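(* The group $H$ is extremely amenable.
   Context: Let $\mathcal{F}_<$ be the class of finite structures $(A,R^A,S^A)$ where $A$ is a fan (finite acyclic connected simple graph with a root, all non-root vertices of degree at most 2) all of whose branches (maximal chains in the tree order from the root) have the same height, $R^A(s,t)$ iff $s=t$ or $t$ is an immediate successor of $s$ in the tree order, and for some enumeration $a_1<\cdots<a_n$ of the branches $S^A(x,y)$ iff $x\in a_i,y\in a_j$ for some $i\le j$. $\mathcal{F}_<$ is a projective Fraïssé family; let $\mathbb{L}_<=(\mathbb{L},R^{\mathbb{L}},S^{\mathbb{L}})$ be its projective Fraïssé limit (a compact zero-dimensional metrizable space with closed relations, characterized by: every member of $\mathcal{F}_<$ is an image of it under a structure-preserving continuous surjection (epimorphism); every continuous map to a finite discrete space factors through an epimorphism onto a member of $\mathcal{F}_<$; any two epimorphisms onto the same member of $\mathcal{F}_<$ differ by precomposition with an automorphism). The symmetrization $R^{\mathbb{L}}_S$ of $R^{\mathbb{L}}$ is an equivalence relation and the quotient $L=\mathbb{L}/R^{\mathbb{L}}_S$ is homeomorphic to the Lelek fan (the unique non-degenerate subcontinuum of the Cantor fan with a dense set of endpoints); $\pi:\mathbb{L}\to L$ is the quotient map. Every $h\in\mathrm{Aut}(\mathbb{L}_<)$ induces a homeomorphism $h^*$ of $L$ with $h^*\circ\pi=\pi\circ h$. $H(L)$ is the homeomorphism group of $L$ with the compact-open topology, and $H$ is the closure in $H(L)$ of $\{h^*:h\in\mathrm{Aut}(\mathbb{L}_<)\}$. A topological group is extremely amenable if every continuous action on a compact Hausdorff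 space has a fixed point. *)

theory Defs
  imports
    "HOL-Analysis.Analysis"
    "HOL-Algebra.Group_Action"
    "Graph_Theory.Digraph_Component_Vwalk"
begin

section \<open>Topological structures with two binary relations\<close>

record 'a rel_struct =
  points :: "'a topology"
  rel_R :: "'a rel"
  rel_S :: "'a rel"

definition topological_structure :: "'a rel_struct \<Rightarrow> bool" where
  "topological_structure M \<longleftrightarrow>
     compact_space (points M) \<and> points M dim_le 0 \<and> metrizable_space (points M) \<and>
     closedin (prod_topology (points M) (points M)) (rel_R M) \<and>
     closedin (prod_topology (points M) (points M)) (rel_S M)"

text \<open>
  Epimorphisms are taken in the sense of projective Fraisse theory (Irwin and Solecki):
  a relation holds in the target iff it holds between some preimages, that is, the relations
  of the target are exactly the images of the relations of the source.
\<close>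

definition epimorphism :: "('a \<Rightarrow> 'b) \<Rightarrow> 'a rel_struct \<Rightarrow> 'b rel_struct \<Rightarrow> bool" where
  "epimorphism f M N \<longleftrightarrow>
     continuous_map (points M) (points N) f \<and>
     f ` topspace (points M) = topspace (points N) \<and>
     rel_R N = map_prod f f ` rel_R M \<and>
     rel_S N = map_prod f f ` rel_S M"

text \<open>Isomorphisms are the bijective epimorphisms; since the spaces concerned are compact
  Hausdorff, these are homeomorphisms that preserve and reflect both relations.\<close>

definition automorphism :: "'a rel_struct \<Rightarrow> ('a \<Rightarrow> 'a) \<Rightarrow> bool" where
  "automorphism M h \<longleftrightarrow> epimorphism h M M \<and> inj_on h (topspace (points M))"

text \<open>A finite discrete space may be taken to consist of natural numbers, and likewise
  a class of finite structures is given by its members with vertices in \<^typ>\<open>nat\<close>.\<close>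

definition projective_Fraisse_limit :: "nat rel_struct set \<Rightarrow> 'a rel_struct \<Rightarrow> bool" where
  "projective_Fraisse_limit \<F> M \<longleftrightarrow>
     topological_structure M \<and>
     (\<forall>A\<in>\<F>. \<exists>f. epimorphism f M A) \<and>
     (\<forall>(X :: nat set) g. finite X \<longrightarrow> continuous_map (points M) (discrete_topology X) g \<longrightarrow>
        (\<exists>A\<in>\<F>. \<exists>f g'. epimorphism f M A \<and> g' \<in> topspace (points A) \<rightarrow> X \<and>
           (\<forall>x\<in>topspace (points M). g x = g' (f x)))) \<and>
     (\<forall>A\<in>\<F>. \<forall>f1 f2. epimorphism f1 M A \<longrightarrow> epimorphism f2 M A \<longrightarrow>
        (\<exists>h. automorphism M h \<and> (\<forall>x\<in>topspace (points M). f2 x = f1 (h x))))"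


section \<open>Ordered fans\<close>

text \<open>
  The locale \<^locale>\<open>pair_graph\<close> describes finite simple undirected graphs as symmetric
  irreflexive digraphs.  In such a digraph every edge, traversed back and forth, is a
  directed cycle of length 2, so undirected acyclicity excludes cycles of length at least 3,
  and the degree of a vertex is its out-degree.
\<close>

definition fan :: "'a pair_pre_digraph \<Rightarrow> 'a \<Rightarrow> bool" where
  "fan G r \<longleftrightarrow>
     pair_graph G \<and> Digraph_Component.connected (with_proj G) \<and>
     (\<nexists>p. pre_digraph.cycle (with_proj G) p \<and> 3 \<le> length p) \<and>
     r \<in> pverts G \<and>
     (\<forall>v\<in>pverts G - {r}. out_degree (with_proj G) v \<le> 2)"

definition tree_le :: "'a pair_pre_digraph \<Rightarrow> 'a \<Rightarrow> 'a \<Rightarrow> 'a \<Rightarrow> bool" where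
  "tree_le G r s t \<longleftrightarrow>
     (\<exists>p. vpath p (with_proj G) \<and> hd p = r \<and> last p = t \<and> s \<in> set p)"

definition immediate_successor :: "'a pair_pre_digraph \<Rightarrow> 'a \<Rightarrow> 'a \<Rightarrow> 'a \<Rightarrow> bool" where
  "immediate_successor G r s t \<longleftrightarrow>
     tree_le G r s t \<and> s \<noteq> t \<and>
     (\<nexists>u. u \<noteq> s \<and> u \<noteq> t \<and> tree_le G r s u \<and> tree_le G r u t)"

definition branches :: "'a pair_pre_digraph \<Rightarrow> 'a \<Rightarrow> 'a set set" where
  "branches G r = {b. pred_on.maxchain (pverts G) (tree_le G r) b}"

definition height :: "'a set \<Rightarrow> nat" where
  "height b = card b - 1"

text \<open>The list \<open>bs\<close> is the enumeration of the branches.\<close>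

definition ordered_fan :: "'a rel_struct \<Rightarrow> bool" where
  "ordered_fan A \<longleftrightarrow>
     (\<exists>G r bs.
        fan G r \<and>
        (\<forall>b\<in>branches G r. \<forall>c\<in>branches G r. height b = height c) \<and>
        distinct bs \<and> set bs = branches G r \<and>
        points A = discrete_topology (pverts G) \<and>
        rel_R A = {(s, t). s \<in> pverts G \<and> t \<in> pverts G \<and>
                           (s = t \<or> immediate_successor G r s t)} \<and>
        rel_S A = {(x, y). \<exists>i j. i \<le> j \<and> j < length bs \<and> x \<in> bs ! i \<and> y \<in> bs ! j})"


section \<open>Homeomorphism groups and extreme amenability\<close>

definition homeo_group :: "'a topology \<Rightarrow> ('a \<Rightarrow> 'a) monoid" where
  "homeo_group X =
     BijGroup (topspace X) \<lparr>carrier := {f \<in> Bij (topspace X). homeomorphic_map X X f}\<rparr>"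

definition compact_open :: "'a topology \<Rightarrow> ('a \<Rightarrow> 'a) topology" where
  "compact_open X = topology_generated_by
     {{f \<in> carrier (homeo_group X). f ` K \<subseteq> U} | K U. compactin X K \<and> openin X U}"

definition topological_group :: "('g, 'm) monoid_scheme \<Rightarrow> 'g topology \<Rightarrow> bool" where
  "topological_group G T \<longleftrightarrow>
     group G \<and> topspace T = carrier G \<and>
     continuous_map (prod_topology T T) T (\<lambda>(x, y). x \<otimes>\<^bsub>G\<^esub> y) \<and>
     continuous_map T T (\<lambda>x. inv\<^bsub>G\<^esub> x)"

text \<open>The type argument is the universe of the compact spaces acted upon; a statement for a
  type variable in this place therefore covers all compact Hausdorff spaces.\<close>

definition extremely_amenable ::
    "'x itself \<Rightarrow> ('g, 'm) monoid_scheme \<Rightarrow> 'g topology \<Rightarrow> bool" where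
  "extremely_amenable TYPE('x) G T \<longleftrightarrow>
     topological_group G T \<and>
     (\<forall>(X :: 'x topology) \<phi>.
        compact_space X \<longrightarrow> Hausdorff_space X \<longrightarrow> topspace X \<noteq> {} \<longrightarrow>
        group_action G (topspace X) \<phi> \<longrightarrow>
        continuous_map (prod_topology T X) X (\<lambda>(g, x). \<phi> g x) \<longrightarrow>
        (\<exists>x\<in>topspace X. \<forall>g\<in>carrier G. \<phi> g x = x))"


section \<open>The quotient and the group \<open>H\<close>\<close>

definition quotient_topology :: "'a topology \<Rightarrow> ('a \<Rightarrow> 'b) \<Rightarrow> 'b topology" where
  "quotient_topology X f =
     topology (\<lambda>U. U \<subseteq> f ` topspace X \<and> openin X {x \<in> topspace X. f x \<in> U})"

lemma openin_quotient_topology: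
  "openin (quotient_topology X f) U \<longleftrightarrow>
     U \<subseteq> f ` topspace X \<and> openin X {x \<in> topspace X. f x \<in> U}"
proof -
  have "istopology (\<lambda>U. U \<subseteq> f ` topspace X \<and> openin X {x \<in> topspace X. f x \<in> U})"
    unfolding istopology_def
  proof (intro conjI allI impI)
    fix S T
    assume "S \<subseteq> f ` topspace X \<and> openin X {x \<in> topspace X. f x \<in> S}"
      and "T \<subseteq> f ` topspace X \<and> openin X {x \<in> topspace X. f x \<in> T}"
    moreover have "{x \<in> topspace X. f x \<in> S \<inter> T} =
        {x \<in> topspace X. f x \<in> S} \<inter> {x \<in> topspace X. f x \<in> T}"
      by auto
    ultimately show "S \<inter> T \<subseteq> f ` topspace X" "openin X {x \<in> topspace X. f x \<in> S \<inter> T}"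
      by auto
  next
    fix \<K>
    assume *: "\<forall>K\<in>\<K>. K \<subseteq> f ` topspace X \<and> openin X {x \<in> topspace X. f x \<in> K}"
    moreover have "{x \<in> topspace X. f x \<in> \<Union>\<K>} = (\<Union>K\<in>\<K>. {x \<in> topspace X. f x \<in> K})"
      by auto
    ultimately show "openin X {x \<in> topspace X. f x \<in> \<Union>\<K>}"
      by (metis (no_types, lifting) openin_Union imageE)
    show "\<Union>\<K> \<subseteq> f ` topspace X"
      using * by blast
  qed
  then show ?thesis
    unfolding quotient_topology_def by simp
qed

lemma quotient_map_quotient_topology: "quotient_map X (quotient_topology X f) f"
proof -
  have "{x \<in> topspace X. f x \<in> f ` topspace X} = topspace X"
    by auto
  then have "openin (quotient_topology X f) (f ` topspace X)"
    by (simp add: openin_quotient_topology)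
  then have "topspace (quotient_topology X f) = f ` topspace X"
    by (meson openin_quotient_topology openin_subset openin_topspace subset_antisym)
  then show ?thesis
    by (simp add: quotient_map_def openin_quotient_topology)
qed

definition quotient_proj :: "'a rel_struct \<Rightarrow> 'a \<Rightarrow> 'a set" where
  "quotient_proj M x = (rel_R M \<union> (rel_R M)\<inverse>) `` {x}"

definition quotient_space :: "'a rel_struct \<Rightarrow> 'a set topology" where
  "quotient_space M = quotient_topology (points M) (quotient_proj M)"

definition induced_homeos :: "'a rel_struct \<Rightarrow> ('a set \<Rightarrow> 'a set) set" where
  "induced_homeos M =
     {g \<in> carrier (homeo_group (quotient_space M)).
        \<exists>h. automorphism M h \<and>
            (\<forall>x\<in>topspace (points M). g (quotient_proj M x) = quotient_proj M (h x))}"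

definition H_group :: "'a rel_struct \<Rightarrow> ('a set \<Rightarrow> 'a set) monoid" where
  "H_group M = homeo_group (quotient_space M)
     \<lparr>carrier := compact_open (quotient_space M) closure_of induced_homeos M\<rparr>"

definition H_topology :: "'a rel_struct \<Rightarrow> ('a set \<Rightarrow> 'a set) topology" where
  "H_topology M = subtopology (compact_open (quotient_space M)) (carrier (H_group M))"

end

theory Submission
  imports Defs
begin

text \<open>
  By compactness, a fixed point of the dense subgroup of induced homeomorphisms exists once the
  ordered fans have the dual Ramsey property: if there were none, colouring automorphisms \<open>h\<close> by the
  position of \<open>h x\<^sub>0\<close> in a suitable finite open cover would contradict it.

  An epimorphism between fans is a word whose letters are labelled monotone step functions, one for
  each branch. For the Ramsey property one takes ultrafilters \<open>V i\<close> on words of height \<open>i\<close> that are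
  coherent (\<open>d\<close> maps \<open>V i\<close> to \<open>V (d i)\<close> for every step function \<open>d\<close>) and satisfy
  \<open>V i \<star> V j = V (max i j)\<close>, as in the proof of Gowers' theorem. Tensor powers of a nonprincipal
  ultrafilter give a coherent family of one-letter words, and idempotents in compact semigroups of
  coherent families give the second property. A fusion argument then yields the blocks of a
  monochromatic subsystem. Words may use arbitrarily many branches and heights; one more ultrafilter
  limit over the size of the fan brings the colouring back to finite fans.

  Applied to a refinement that doubles every height, homogeneity also shows that a point of the limit
  has at most one other point related to it, so that the quotient is a compact Hausdorff space.
\<close>

section \<open>Idempotents in compact semigroups\<close>

text \<open>A map of the target fan acts on words from the left: it replaces every letter
  \<open>F\<close> of a block by \<open>d \<circ> F\<close>, where \<open>d\<close> depends on the
  block only. Each block is chosen before \<open>d\<close> is known and has to serve all of the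
  finitely many \<open>d\<close> at once. Coherence controls the outcome: if the block is generic of
  height \<open>m\<close>, that is, drawn along \<open>V m\<close>, its image is generic of height
  \<open>d m\<close>. Absorption makes this image harmless: put in front of a generic word of height
  \<open>n\<close>, it leaves a generic word of height \<open>n\<close>. Surjectivity decides when a
  target branch is finished: its letters may end once some \<open>d\<close> with
  \<open>d m = n\<close> has occurred there, because a generic word of height \<open>n\<close> has
  then been spent on it.

  In the fixed point argument, automorphisms \<open>h\<close> and \<open>h'\<close> with
  \<open>\<phi> \<circ> h = \<phi> \<circ> h'\<close> differ by a left factor that preserves
  \<open>\<phi>\<close>. Every neighbourhood of the identity contains the homeomorphisms induced by
  all such factors, for a suitable \<open>\<phi>\<close>; so it is enough to control automorphisms
  up to composition with an epimorphism onto a finite fan.\<close>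

lemma compact_UNIV_fun:
  assumes "compact (UNIV :: 'b::topological_space set)"
  shows "compact (UNIV :: ('a \<Rightarrow> 'b) set)"
proof -
  have "compact_space (product_topology (\<lambda>_::'a. euclidean :: 'b topology) UNIV)"
    using assms unfolding compact_space_product_topology by (simp add: compact_space_def)
  then show ?thesis
    by (simp add: euclidean_product_topology compact_space_def)
qed

lemma Hausdorff_space_fun:
  assumes "Hausdorff_space (euclidean :: 'b::topological_space topology)"
  shows "Hausdorff_space (euclidean :: ('a \<Rightarrow> 'b) topology)"
  using assms Hausdorff_space_product_topology[of "\<lambda>_::'a. euclidean :: 'b topology" UNIV]
  by (simp add: euclidean_product_topology)

lemma chain_Inter_mem:
  assumes "finite F" "F \<noteq> {}" "\<And>A B. A \<in> F \<Longrightarrow> B \<in> F \<Longrightarrow> A \<subseteq> B \<or> B \<subseteq> A"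
  shows "\<Inter>F \<in> F"
  using assms
proof (induction F rule: finite_ne_induct)
  case (insert A F)
  then have "\<Inter>F \<in> F" by blast
  with insert.prems[of A "\<Inter>F"] show ?case
    by (auto simp: Int_absorb1 Int_absorb2)
qed simp

text \<open>By compactness a chain of nonempty closed subsemigroups has nonempty intersection, which
  is again one, so Zorn's lemma applies downwards.\<close>

lemma minimal_closed_subsemigroup:
  fixes m :: "'a::topological_space \<Rightarrow> 'a \<Rightarrow> 'a"
  assumes cpt: "compact (UNIV :: 'a set)" and C: "closed C" "C \<noteq> {}"
    and mult: "\<And>x y. x \<in> C \<Longrightarrow> y \<in> C \<Longrightarrow> m x y \<in> C"
  shows "\<exists>A\<subseteq>C. closed A \<and> A \<noteq> {} \<and> (\<forall>x\<in>A. \<forall>y\<in>A. m x y \<in> A) \<and>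
    (\<forall>B\<subseteq>A. closed B \<longrightarrow> B \<noteq> {} \<longrightarrow> (\<forall>x\<in>B. \<forall>y\<in>B. m x y \<in> B) \<longrightarrow> B = A)"
proof -
  define S where "S = {A. A \<subseteq> C \<and> closed A \<and> A \<noteq> {} \<and> (\<forall>x\<in>A. \<forall>y\<in>A. m x y \<in> A)}"
  have "C \<in> S" using C mult by (auto simp: S_def)
  \<comment> \<open>Zorn's lemma is stated for maximal elements, so the family is replaced by that
    of the complements; unions of chains there are complements of intersections.\<close>
  have "\<exists>M\<in>uminus ` S. \<forall>X\<in>uminus ` S. M \<subseteq> X \<longrightarrow> X = M"
  proof (rule subset_Zorn_nonempty)
    show "uminus ` S \<noteq> {}" using \<open>C \<in> S\<close> by blast
  next
    fix \<C> assume ne: "\<C> \<noteq> {}" and ch: "subset.chain (uminus ` S) \<C>"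
    define \<D> where "\<D> = uminus ` \<C>"
    have DS: "\<D> \<subseteq> S" using ch by (force simp: \<D>_def subset.chain_def)
    have Dch: "A \<subseteq> B \<or> B \<subseteq> A" if "A \<in> \<D>" "B \<in> \<D>" for A B
    proof -
      have "- A \<in> \<C>" "- B \<in> \<C>" using that by (auto simp: \<D>_def)
      then have "(\<subset>)\<^sup>=\<^sup>= (- A) (- B) \<or> (\<subset>)\<^sup>=\<^sup>= (- B) (- A)"
        by (rule subset.chain_total[OF ch])
      then show ?thesis by auto
    qed
    have Dne: "\<D> \<noteq> {}" using ne by (simp add: \<D>_def)
    have "UNIV \<inter> \<Inter>\<D> \<noteq> {}"
    proof (rule compact_imp_fip[OF cpt])
      show "closed T" if "T \<in> \<D>" for T using that DS by (auto simp: S_def)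
      fix F assume F: "finite F" "F \<subseteq> \<D>"
      show "UNIV \<inter> \<Inter>F \<noteq> {}"
      proof (cases "F = {}")
        case False
        then have "\<Inter>F \<in> F" using chain_Inter_mem[OF F(1)] Dch F(2) by blast
        then show ?thesis using F DS by (auto simp: S_def)
      qed simp
    qed
    moreover have "\<Inter>\<D> \<subseteq> C"
      using DS Dne unfolding S_def by blast
    moreover have "closed (\<Inter>\<D>)"
      using DS by (auto simp: S_def intro!: closed_Inter)
    moreover have "\<forall>x\<in>\<Inter>\<D>. \<forall>y\<in>\<Inter>\<D>. m x y \<in> \<Inter>\<D>"
      using DS by (fastforce simp: S_def)
    ultimately have "\<Inter>\<D> \<in> S" by (simp add: S_def)
    moreover have "\<Union>\<C> = - \<Inter>\<D>" by (auto simp: \<D>_def)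
    ultimately show "\<Union>\<C> \<in> uminus ` S" by blast
  qed
  then obtain A where A: "A \<in> S" and min': "\<forall>X\<in>uminus ` S. - A \<subseteq> X \<longrightarrow> X = - A"
    by auto
  have min: "- B = - A" if "B \<in> S" "- A \<subseteq> - B" for B
    using min' that by (meson imageI)
  have "B = A" if "B \<subseteq> A" "closed B" "B \<noteq> {}" "\<forall>x\<in>B. \<forall>y\<in>B. m x y \<in> B" for B
  proof -
    have "B \<subseteq> C" using A that(1) by (auto simp: S_def)
    then have "B \<in> S" using that by (simp add: S_def)
    then show ?thesis using min[of B] that(1) by simp
  qed
  then show ?thesis using A unfolding S_def by (intro exI[of _ A]) simp
qed

lemma closed_fiber:
  fixes f :: "'a::topological_space \<Rightarrow> 'a"
  assumes "Hausdorff_space (euclidean :: 'a topology)" "continuous_on UNIV f"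
  shows "closed {x. f x = a}"
proof -
  have "closed {a}"
    using assms(1) closedin_Hausdorff_singleton[of euclidean a] by simp
  then have "closed (f -` {a})" by (rule closed_vimage) (rule assms)
  then show ?thesis by (simp add: vimage_def)
qed

text \<open>The Ellis-Numakura lemma. For \<open>a\<close> in a minimal closed subsemigroup
  \<open>A\<close>, the translate of \<open>A\<close> by \<open>a\<close> on the right is a closed
  subsemigroup, hence all of \<open>A\<close>; so some \<open>x\<close> in \<open>A\<close> has
  \<open>m x a = a\<close>. The set of these \<open>x\<close> is again a closed subsemigroup, hence
  contains \<open>a\<close>. Only right translations need to be continuous.\<close>

theorem idempotent_in_compact_semigroup:
  fixes m :: "'a::topological_space \<Rightarrow> 'a \<Rightarrow> 'a"
  assumes cpt: "compact (UNIV :: 'a set)" and haus: "Hausdorff_space (euclidean :: 'a topology)"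
    and C: "closed C" "C \<noteq> {}" "\<And>x y. x \<in> C \<Longrightarrow> y \<in> C \<Longrightarrow> m x y \<in> C"
    and assoc: "\<And>x y z. m (m x y) z = m x (m y z)"
    and cont: "\<And>y. continuous_on UNIV (\<lambda>x. m x y)"
  shows "\<exists>e\<in>C. m e e = e"
proof -
  have "\<exists>A\<subseteq>C. closed A \<and> A \<noteq> {} \<and> (\<forall>x\<in>A. \<forall>y\<in>A. m x y \<in> A) \<and>
    (\<forall>B\<subseteq>A. closed B \<longrightarrow> B \<noteq> {} \<longrightarrow> (\<forall>x\<in>B. \<forall>y\<in>B. m x y \<in> B) \<longrightarrow> B = A)"
    by (rule minimal_closed_subsemigroup[OF cpt C])
  then obtain A where A: "A \<subseteq> C" "closed A" "A \<noteq> {}" and A4: "\<forall>x\<in>A. \<forall>y\<in>A. m x y \<in> A"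
    and min: "\<forall>B\<subseteq>A. closed B \<longrightarrow> B \<noteq> {} \<longrightarrow> (\<forall>x\<in>B. \<forall>y\<in>B. m x y \<in> B) \<longrightarrow> B = A"
    by (elim exE conjE) (rule that)
  obtain a where a: "a \<in> A" using A by blast
  have "compact A" using cpt A(2) compact_Int_closed[of UNIV A] by simp
  then have "compact ((\<lambda>x. m x a) ` A)"
    using cont compact_continuous_image continuous_on_subset by blast
  then have "closed ((\<lambda>x. m x a) ` A)"
    using compactin_imp_closedin[OF haus] by simp
  moreover have "\<forall>x\<in>(\<lambda>x. m x a) ` A. \<forall>y\<in>(\<lambda>x. m x a) ` A. m x y \<in> (\<lambda>x. m x a) ` A"
  proof (intro ballI, elim imageE)
    fix x y b c assume "x = m b a" "b \<in> A" "y = m c a" "c \<in> A"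
    then have "m x y = m (m (m b a) c) a" "m (m b a) c \<in> A" using A4 a by (simp_all add: assoc)
    then show "m x y \<in> (\<lambda>x. m x a) ` A" by (rule image_eqI)
  qed
  moreover have "(\<lambda>x. m x a) ` A \<subseteq> A" "(\<lambda>x. m x a) ` A \<noteq> {}"
    using A4 a by auto
  ultimately have "(\<lambda>x. m x a) ` A = A"
    using min[THEN spec, of "(\<lambda>x. m x a) ` A"] by simp
  then obtain b where b: "b \<in> A" "m b a = a" using a by (metis imageE)
  have "closed {x\<in>A. m x a = a}"
    using closed_Int[OF A(2) closed_fiber[OF haus cont[of a], of a]] by (simp add: Int_def)
  moreover have "\<forall>x\<in>{x\<in>A. m x a = a}. \<forall>y\<in>{x\<in>A. m x a = a}. m x y \<in> {x\<in>A. m x a = a}"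
    using A4 by (simp add: assoc)
  moreover have "{x\<in>A. m x a = a} \<noteq> {}" "{x\<in>A. m x a = a} \<subseteq> A" using b by auto
  ultimately have "{x\<in>A. m x a = a} = A"
    using min[THEN spec, of "{x\<in>A. m x a = a}"] by simp
  then show ?thesis using a A(1) by blast
qed

section \<open>Ultrafilters as Boolean quantifiers\<close>

text \<open>A Boolean homomorphism from predicates to truth values, that is, an ultrafilter read as
  the quantifier "for almost all". Limits of limits become nested quantifiers, tensor products are
  associative by unfolding, and the ultrafilters form a subset of a power of
  \<open>bool\<close>.\<close>

definition ultra :: "(('s \<Rightarrow> bool) \<Rightarrow> bool) \<Rightarrow> bool" where
  "ultra Q \<longleftrightarrow> (\<forall>P. Q (\<lambda>x. \<not> P x) = (\<not> Q P)) \<and> (\<forall>P R. Q (\<lambda>x. P x \<and> R x) = (Q P \<and> Q R))"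

lemma ultra_not: "ultra Q \<Longrightarrow> Q (\<lambda>x. \<not> P x) \<longleftrightarrow> \<not> Q P"
  and ultra_conj: "ultra Q \<Longrightarrow> Q (\<lambda>x. P x \<and> R x) \<longleftrightarrow> Q P \<and> Q R"
  by (auto simp: ultra_def)

lemma ultra_False: "ultra Q \<Longrightarrow> \<not> Q (\<lambda>_. False)"
  using ultra_conj[of Q "\<lambda>_. False" "\<lambda>_. \<not> False"] ultra_not[of Q "\<lambda>_. False"] by auto

lemma ultra_True: "ultra Q \<Longrightarrow> Q (\<lambda>_. True)"
  using ultra_not[of Q "\<lambda>_. False"] ultra_False[of Q] by auto

lemma ultra_mono:
  assumes "ultra Q" "Q P" "\<And>x. P x \<Longrightarrow> R x"
  shows "Q R"
proof -
  have "(\<lambda>x. P x \<and> R x) = P" using assms(3) by auto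
  then show ?thesis using ultra_conj[OF assms(1), of P R] assms(2) by simp
qed

lemma ultra_mp:
  assumes "ultra Q" "Q P" "Q R" "\<And>x. P x \<Longrightarrow> R x \<Longrightarrow> S x"
  shows "Q S"
  using ultra_mono[OF assms(1), of "\<lambda>x. P x \<and> R x" S] assms by (simp add: ultra_conj)

lemma ultra_cong:
  assumes "ultra Q" "Q E" "\<And>x. E x \<Longrightarrow> P x = R x"
  shows "Q P = Q R"
proof
  show "Q R" if "Q P" by (rule ultra_mp[of Q E P R, OF assms(1,2) that]) (simp add: assms(3))
  show "Q P" if "Q R" by (rule ultra_mp[of Q E R P, OF assms(1,2) that]) (simp add: assms(3))
qed

lemma ultra_const: "ultra Q \<Longrightarrow> Q (\<lambda>_. b) = b"
  by (cases b) (auto simp: ultra_True ultra_False)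

lemma ultra_Ball:
  assumes "ultra Q" "finite A" "\<And>a. a \<in> A \<Longrightarrow> Q (P a)"
  shows "Q (\<lambda>x. \<forall>a\<in>A. P a x)"
  using assms(2,3)
proof (induction A)
  case empty then show ?case using ultra_True[OF assms(1)] by simp
next
  case (insert a A) then show ?case by (simp add: ultra_conj[OF assms(1)])
qed

lemma ultra_exists:
  assumes "ultra Q" "Q P"
  shows "\<exists>x. P x"
proof (rule ccontr)
  assume "\<nexists>x. P x"
  then have "P = (\<lambda>_. False)" by auto
  then show False using assms ultra_False[of Q] by simp
qed

lemma ultra_finite_range:
  assumes "ultra Q" "finite (range f)"
  shows "\<exists>c. Q (\<lambda>x. f x = c)"
proof (rule ccontr)
  assume "\<nexists>c. Q (\<lambda>x. f x = c)"
  then have "Q (\<lambda>x. \<not> f x = c)" for c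
    using ultra_not[OF assms(1), of "\<lambda>x. f x = c"] by simp
  then have "Q (\<lambda>x. \<forall>c\<in>range f. \<not> f x = c)"
    by (rule ultra_Ball[of Q "range f" "\<lambda>c x. \<not> f x = c", OF assms])
  then have "\<exists>x. \<forall>c\<in>range f. \<not> f x = c"
    by (rule ultra_exists[of Q "\<lambda>x. \<forall>c\<in>range f. \<not> f x = c", OF assms(1)])
  then show False by blast
qed

lemma ultra_point: "ultra (\<lambda>P. P a)" by (simp add: ultra_def)

lemma ultra_bind:
  assumes "ultra Q" "\<And>x. ultra (R x)"
  shows "ultra (\<lambda>P. Q (\<lambda>x. R x (\<lambda>y. P (f x y))))"
  using assms unfolding ultra_def by simp

lemma ultra_map: "ultra Q \<Longrightarrow> ultra (\<lambda>P. Q (\<lambda>x. P (f x)))"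
  by (simp add: ultra_def)

lemma continuous_on_apply2: "continuous_on UNIV (\<lambda>V. V i P :: 'b::topological_space)"
  by (intro continuous_on_product_then_coordinatewise[where f = "\<lambda>V. V i"] continuous_on_product_coordinates)

lemma open_Collect_bool:
  fixes f :: "'a::topological_space \<Rightarrow> bool"
  assumes "continuous_on UNIV f"
  shows "open {x. f x}" "closed {x. f x}"
proof -
  have "open (f -` {True})" by (rule open_vimage[OF open_discrete assms])
  moreover have "open (f -` {False})" by (rule open_vimage[OF open_discrete assms])
  moreover have "f -` {True} = {x. f x}" "f -` {False} = - {x. f x}" by auto
  ultimately show "open {x. f x}" "closed {x. f x}" by (simp_all add: closed_def)
qed

text \<open>Each instance of the two axioms compares finitely many coordinates \<open>Q P\<close>,
  which are continuous with values in a discrete space. Such a condition is clopen, and closedness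
  survives the intersection over all instances.\<close>

lemma closed_ultra: "closed {Q. ultra (Q :: ('s \<Rightarrow> bool) \<Rightarrow> bool)}"
proof -
  have op: "open {Q :: ('s \<Rightarrow> bool) \<Rightarrow> bool. Q P}" and cl: "closed {Q :: ('s \<Rightarrow> bool) \<Rightarrow> bool. Q P}" for P
    by (rule open_Collect_bool; simp)+
  have 1: "closed {Q :: ('s \<Rightarrow> bool) \<Rightarrow> bool. (Q (\<lambda>x. \<not> P x) \<longrightarrow> \<not> Q P) \<and> (\<not> Q P \<longrightarrow> Q (\<lambda>x. \<not> P x))}" for P
    by (intro closed_Collect_conj closed_Collect_imp closed_Collect_neg open_Collect_neg op cl)
  have 2: "closed {Q :: ('s \<Rightarrow> bool) \<Rightarrow> bool. (Q (\<lambda>x. P x \<and> R x) \<longrightarrow> Q P \<and> Q R) \<and>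
      (Q P \<and> Q R \<longrightarrow> Q (\<lambda>x. P x \<and> R x))}" for P R
    by (intro closed_Collect_conj closed_Collect_imp open_Collect_conj op cl)
  have "{Q :: ('s \<Rightarrow> bool) \<Rightarrow> bool. ultra Q} =
      {Q. (\<forall>P. (Q (\<lambda>x. \<not> P x) \<longrightarrow> \<not> Q P) \<and> (\<not> Q P \<longrightarrow> Q (\<lambda>x. \<not> P x))) \<and>
      (\<forall>P R. (Q (\<lambda>x. P x \<and> R x) \<longrightarrow> Q P \<and> Q R) \<and> (Q P \<and> Q R \<longrightarrow> Q (\<lambda>x. P x \<and> R x)))}"
    by (simp only: ultra_def iff_conv_conj_imp)
  also have "closed \<dots>" by (intro closed_Collect_conj closed_Collect_all 1 2)
  finally show ?thesis .
qed

lemma compact_UNIV_bool: "compact (UNIV :: bool set)"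
  by (rule finite_imp_compact) simp

lemma Hausdorff_space_bool: "Hausdorff_space (euclidean :: bool topology)"
proof -
  have "\<exists>U V. open U \<and> open V \<and> x \<in> U \<and> y \<in> V \<and> disjnt U V" if "x \<noteq> y" for x y :: bool
    using that by (intro exI[of _ "{x}"] exI[of _ "{y}"]) (auto simp: open_discrete)
  then show ?thesis unfolding Hausdorff_space_def by simp
qed

text \<open>By compactness: the sets \<open>C n\<close> are closed, and finitely many of them share
  the principal ultrafilter at a large enough point.\<close>

lemma nonprincipal_ultra:
  obtains U :: "(nat \<Rightarrow> bool) \<Rightarrow> bool" where "ultra U" "\<And>n. U (\<lambda>x. n \<le> x)"
proof -
  define C where "C n = {Q. ultra Q \<and> Q (\<lambda>x::nat. n \<le> x)}" for n
  have cl: "closed (C n)" for n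
  proof -
    show ?thesis unfolding C_def
      by (intro closed_Collect_conj closed_ultra open_Collect_bool(2)) simp_all
  qed
  have "UNIV \<inter> (\<Inter>n\<in>UNIV. C n) \<noteq> {}"
  proof (rule compact_imp_fip_image[OF _ cl])
    show "compact (UNIV :: ((nat \<Rightarrow> bool) \<Rightarrow> bool) set)"
      by (intro compact_UNIV_fun compact_UNIV_bool)
    fix I :: "nat set" assume "finite I"
    then obtain b where "\<forall>i\<in>I. i \<le> b" using finite_nat_set_iff_bounded_le by blast
    then have "(\<lambda>P. P b) \<in> (\<Inter>n\<in>I. C n)" by (auto simp: C_def ultra_point)
    then show "UNIV \<inter> (\<Inter>n\<in>I. C n) \<noteq> {}" by blast
  qed
  then obtain U where "\<And>n. U \<in> C n" by blast
  then show thesis using that by (auto simp: C_def)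
qed

section \<open>Words of step functions\<close>

text \<open>The self-maps of an infinite branch that fix the root and send an edge to an edge or a
  point. They are total on \<open>nat\<close>, with no bound on time or height, so that words of all
  sizes have one type.\<close>

definition steps :: "(nat \<Rightarrow> nat) set" where
  "steps = {d. d 0 = 0 \<and> (\<forall>t. d (Suc t) = d t \<or> d (Suc t) = Suc (d t))}"

lemma steps_0: "d \<in> steps \<Longrightarrow> d 0 = 0"
  and steps_Suc: "d \<in> steps \<Longrightarrow> d (Suc t) = d t \<or> d (Suc t) = Suc (d t)"
  by (auto simp: steps_def)

lemma steps_mono: "d \<in> steps \<Longrightarrow> s \<le> t \<Longrightarrow> d s \<le> d t"
proof (rule lift_Suc_mono_le[of d])
  fix n assume "d \<in> steps"
  then show "d n \<le> d (Suc n)" using steps_Suc[of d n] by auto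
qed

lemma steps_comp: "d \<in> steps \<Longrightarrow> e \<in> steps \<Longrightarrow> d \<circ> e \<in> steps"
  unfolding steps_def by (auto, metis)

type_synonym wrd = "(nat \<Rightarrow> nat) list"

text \<open>Composition on the left changes the heights that the letters attain and leaves their
  domain alone; this is how a map of the target acts on a word.\<close>

definition act :: "(nat \<Rightarrow> nat) \<Rightarrow> wrd \<Rightarrow> wrd" where
  "act d w = map (\<lambda>F. d \<circ> F) w"

lemma act_append: "act d (v @ w) = act d v @ act d w" by (simp add: act_def)

definition has_level :: "nat \<Rightarrow> wrd \<Rightarrow> bool" where
  "has_level i w \<longleftrightarrow> (\<forall>F\<in>set w. F \<in> steps \<and> (\<forall>t. F t \<le> i)) \<and> (\<exists>F\<in>set w. \<exists>t. F t = i)"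

lemma has_level_append:
  assumes "has_level i v" "has_level j w"
  shows "has_level (max i j) (v @ w)"
proof -
  have "F t \<le> max i j" if "F \<in> set v \<union> set w" for F t
    using assms that by (fastforce simp: has_level_def le_max_iff_disj)
  moreover have "\<exists>F\<in>set v \<union> set w. \<exists>t. F t = max i j"
    using assms unfolding has_level_def max_def by (cases "i \<le> j") auto
  ultimately show ?thesis using assms unfolding has_level_def by auto
qed

type_synonym quant = "(wrd \<Rightarrow> bool) \<Rightarrow> bool"

text \<open>The product of the Stone-Cech compactification of the monoid of words.\<close>

definition qmult :: "quant \<Rightarrow> quant \<Rightarrow> quant" (infixl "\<star>" 70) where
  "Q \<star> R = (\<lambda>P. Q (\<lambda>x. R (\<lambda>y. P (x @ y))))"

lemma qmult_assoc: "(Q \<star> R) \<star> S = Q \<star> (R \<star> S)"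
  by (simp add: qmult_def)

lemma ultra_qmult: "ultra Q \<Longrightarrow> ultra R \<Longrightarrow> ultra (Q \<star> R)"
  unfolding qmult_def using ultra_bind[of Q "\<lambda>_. R" "\<lambda>x y. x @ y"] by simp

definition qact :: "(nat \<Rightarrow> nat) \<Rightarrow> quant \<Rightarrow> quant" where
  "qact d Q = (\<lambda>P. Q (\<lambda>x. P (act d x)))"

lemma qact_qmult: "qact d (Q \<star> R) = qact d Q \<star> qact d R"
  by (simp add: qact_def qmult_def act_append)

text \<open>The level condition ensures that almost every word drawn from \<open>V m\<close>
  consists of step functions and attains the height \<open>m\<close>, without which a block could
  not map onto a branch of that height.\<close>

definition coherent :: "(nat \<Rightarrow> quant) set" where
  "coherent = {V. (\<forall>i. ultra (V i) \<and> V i (has_level i)) \<and> (\<forall>d\<in>steps. \<forall>i. qact d (V i) = V (d i))}"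

definition tuple_mult :: "(nat \<Rightarrow> quant) \<Rightarrow> (nat \<Rightarrow> quant) \<Rightarrow> (nat \<Rightarrow> quant)" where
  "tuple_mult V W = (\<lambda>i. V i \<star> W i)"

lemma has_level_qmult:
  assumes "ultra Q" "ultra R" "Q (has_level i)" "R (has_level j)"
  shows "(Q \<star> R) (has_level (max i j))"
  unfolding qmult_def
proof (rule ultra_mono[of Q "has_level i", OF assms(1,3)])
  fix x assume "has_level i x"
  then show "R (\<lambda>y. has_level (max i j) (x @ y))"
    by (intro ultra_mono[of R "has_level j", OF assms(2,4)] has_level_append)
qed

lemma coherent_tuple_mult:
  assumes "V \<in> coherent" "W \<in> coherent"
  shows "tuple_mult V W \<in> coherent"
  using assms has_level_qmult[of "V i" "W i" i i for i]
  by (auto simp: coherent_def tuple_mult_def ultra_qmult qact_qmult)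

text \<open>For fixed \<open>d\<close>, \<open>i\<close> and \<open>P\<close>, the equation between
  \<open>qact d (V i)\<close> and \<open>V (d i)\<close> compares two coordinates of
  \<open>V\<close>, as in \<open>closed_ultra\<close>.\<close>

lemma closed_coherent: "closed coherent"
proof -
  have cl: "closed {V :: nat \<Rightarrow> quant. V i P}" and op: "open {V :: nat \<Rightarrow> quant. V i P}" for i P
    by (rule open_Collect_bool; rule continuous_on_apply2)+
  have 1: "closed {V :: nat \<Rightarrow> quant. ultra (V i)}" for i
    using closed_vimage[OF closed_ultra, of "\<lambda>V. V i"] by (simp add: vimage_def)
  have 2: "closed {V :: nat \<Rightarrow> quant. qact d (V i) = V (d i)}" for d i
  proof -
    have "{V :: nat \<Rightarrow> quant. qact d (V i) = V (d i)} =
      {V. \<forall>P. (V i (\<lambda>x. P (act d x)) \<longrightarrow> V (d i) P) \<and> (V (d i) P \<longrightarrow> V i (\<lambda>x. P (act d x)))}"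
      by (auto simp: qact_def fun_eq_iff)
    also have "closed \<dots>"
      by (intro closed_Collect_all closed_Collect_conj closed_Collect_imp op cl)
    finally show ?thesis .
  qed
  have "coherent = {V. \<forall>i. ultra (V i)} \<inter> {V. \<forall>i. V i (has_level i)} \<inter>
      (\<Inter>d\<in>steps. {V. \<forall>i. qact d (V i) = V (d i)})"
    by (auto simp: coherent_def)
  also have "closed \<dots>"
    by (intro closed_Int closed_INT ballI closed_Collect_all 1 2 cl)
  finally show ?thesis .
qed

text \<open>With \<open>W\<close> fixed, the product evaluated at \<open>i\<close> and
  \<open>P\<close> is the value of \<open>V i\<close> at a predicate determined by \<open>W\<close>
  and \<open>P\<close>, hence a coordinate of \<open>V\<close>.\<close>

lemma continuous_tuple_mult: "continuous_on UNIV (\<lambda>V. tuple_mult V W)"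
  unfolding tuple_mult_def qmult_def
  by (intro continuous_on_coordinatewise_then_product continuous_on_apply2)

lemma tuple_mult_assoc: "tuple_mult (tuple_mult V W) X = tuple_mult V (tuple_mult W X)"
  by (simp add: tuple_mult_def qmult_assoc)

lemma compact_UNIV_tuples: "compact (UNIV :: (nat \<Rightarrow> quant) set)"
  by (intro compact_UNIV_fun compact_UNIV_bool)

lemma Hausdorff_tuples: "Hausdorff_space (euclidean :: (nat \<Rightarrow> quant) topology)"
  by (intro Hausdorff_space_fun Hausdorff_space_bool)

lemma tuple_idempotent:
  assumes "closed C" "C \<noteq> {}" "\<And>V W. V \<in> C \<Longrightarrow> W \<in> C \<Longrightarrow> tuple_mult V W \<in> C"
  obtains V where "V \<in> C" "\<And>i. V i \<star> V i = V i"
proof -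
  have "\<exists>V\<in>C. tuple_mult V V = V"
    by (rule idempotent_in_compact_semigroup[OF compact_UNIV_tuples Hausdorff_tuples assms])
      (auto simp: tuple_mult_assoc continuous_tuple_mult)
  then obtain V where "V \<in> C" "tuple_mult V V = V" by blast
  then show thesis using that[of V] by (metis tuple_mult_def)
qed

section \<open>A coherent family on one-letter words\<close>

definition addjump :: "(nat \<Rightarrow> nat) \<Rightarrow> nat \<Rightarrow> (nat \<Rightarrow> nat)" where
  "addjump F s = (\<lambda>t. F t + of_bool (s \<le> t))"

text \<open>\<open>letter_quant U i\<close> is the \<open>i\<close>-th tensor power of \<open>U\<close>, carried to the step functions with
  \<open>i\<close> jumps; dropping jumps maps tensor powers to tensor powers, which gives coherence for free.\<close>

primrec letter_quant :: "((nat \<Rightarrow> bool) \<Rightarrow> bool) \<Rightarrow> nat \<Rightarrow> ((nat \<Rightarrow> nat) \<Rightarrow> bool) \<Rightarrow> bool" where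
  "letter_quant U 0 = (\<lambda>P. P (\<lambda>_. 0))"
| "letter_quant U (Suc i) = (\<lambda>P. letter_quant U i (\<lambda>F. U (\<lambda>s. P (addjump F s))))"

text \<open>Exactly \<open>i\<close> jumps: the height \<open>i\<close> is reached and never left.
  The time \<open>b\<close> is what a further jump has to wait for.\<close>

definition stable :: "nat \<Rightarrow> (nat \<Rightarrow> nat) \<Rightarrow> bool" where
  "stable i F \<longleftrightarrow> F \<in> steps \<and> (\<forall>t. F t \<le> i) \<and> (\<exists>b. \<forall>t\<ge>b. F t = i)"

text \<open>After \<open>F\<close> has become constant, \<open>d\<close> sees an added jump as a
  passage from \<open>d i\<close> to \<open>d (Suc i)\<close>, so it either erases the jump or keeps
  it at the same time \<open>s\<close>.\<close>

lemma stable_addjump: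
  assumes "stable i F"
  shows "\<exists>b. \<forall>s\<ge>b. stable (Suc i) (addjump F s) \<and> (\<forall>d\<in>steps. d \<circ> addjump F s =
    (if d (Suc i) = d i then d \<circ> F else addjump (d \<circ> F) s))"
proof -
  obtain b where b: "\<And>t. t \<ge> b \<Longrightarrow> F t = i" and F: "F \<in> steps" "\<And>t. F t \<le> i"
    using assms by (auto simp: stable_def)
  show ?thesis
  \<comment> \<open>The jump comes strictly after time \<open>b\<close>, so that \<open>F\<close>
    already has the value \<open>i\<close> one step earlier and no step of size two arises; nor can
    it fall on time 0, which would move the root.\<close>
  proof (intro exI[of _ "Suc b"] allI impI conjI ballI)
    fix s assume s: "Suc b \<le> s"
    have "addjump F s \<in> steps"
      unfolding steps_def
    proof (intro CollectI conjI allI)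
      show "addjump F s 0 = 0" using s F(1) by (simp add: addjump_def steps_0)
      fix t
      show "addjump F s (Suc t) = addjump F s t \<or> addjump F s (Suc t) = Suc (addjump F s t)"
        using s steps_Suc[OF F(1), of t] b[of t] b[of "Suc t"] by (cases "Suc t = s") (auto simp: addjump_def)
    qed
    moreover have "addjump F s t \<le> Suc i" for t using F(2)[of t] by (simp add: addjump_def)
    moreover have "\<forall>t\<ge>s. addjump F s t = Suc i" using b s by (simp add: addjump_def)
    ultimately show "stable (Suc i) (addjump F s)" by (auto simp: stable_def)
    fix d assume "d \<in> steps"
    then show "d \<circ> addjump F s = (if d (Suc i) = d i then d \<circ> F else addjump (d \<circ> F) s)"
      using b s steps_Suc[of d i] by (auto simp: addjump_def fun_eq_iff)
  qed
qed

context
  fixes U :: "(nat \<Rightarrow> bool) \<Rightarrow> bool" assumes U: "ultra U" "\<And>n. U (\<lambda>x. n \<le> x)"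
begin

lemma ultra_letter_quant: "ultra (letter_quant U i)"
proof (induction i)
  case 0 show ?case by (simp add: ultra_point)
next
  case (Suc i) then show ?case using U(1) by (simp add: ultra_def)
qed

lemma letter_quant_stable: "letter_quant U i (stable i)"
proof (induction i)
  case 0 show ?case by (simp add: stable_def steps_def)
next
  case (Suc i)
  show ?case unfolding letter_quant.simps
  proof (rule ultra_mono[of "letter_quant U i" "stable i", OF ultra_letter_quant Suc])
    fix F assume "stable i F"
    from stable_addjump[OF this] obtain b where b: "\<And>s. b \<le> s \<Longrightarrow> stable (Suc i) (addjump F s)"
      by auto
    show "U (\<lambda>s. stable (Suc i) (addjump F s))"
      by (rule ultra_mono[of U "\<lambda>x. b \<le> x", OF U(1) U(2) b])
  qed
qed

text \<open>The time \<open>s\<close> of the last jump is quantified innermost, so almost every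
  \<open>s\<close> lies beyond the point where \<open>F\<close> is constant and
  \<open>stable_addjump\<close> applies. If \<open>d\<close> erases the jump, the inner quantifier
  ranges over a constant and disappears.\<close>

lemma letter_quant_comp:
  assumes "d \<in> steps"
  shows "letter_quant U i (\<lambda>F. P (d \<circ> F)) = letter_quant U (d i) P"
proof (induction i arbitrary: P)
  case 0 show ?case using assms by (simp add: o_def steps_0)
next
  case (Suc i)
  have eq: "U (\<lambda>s. P (d \<circ> addjump F s)) =
      (if d (Suc i) = d i then P (d \<circ> F) else U (\<lambda>s. P (addjump (d \<circ> F) s)))" if st: "stable i F" for F
  proof -
    obtain b where b: "\<And>s. b \<le> s \<Longrightarrow>
        d \<circ> addjump F s = (if d (Suc i) = d i then d \<circ> F else addjump (d \<circ> F) s)"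
      using stable_addjump[OF st] assms by auto
    have "U (\<lambda>s. P (d \<circ> addjump F s)) =
        U (\<lambda>s. P (if d (Suc i) = d i then d \<circ> F else addjump (d \<circ> F) s))"
      by (rule ultra_cong[of U "\<lambda>x. b \<le> x", OF U(1) U(2)]) (simp add: b)
    then show ?thesis by (simp add: ultra_const[OF U(1)])
  qed
  have "letter_quant U (Suc i) (\<lambda>F. P (d \<circ> F)) = letter_quant U i (\<lambda>F. U (\<lambda>s. P (d \<circ> addjump F s)))"
    by simp
  also have "\<dots> = letter_quant U i (\<lambda>F. if d (Suc i) = d i then P (d \<circ> F) else U (\<lambda>s. P (addjump (d \<circ> F) s)))"
    by (rule ultra_cong[of "letter_quant U i" "stable i", OF ultra_letter_quant letter_quant_stable eq])
  also have "\<dots> = letter_quant U (d (Suc i)) P"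
  proof (cases "d (Suc i) = d i")
    case True then show ?thesis using Suc[of P] by (simp only: if_True simp_thms)
  next
    case False
    then have "d (Suc i) = Suc (d i)" using steps_Suc[OF assms, of i] by blast
    then show ?thesis using Suc[of "\<lambda>F. U (\<lambda>s. P (addjump F s))"] False
      by (simp only: if_False letter_quant.simps)
  qed
  finally show ?case .
qed

end

lemma coherent_nonempty: "coherent \<noteq> {}"
proof -
  obtain U :: "(nat \<Rightarrow> bool) \<Rightarrow> bool" where U: "ultra U" "\<And>n. U (\<lambda>x. n \<le> x)"
    using nonprincipal_ultra by blast
  have "(\<lambda>i P. letter_quant U i (\<lambda>F. P [F])) \<in> coherent"
    unfolding coherent_def
  proof (intro CollectI conjI allI ballI)
    fix i
    show "ultra (\<lambda>P. letter_quant U i (\<lambda>F. P [F]))" by (rule ultra_map[of "letter_quant U i" "\<lambda>F. [F]", OF ultra_letter_quant[OF U]])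
    show "letter_quant U i (\<lambda>F. has_level i [F])"
      by (rule ultra_mono[of "letter_quant U i" "stable i", OF ultra_letter_quant[OF U] letter_quant_stable[OF U]]) (auto simp: stable_def has_level_def)
    fix d assume "d \<in> steps"
    then show "qact d (\<lambda>P. letter_quant U i (\<lambda>F. P [F])) = (\<lambda>P. letter_quant U (d i) (\<lambda>F. P [F]))"
      unfolding qact_def act_def using letter_quant_comp[OF U, of d i "\<lambda>F. P [F]" for P] by simp
  qed
  then show ?thesis by blast
qed

section \<open>Mutually absorbing coherent families\<close>

primrec down :: "(nat \<Rightarrow> quant) \<Rightarrow> nat \<Rightarrow> quant" where
  "down V 0 = V 0" | "down V (Suc i) = V (Suc i) \<star> down V i"

primrec up :: "(nat \<Rightarrow> quant) \<Rightarrow> nat \<Rightarrow> quant" where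
  "up V 0 = V 0" | "up V (Suc i) = up V i \<star> V (Suc i)"

lemma idem_left: "V i \<star> V i = V i \<Longrightarrow> V i \<star> down V i = down V i"
  by (cases i) (simp_all add: qmult_assoc[symmetric])

lemma idem_right: "V i \<star> V i = V i \<Longrightarrow> up V i \<star> V i = up V i"
  by (cases i) (simp_all add: qmult_assoc)

text \<open>Applied to \<open>V i \<star> ... \<star> V 0\<close> or to its mirror image,
  \<open>d\<close> produces a product in which a factor is repeated next to itself whenever
  \<open>d (Suc i) = d i\<close>; idempotence deletes the repetition.\<close>

lemma coherent_down_up:
  assumes V: "V \<in> coherent" and idem: "\<And>i. V i \<star> V i = V i"
  shows "down V \<in> coherent" "up V \<in> coherent"
proof -
  have u: "ultra (V i)" "V i (has_level i)" for i using V by (auto simp: coherent_def)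
  have c: "qact d (V i) = V (d i)" if "d \<in> steps" for d i using V that by (auto simp: coherent_def)
  have ud: "ultra (down V i)" "ultra (up V i)" for i
    by (induction i) (auto simp: u ultra_qmult)
  have l: "down V i (has_level i)" "up V i (has_level i)" for i
  proof (induction i)
    case (Suc i)
    { case 1 show ?case using has_level_qmult[OF u(1)[of "Suc i"] ud(1)[of i] u(2) Suc(1)] by simp }
    { case 2 show ?case using has_level_qmult[OF ud(2)[of i] u(1)[of "Suc i"] Suc(2) u(2)] by simp }
  qed (simp_all add: u)
  have q: "qact d (down V i) = down V (d i)" "qact d (up V i) = up V (d i)" if d: "d \<in> steps" for d i
  proof (induction i)
    case 0
    { case 1 show ?case using d by (simp add: c steps_0) }
    { case 2 show ?case using d by (simp add: c steps_0) }
  next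
    case (Suc i)
    { case 1 show ?case
        using steps_Suc[OF d, of i] Suc(1) idem_left[of V "d i"] idem by (auto simp: qact_qmult c[OF d]) }
    { case 2 show ?case
        using steps_Suc[OF d, of i] Suc(2) idem_right[of V "d i"] idem by (auto simp: qact_qmult c[OF d]) }
  qed
  show "down V \<in> coherent" "up V \<in> coherent" using ud l q by (auto simp: coherent_def)
qed

text \<open>Only the components up to \<open>k\<close> are constrained, so that they can be adjusted
  one at a time while the others remain any coherent continuation.\<close>

definition absorbing :: "nat \<Rightarrow> (nat \<Rightarrow> quant) \<Rightarrow> bool" where
  "absorbing k V \<longleftrightarrow> (\<forall>i\<le>k. \<forall>j\<le>k. V i \<star> V j = V (max i j))"

lemma absorbing_down_up:
  assumes "absorbing k V" "i \<le> k"
  shows "down V i = V i" "up V i = V i"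
proof -
  have "down V i = V i \<and> up V i = V i"
    using assms(2)
  proof (induction i)
    case (Suc i) then show ?case using assms(1) by (simp add: absorbing_def)
  qed simp
  then show "down V i = V i" "up V i = V i" by auto
qed

text \<open>One first makes the new component absorb the old ones on the right, by an idempotent in
  the closed subsemigroup \<open>C\<close>, which contains \<open>down W\<close>; then \<open>up V\<close> absorbs on both sides. Closedness
  forces this order, since products are continuous in the left factor only.\<close>

lemma absorbing_step:
  assumes V0: "V0 \<in> coherent" "absorbing k V0"
  shows "\<exists>V\<in>coherent. absorbing (Suc k) V"
proof -
  define D where "D = {V\<in>coherent. \<forall>i\<le>k. V i = V0 i}"
  define C where "C = {V\<in>D. \<forall>i\<le>k. V (Suc k) \<star> V0 i = V (Suc k)}"
  have mx: "V0 i \<star> V0 j = V0 (max i j)" if "i \<le> k" "j \<le> k" for i j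
    using V0(2) that by (auto simp: absorbing_def)
  have cl: "closed {V :: nat \<Rightarrow> quant. V i P}" and op: "open {V :: nat \<Rightarrow> quant. V i P}" for i P
    by (rule open_Collect_bool; rule continuous_on_apply2)+
  have "D = coherent \<inter> (\<Inter>i\<in>{..k}. {V. \<forall>P. (V i P \<longrightarrow> V0 i P) \<and> (V0 i P \<longrightarrow> V i P)})"
    by (auto simp: D_def fun_eq_iff)
  also have "closed \<dots>"
    by (intro closed_Int closed_coherent closed_INT ballI closed_Collect_all closed_Collect_conj
        closed_Collect_imp op cl closed_Collect_const open_Collect_const)
  finally have clD: "closed D" .
  have "C = D \<inter> (\<Inter>i\<in>{..k}. {V. \<forall>P. (V (Suc k) (\<lambda>x. V0 i (\<lambda>y. P (x @ y))) \<longrightarrow> V (Suc k) P) \<and>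
      (V (Suc k) P \<longrightarrow> V (Suc k) (\<lambda>x. V0 i (\<lambda>y. P (x @ y))))})"
    by (auto simp: C_def qmult_def fun_eq_iff)
  also have "closed \<dots>"
    by (intro closed_Int clD closed_INT ballI closed_Collect_all closed_Collect_conj
        closed_Collect_imp op cl)
  finally have clC: "closed C" .
  have "V0 \<in> D" using V0 by (simp add: D_def)
  have multD: "tuple_mult V W \<in> D" if "V \<in> D" "W \<in> D" for V W
    using that mx coherent_tuple_mult by (auto simp: D_def tuple_mult_def)
  \<comment> \<open>A first idempotent, because the coherence of \<open>down W\<close> rests on
    idempotent components.\<close>
  obtain W where W: "W \<in> D" "\<And>i. W i \<star> W i = W i"
    using tuple_idempotent[OF clD _ multD] \<open>V0 \<in> D\<close> by blast
  have Wa: "absorbing k W" and Wk: "\<And>i. i \<le> k \<Longrightarrow> W i = V0 i"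
    using W V0(2) by (auto simp: D_def absorbing_def)
  have "down W \<in> C"
  proof -
    have "down W \<in> D"
      using coherent_down_up(1)[OF _ W(2)] W(1) absorbing_down_up(1)[OF Wa] by (auto simp: D_def)
    moreover have "down W (Suc k) \<star> V0 i = down W (Suc k)" if "i \<le> k" for i
      using that absorbing_down_up(1)[OF Wa, of k] Wk mx[of k i] by (simp add: qmult_assoc)
    ultimately show ?thesis by (simp add: C_def)
  qed
  have multC: "tuple_mult V W \<in> C" if "V \<in> C" "W \<in> C" for V W
    using that multD by (auto simp: C_def tuple_mult_def qmult_assoc)
  \<comment> \<open>A second idempotent, now inside \<open>C\<close>: \<open>down W\<close> served
    to show that \<open>C\<close> is nonempty, and the coherence of \<open>up V\<close> calls for
    idempotent components again.\<close>
  obtain V where V: "V \<in> C" "\<And>i. V i \<star> V i = V i"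
    using tuple_idempotent[OF clC _ multC] \<open>down W \<in> C\<close> by blast
  have VD: "V \<in> coherent" "\<And>i. i \<le> k \<Longrightarrow> V i = V0 i" "\<And>i. i \<le> k \<Longrightarrow> V (Suc k) \<star> V0 i = V (Suc k)"
    using V(1) by (auto simp: C_def D_def)
  have Va: "absorbing k V" using VD(2) V0(2) by (auto simp: absorbing_def)
  have upV: "up V i = V0 i" if "i \<le> k" for i using absorbing_down_up(2)[OF Va that] VD(2) that by simp
  have upS: "up V (Suc k) = V0 k \<star> V (Suc k)" using upV by simp
  have 1: "V0 i \<star> up V (Suc k) = up V (Suc k)" if "i \<le> k" for i
    using mx[OF that order_refl] that by (simp add: upS qmult_assoc[symmetric] max_def del: up.simps)
  have 2: "up V (Suc k) \<star> V0 i = up V (Suc k)" if "i \<le> k" for i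
    using VD(3)[OF that] by (simp add: upS qmult_assoc)
  have 3: "up V (Suc k) \<star> up V (Suc k) = up V (Suc k)"
  proof -
    \<comment> \<open>Right absorption removes the inner \<open>V0 k\<close>; then
      \<open>V (Suc k)\<close> meets itself and is idempotent.\<close>
    have "up V (Suc k) \<star> up V (Suc k) = V0 k \<star> ((V (Suc k) \<star> V0 k) \<star> V (Suc k))"
      by (simp only: upS qmult_assoc)
    also have "\<dots> = up V (Suc k)" by (simp only: VD(3)[OF order_refl] V(2) upS)
    finally show ?thesis .
  qed
  have "absorbing (Suc k) (up V)"
    unfolding absorbing_def
  proof (intro allI impI)
    fix i j assume "i \<le> Suc k" "j \<le> Suc k"
    then consider "i \<le> k" "j \<le> k" | "i = Suc k" "j \<le> k" | "i \<le> k" "j = Suc k" | "i = Suc k" "j = Suc k"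
      by linarith
    then show "up V i \<star> up V j = up V (max i j)"
    proof cases
      case 1 then show ?thesis using mx[of i j] upV by (simp add: max_def)
    next
      case 2 then show ?thesis using \<open>j \<le> k \<Longrightarrow> up V (Suc k) \<star> V0 j = up V (Suc k)\<close> upV[of j]
        by (simp add: max_def del: up.simps)
    next
      case 3 then show ?thesis using \<open>i \<le> k \<Longrightarrow> V0 i \<star> up V (Suc k) = up V (Suc k)\<close> upV[of i]
        by (simp add: max_def del: up.simps)
    next
      case 4 then show ?thesis using \<open>up V (Suc k) \<star> up V (Suc k) = up V (Suc k)\<close>
        by (simp del: up.simps)
    qed
  qed
  moreover have "up V \<in> coherent" by (rule coherent_down_up(2)[OF VD(1) V(2)])
  ultimately show ?thesis by blast
qed

theorem absorbing_exists: "\<exists>V\<in>coherent. absorbing k V"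
proof (induction k)
  case 0
  obtain V where "V \<in> coherent" "\<And>i. V i \<star> V i = V i"
    using tuple_idempotent[OF closed_coherent coherent_nonempty coherent_tuple_mult] by blast
  then show ?case by (auto simp: absorbing_def)
next
  case (Suc k) then show ?case using absorbing_step by blast
qed

section \<open>The Ramsey theorem for labelled words\<close>

type_synonym lword = "((nat \<Rightarrow> nat) \<times> nat) list"

definition lab :: "nat \<Rightarrow> wrd \<Rightarrow> lword" where
  "lab j u = map (\<lambda>F. (F, j)) u"

lemma lab_append: "lab j (u @ v) = lab j u @ lab j v" by (simp add: lab_def)

text \<open>The \<open>r\<close>-fold tensor power of \<open>Q\<close> along the labels:
  \<open>P\<close> is asked of \<open>x\<close> completed by \<open>r\<close> generic words with the
  labels \<open>j\<close>, \<open>j + 1\<close> and so on.\<close>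

primrec iterated :: "quant \<Rightarrow> (lword \<Rightarrow> bool) \<Rightarrow> nat \<Rightarrow> nat \<Rightarrow> lword \<Rightarrow> bool" where
  "iterated Q P 0 j x = P x"
| "iterated Q P (Suc r) j x = Q (\<lambda>u. iterated Q P r (Suc j) (x @ lab j u))"

text \<open>The parameter \<open>R\<close> leaves room for one more ultrafilter inside the iterated
  ones, which will be the limit over the size of the fan.\<close>

lemma ultra_iterated:
  assumes "ultra Q" "\<And>x. ultra (\<lambda>P. R P x)"
  shows "ultra (\<lambda>P. iterated Q (R P) r j x)"
proof (induction r arbitrary: j x)
  case 0 then show ?case using assms(2) by simp
next
  case (Suc r)
  have "iterated Q (R (\<lambda>z. \<not> P z)) r j y = (\<not> iterated Q (R P) r j y)"
    "iterated Q (R (\<lambda>z. P z \<and> P' z)) r j y = (iterated Q (R P) r j y \<and> iterated Q (R P') r j y)" for P P' j y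
    using Suc[of j y] unfolding ultra_def by simp_all
  then show ?case unfolding ultra_def by (simp add: ultra_not[OF assms(1)] ultra_conj[OF assms(1)])
qed

text \<open>The word of a composite map: the block \<open>p\<close> stands for one branch of an
  intermediate fan, and the letter \<open>(d, j)\<close> at the same position carries that branch to
  the target branch \<open>j\<close>.\<close>

definition substitute :: "((nat \<Rightarrow> nat) \<times> nat) list \<Rightarrow> wrd list \<Rightarrow> lword" where
  "substitute \<delta> ps = concat (map2 (\<lambda>e p. lab (snd e) (act (fst e) p)) \<delta> ps)"

lemma substitute_snoc:
  "length \<delta> = length ps \<Longrightarrow> substitute (\<delta> @ [e]) (ps @ [p]) = substitute \<delta> ps @ lab (snd e) (act (fst e) p)"
  by (simp add: substitute_def)

definition bounded_steps :: "nat \<Rightarrow> (nat \<Rightarrow> nat) set" where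
  "bounded_steps m = {d \<in> steps. \<forall>t\<ge>m. d t = d m}"

lemma bounded_steps_steps: "d \<in> bounded_steps m \<Longrightarrow> d \<in> steps"
  by (simp add: bounded_steps_def)

lemma steps_le: "d \<in> steps \<Longrightarrow> d t \<le> t"
proof (induction t)
  case (Suc t) then show ?case using steps_Suc[of d t] by auto
qed (simp add: steps_0)

lemma finite_bounded_steps: "finite (bounded_steps m)"
proof -
  have substitute: "(\<lambda>d. restrict d {..m}) ` bounded_steps m \<subseteq> {..m} \<rightarrow>\<^sub>E {..m}"
  proof (intro image_subsetI PiE_I)
    fix d t assume "d \<in> bounded_steps m" "t \<in> {..m}"
    then show "restrict d {..m} t \<in> {..m}" using steps_le[of d t] bounded_steps_steps[of d m] by simp
  qed simp
  have "finite ({..m} \<rightarrow>\<^sub>E {..m})" by (intro finite_PiE) auto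
  with substitute have fin: "finite ((\<lambda>d. restrict d {..m}) ` bounded_steps m)" by (rule finite_subset)
  have "d = e" if d: "d \<in> bounded_steps m" and e: "e \<in> bounded_steps m" and eq: "restrict d {..m} = restrict e {..m}" for d e
  proof
    fix t
    have *: "d s = e s" if "s \<le> m" for s using fun_cong[OF eq, of s] that by simp
    have "d t = d m" "e t = e m" if "m \<le> t" using d e that unfolding bounded_steps_def by blast+
    then show "d t = e t" using *[of t] *[of m] by (metis nat_le_linear order_refl)
  qed
  then have "inj_on (\<lambda>d. restrict d {..m}) (bounded_steps m)" by (intro inj_onI)
  with fin show ?thesis by (rule finite_imageD)
qed

definition full :: "nat \<Rightarrow> nat \<Rightarrow> lword \<Rightarrow> nat \<Rightarrow> bool" where
  "full m n \<delta> j \<longleftrightarrow> (\<exists>d. (d, j) \<in> set \<delta> \<and> d m = n)"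

text \<open>\<open>frag\<close> and \<open>full\<close> describe the epimorphisms from \<open>K\<close> branches of height \<open>m\<close> onto \<open>k\<close> branches of
  height \<open>n\<close>; only the values up to \<open>m\<close> matter, hence \<open>bounded_steps\<close>.\<close>

definition frag :: "nat \<Rightarrow> nat \<Rightarrow> nat \<Rightarrow> nat \<Rightarrow> lword set" where
  "frag m n k K = {\<delta>. length \<delta> = K \<and> set \<delta> \<subseteq> {d \<in> bounded_steps m. d m \<le> n} \<times> {..<k} \<and> sorted (map snd \<delta>)}"

lemma finite_frag: "finite (frag m n k K)"
proof -
  have "finite ({d \<in> bounded_steps m. d m \<le> n} \<times> {..<k})" using finite_bounded_steps by auto
  from finite_lists_length_eq[OF this, of K] show ?thesis
    by (rule rev_finite_subset) (auto simp: frag_def)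
qed

section \<open>Fusion: choosing the blocks one after another along the ultrafilters\<close>

context
  fixes V :: "nat \<Rightarrow> quant" and m n k :: nat and P :: "lword \<Rightarrow> bool"
  assumes V: "V \<in> coherent" "absorbing (max m n) V"
begin

text \<open>The state in which the labels below \<open>j\<close> are closed: the word
  \<open>x\<close> written so far satisfies \<open>P\<close> once generic words of height
  \<open>n\<close> are appended for the remaining labels.\<close>

definition accept :: "nat \<Rightarrow> lword \<Rightarrow> bool" where
  "accept j x = iterated (V n) P (k - j) j x"

lemma accept_end: "accept k x = P x" by (simp add: accept_def)

lemma accept_step: "j < k \<Longrightarrow> accept j x = V n (\<lambda>u. accept (Suc j) (x @ lab j u))"
  by (simp add: accept_def Suc_diff_Suc flip: Suc_diff_Suc)

text \<open>The invariant while \<open>j\<close> is the current label. Appending a generic word of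
  height \<open>n\<close> always leads to acceptance. Once some letter has covered the branch
  \<open>j\<close>, the label may also be closed at once or receive a generic word of any height up
  to \<open>n\<close>; before that neither is claimed.\<close>

definition good :: "lword \<Rightarrow> lword \<Rightarrow> nat \<Rightarrow> bool" where
  "good \<delta> x j \<longleftrightarrow> V n (\<lambda>w. accept (Suc j) (x @ lab j w)) \<and>
     (full m n \<delta> j \<longrightarrow> accept (Suc j) x \<and> (\<forall>l\<le>n. V l (\<lambda>w. accept (Suc j) (x @ lab j w))))"

lemma ultra_V: "ultra (V i)" using V(1) by (simp add: coherent_def)

lemma V_act: "d \<in> steps \<Longrightarrow> V m (\<lambda>p. R (act d p)) = V (d m) R"
  using V(1) by (auto simp: coherent_def qact_def fun_eq_iff)

lemma V_mult: "i \<le> n \<Longrightarrow> j \<le> n \<Longrightarrow> V i (\<lambda>x. V j (\<lambda>y. R (x @ y))) = V (max i j) R"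
  using V(2) by (auto simp: absorbing_def qmult_def fun_eq_iff le_max_iff_disj)

text \<open>The new piece \<open>act d p\<close> is generic of height \<open>d m\<close>; followed
  by a generic word of height \<open>l\<close> it is generic of height \<open>max (d m) l\<close>.
  This maximum is \<open>n\<close> if \<open>l = n\<close> or \<open>d m = n\<close>, and otherwise
  the fullness clause of the old invariant covers it.\<close>

lemma good_extend:
  assumes good: "good \<delta> x j" and d: "d \<in> steps" "d m \<le> n"
  shows "V m (\<lambda>p. good (\<delta> @ [(d, j)]) (x @ lab j (act d p)) j)"
proof -
  define R where "R w = accept (Suc j) (x @ lab j w)" for w
  have fullS: "full m n (\<delta> @ [(d, j)]) j \<longleftrightarrow> full m n \<delta> j \<or> d m = n"
    by (auto simp: full_def)
  have two: "V m (\<lambda>p. V l (\<lambda>w. R (act d p @ w)))" if "l \<le> n" "V (max (d m) l) R" for l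
    using that V_mult[OF d(2), of l R] V_act[OF d(1), of "\<lambda>u. V l (\<lambda>w. R (u @ w))"] by simp
  have one: "V m (\<lambda>p. R (act d p))" if "V (d m) R"
    using that V_act[OF d(1), of R] by simp
  have a: "V n R" using good by (simp add: good_def R_def[abs_def])
  have A: "V m (\<lambda>p. V n (\<lambda>w. R (act d p @ w)))"
    using two[of n] a d(2) by (simp add: max_absorb2)
  have B: "V m (\<lambda>p. R (act d p) \<and> (\<forall>l\<in>{..n}. V l (\<lambda>w. R (act d p @ w))))"
    if f: "full m n \<delta> j \<or> d m = n"
  proof -
    have *: "V (max (d m) l) R" if "l \<le> n" for l
    proof (cases "d m = n")
      case True then show ?thesis using a that by (simp add: max_absorb1)
    next
      case False
      then show ?thesis using f good d(2) that by (auto simp: good_def R_def[abs_def])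
    qed
    \<comment> \<open>With \<open>l = 0\<close> the maximum is \<open>d m\<close> itself, which is
      the case of closing the label right after the new piece.\<close>
    have "V m (\<lambda>p. R (act d p))" using one *[of 0] by simp
    moreover have "V m (\<lambda>p. \<forall>l\<in>{..n}. V l (\<lambda>w. R (act d p @ w)))"
      by (rule ultra_Ball[of "V m" "{..n}" "\<lambda>l p. V l (\<lambda>w. R (act d p @ w))"])
        (use ultra_V two * in auto)
    ultimately show ?thesis by (simp add: ultra_conj[OF ultra_V])
  qed
  show ?thesis
  proof (cases "full m n \<delta> j \<or> d m = n")
    case True
    then show ?thesis
      using A B[OF True] unfolding good_def fullS
      by (simp add: ultra_conj[OF ultra_V] R_def lab_append atMost_def Ball_def)
  next
    case False
    then show ?thesis using A unfolding good_def fullS by (simp add: R_def lab_append)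
  qed
qed

text \<open>Fullness permits closing the label \<open>j\<close>. The acceptance so obtained unfolds
  by one quantifier to the first clause for the next label, where the second clause is
  vacuous.\<close>

lemma good_next:
  assumes "good \<delta> x j" "full m n \<delta> j" "Suc j < k" "\<not> full m n \<delta> (Suc j)"
  shows "good \<delta> x (Suc j)"
  using assms accept_step[of "Suc j" x] by (simp add: good_def)

text \<open>At each stage only finitely many words and letters matter, so almost every
  \<open>p\<close> along \<open>V m\<close> extends all of them at once. The conditions on
  \<open>j\<close> describe prefixes of words of epimorphisms: no label exceeds \<open>j\<close>,
  and the labels below \<open>j\<close> are full.\<close>

lemma fusion:
  assumes start: "accept 0 []" and k: "0 < k"
  shows "\<exists>ps. length ps = K \<and> (\<forall>p\<in>set ps. has_level m p) \<and>
    (\<forall>\<delta>\<in>frag m n k K. \<forall>j<k. (\<forall>e\<in>set \<delta>. snd e \<le> j) \<longrightarrow> (\<forall>i<j. full m n \<delta> i) \<longrightarrow> good \<delta> (substitute \<delta> ps) j)"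
proof (induction K)
  case 0
  have "good [] [] 0" using start accept_step[OF k] by (simp add: good_def full_def)
  then show ?case by (auto simp: frag_def substitute_def full_def)
next
  case (Suc K)
  then obtain ps where ps: "length ps = K" "\<forall>p\<in>set ps. has_level m p"
    and IH: "\<And>\<delta> j. \<delta> \<in> frag m n k K \<Longrightarrow> j < k \<Longrightarrow> (\<forall>e\<in>set \<delta>. snd e \<le> j) \<Longrightarrow>
      (\<forall>i<j. full m n \<delta> i) \<Longrightarrow> good \<delta> (substitute \<delta> ps) j"
    by blast
  define A where "A = {(\<delta>, d, j). \<delta> \<in> frag m n k K \<and> d \<in> bounded_steps m \<and> d m \<le> n \<and> j < k \<and> good \<delta> (substitute \<delta> ps) j}"
  have "A \<subseteq> frag m n k K \<times> bounded_steps m \<times> {..<k}" by (auto simp: A_def)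
  then have finA: "finite A"
    by (rule finite_subset) (simp add: finite_frag finite_bounded_steps)
  define S where "S = (\<lambda>(\<delta>, d, j) p. good (\<delta> @ [(d, j)]) (substitute \<delta> ps @ lab j (act d p)) j)"
  have "V m (S a)" if "a \<in> A" for a
  proof -
    obtain \<delta> d j where a: "a = (\<delta>, d, j)" by (rule prod_cases3)
    have "V m (\<lambda>p. good (\<delta> @ [(d, j)]) (substitute \<delta> ps @ lab j (act d p)) j)"
      using that good_extend[of \<delta> "substitute \<delta> ps" j d] bounded_steps_steps[of d m] by (simp add: a A_def)
    then show ?thesis by (simp add: a S_def)
  qed
  then have "V m (\<lambda>p. \<forall>a\<in>A. S a p)"
    by (rule ultra_Ball[of "V m" A S, OF ultra_V finA])
  moreover have "V m (has_level m)" using V(1) by (simp add: coherent_def)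
  ultimately have "V m (\<lambda>p. has_level m p \<and> (\<forall>a\<in>A. S a p))"
    by (simp add: ultra_conj[OF ultra_V])
  from ultra_exists[of "V m" "\<lambda>p. has_level m p \<and> (\<forall>a\<in>A. S a p)", OF ultra_V this]
  obtain p where p: "has_level m p" "\<And>a. a \<in> A \<Longrightarrow> S a p" by blast
  have "good \<delta>' (substitute \<delta>' (ps @ [p])) j"
    if \<delta>': "\<delta>' \<in> frag m n k (Suc K)" and j: "j < k" "\<forall>e\<in>set \<delta>'. snd e \<le> j" "\<forall>i<j. full m n \<delta>' i" for \<delta>' j
  proof -
    obtain \<delta> d j0 where eq: "\<delta>' = \<delta> @ [(d, j0)]"
      using \<delta>' by (cases \<delta>' rule: rev_cases) (auto simp: frag_def)
    have \<delta>: "\<delta> \<in> frag m n k K" and d: "d \<in> bounded_steps m" "d m \<le> n" and le: "\<And>e. e \<in> set \<delta> \<Longrightarrow> snd e \<le> j0"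
      using \<delta>' by (auto simp: frag_def eq sorted_append)
    have j0: "j0 \<le> j" using j(2) eq by auto
    \<comment> \<open>The last letter carries the label \<open>j0\<close>, while the invariant is
      wanted for some \<open>j \<ge> j0\<close>. The labels from \<open>j0\<close> to just below
      \<open>j\<close> are closed one by one, as their fullness permits.\<close>
    have "i \<le> j \<longrightarrow> good \<delta>' (substitute \<delta>' (ps @ [p])) i" if "j0 \<le> i" for i
      using that
    proof (induction i rule: dec_induct)
      case base
      have "full m n \<delta> i" if "i < j0" for i
      proof -
        have "full m n \<delta>' i" using j(3) that j0 by simp
        then show ?thesis using that by (auto simp: full_def eq)
      qed
      then have "good \<delta> (substitute \<delta> ps) j0" using IH[OF \<delta>, of j0] j(1) j0 le by auto
      then have "(\<delta>, d, j0) \<in> A" using \<delta> d j(1) j0 by (simp add: A_def)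
      from p(2)[OF this] show ?case
        using \<delta> ps(1) by (simp add: S_def eq substitute_snoc frag_def)
    next
      case (step i)
      show ?case
      proof
        assume "Suc i \<le> j"
        moreover have "\<not> full m n \<delta>' (Suc i)"
        proof
          assume "full m n \<delta>' (Suc i)"
          then obtain d' where "(d', Suc i) \<in> set \<delta>'" by (auto simp: full_def)
          then have "Suc i \<le> j0" using le[of "(d', Suc i)"] by (auto simp: eq)
          then show False using step.hyps by simp
        qed
        ultimately show "good \<delta>' (substitute \<delta>' (ps @ [p])) (Suc i)"
          using step.IH j by (intro good_next) auto
      qed
    qed
    then show ?thesis using j0 by blast
  qed
  then show ?case using ps p(1) by (intro exI[of _ "ps @ [p]"]) auto
qed

lemma fusion_final:
  assumes start: "accept 0 []" and k: "0 < k"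
  shows "\<exists>ps. length ps = K \<and> (\<forall>p\<in>set ps. has_level m p) \<and>
    (\<forall>\<delta>\<in>frag m n k K. (\<forall>j<k. full m n \<delta> j) \<longrightarrow> P (substitute \<delta> ps))"
proof -
  obtain ps where ps: "length ps = K" "\<forall>p\<in>set ps. has_level m p" and
    good: "\<And>\<delta> j. \<delta> \<in> frag m n k K \<Longrightarrow> j < k \<Longrightarrow> (\<forall>e\<in>set \<delta>. snd e \<le> j) \<Longrightarrow>
      (\<forall>i<j. full m n \<delta> i) \<Longrightarrow> good \<delta> (substitute \<delta> ps) j"
    using fusion[OF assms, of K] by blast
  have "P (substitute \<delta> ps)" if "\<delta> \<in> frag m n k K" "\<forall>j<k. full m n \<delta> j" for \<delta>
  proof -
    \<comment> \<open>The last label is full, so it can be closed with nothing left to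
      append.\<close>
    have "good \<delta> (substitute \<delta> ps) (k - 1)"
      using that k by (intro good) (auto simp: frag_def)
    then show ?thesis using that(2) k accept_end by (simp add: good_def)
  qed
  then show ?thesis using ps by blast
qed

end

text \<open>\<open>col N x\<close> is meant to colour \<open>x\<close> as a map on the fan with
  \<open>N\<close> branches of height \<open>N\<close>. This size cannot be fixed before the blocks
  are known, so the colouring is replaced by its limit over \<open>N\<close>, and \<open>N\<close>
  is chosen at the end, for the finitely many words that matter.\<close>

theorem labelled_words_Ramsey:
  fixes col :: "nat \<Rightarrow> lword \<Rightarrow> 'c"
  assumes fin: "finite (range (\<lambda>(N, x). col N x))" and k: "0 < k"
  shows "\<exists>c ps N. length ps = K \<and> (\<forall>p\<in>set ps. has_level m p \<and> (\<exists>F\<in>set p. F N = m)) \<and>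
    length (concat ps) \<le> N \<and>
    (\<forall>\<delta>\<in>frag m n k K. (\<forall>j<k. full m n \<delta> j) \<longrightarrow> col N (substitute \<delta> ps) = c)"
proof -
  obtain V where V: "V \<in> coherent" "absorbing (max m n) V"
    using absorbing_exists by blast
  obtain U :: "(nat \<Rightarrow> bool) \<Rightarrow> bool" where U: "ultra U" "\<And>n. U (\<lambda>x. n \<le> x)"
    using nonprincipal_ultra by blast
  define R where "R P x = U (\<lambda>N. P (N, x))" for P :: "nat \<times> lword \<Rightarrow> bool" and x
  have "ultra (V n)" using V(1) by (simp add: coherent_def)
  then have "ultra (\<lambda>P. iterated (V n) (R P) k 0 [])"
    by (rule ultra_iterated) (simp add: R_def ultra_map[of U "\<lambda>N. (N, x)" for x, OF U(1)])
  from ultra_finite_range[OF this fin]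
  obtain c where c: "iterated (V n) (R (\<lambda>z. (\<lambda>(N, x). col N x) z = c)) k 0 []" by blast
  define P where "P x = U (\<lambda>N. col N x = c)" for x
  have "R (\<lambda>z. (\<lambda>(N, x). col N x) z = c) = P" by (auto simp: R_def P_def)
  with c have "accept V n k P 0 []" by (simp add: accept_def[OF V])
  from fusion_final[OF V this k, of K] obtain ps where ps: "length ps = K" "\<forall>p\<in>set ps. has_level m p"
    and Pc: "\<forall>\<delta>\<in>frag m n k K. (\<forall>j<k. full m n \<delta> j) \<longrightarrow> P (substitute \<delta> ps)" by blast
  define D where "D = {\<delta>\<in>frag m n k K. \<forall>j<k. full m n \<delta> j}"
  have 1: "U (\<lambda>N. \<forall>\<delta>\<in>D. col N (substitute \<delta> ps) = c)"
    by (rule ultra_Ball[of U D "\<lambda>\<delta> N. col N (substitute \<delta> ps) = c", OF U(1)])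
      (use Pc in \<open>auto simp: D_def finite_frag P_def[abs_def]\<close>)
  \<comment> \<open>A letter that attains \<open>m\<close> at time \<open>t\<close> keeps this
    height, so every \<open>N \<ge> t\<close> serves, and these \<open>N\<close> are almost
    all.\<close>
  have "U (\<lambda>N. \<exists>F\<in>set p. F N = m)" if "p \<in> set ps" for p
  proof -
    have "has_level m p" using ps(2) that by blast
    then obtain F t where F: "F \<in> set p" "F t = m" "F \<in> steps" "\<forall>s. F s \<le> m"
      by (auto simp: has_level_def)
    show ?thesis
    proof (rule ultra_mono[of U "\<lambda>x. t \<le> x", OF U(1) U(2)])
      fix N assume "t \<le> N"
      then have "F N = m" using F steps_mono[OF F(3), of t N] by (simp add: antisym)
      then show "\<exists>F\<in>set p. F N = m" using F(1) by blast
    qed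
  qed
  then have 2: "U (\<lambda>N. \<forall>p\<in>set ps. \<exists>F\<in>set p. F N = m)"
    by (rule ultra_Ball[of U "set ps" "\<lambda>p N. \<exists>F\<in>set p. F N = m", OF U(1) finite_set])
  have "U (\<lambda>N. length (concat ps) \<le> N \<and> (\<forall>p\<in>set ps. \<exists>F\<in>set p. F N = m) \<and> (\<forall>\<delta>\<in>D. col N (substitute \<delta> ps) = c))"
    using 1 2 U(2) by (simp add: ultra_conj[OF U(1)])
  from ultra_exists[of U "\<lambda>N. length (concat ps) \<le> N \<and> (\<forall>p\<in>set ps. \<exists>F\<in>set p. F N = m) \<and> (\<forall>\<delta>\<in>D. col N (substitute \<delta> ps) = c)", OF U(1) this]
  obtain N where "length (concat ps) \<le> N" "\<forall>p\<in>set ps. \<exists>F\<in>set p. F N = m" "\<forall>\<delta>\<in>D. col N (substitute \<delta> ps) = c"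
    by blast
  then show ?thesis using ps by (intro exI[of _ c] exI[of _ ps] exI[of _ N]) (auto simp: D_def)
qed

section \<open>The tree order of a fan\<close>

lemma vwalk_arcs_subset_iff:
  "set (vwalk_arcs p) \<subseteq> E \<longleftrightarrow> successively (\<lambda>x y. (x, y) \<in> E) p"
  by (induction p rule: vwalk_arcs.induct) auto

lemma awalk_vwalk_arcs:
  "w \<noteq> [] \<Longrightarrow> pcas (hd w) (vwalk_arcs w) (last w) \<and> pawalk_verts (hd w) (vwalk_arcs w) = w"
proof (induction w rule: vwalk_arcs.induct)
  case (3 x y xs) then show ?case by (cases xs) auto
qed simp_all

locale rooted_fan =
  fixes G :: "'a pair_pre_digraph" and r :: 'a
  assumes fan: "fan G r"
begin

lemma pair_graph: "pair_graph G" using fan by (simp add: fan_def)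

lemma root_in: "r \<in> pverts G" using fan by (simp add: fan_def)

lemma finite_arcs: "finite (parcs G)" and finite_verts: "finite (pverts G)"
proof -
  interpret pair_graph G by (rule pair_graph)
  show "finite (parcs G)" "finite (pverts G)" using pair_finite_arcs pair_finite_verts by auto
qed

lemma arc_props:
  assumes "(a, b) \<in> parcs G"
  shows "a \<in> pverts G" "b \<in> pverts G" "a \<noteq> b" "(b, a) \<in> parcs G"
proof -
  interpret pair_graph G by (rule pair_graph)
  show "a \<in> pverts G" "b \<in> pverts G" using in_arcsD1[OF assms] in_arcsD2[OF assms] .
  show "a \<noteq> b" using pair_no_loops[OF assms] by simp
  have "sym (parcs G)" using pair_sym_arcs by (simp add: symmetric_def)
  then show "(b, a) \<in> parcs G" using assms by (rule symD)
qed

lemma two_neighbours: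
  assumes "v \<in> pverts G" "v \<noteq> r" "(v, a) \<in> parcs G" "(v, b) \<in> parcs G" "(v, c) \<in> parcs G" "a \<noteq> b"
  shows "c = a \<or> c = b"
proof (rule ccontr)
  assume "\<not> (c = a \<or> c = b)"
  then have "card {(v, a), (v, b), (v, c)} = 3" using assms(6) by auto
  moreover have "card {(v, a), (v, b), (v, c)} \<le> card {e \<in> parcs G. fst e = v}"
    using assms finite_arcs by (intro card_mono) auto
  moreover have "out_degree (with_proj G) v \<le> 2" using fan assms(1,2) by (simp add: fan_def)
  then have "card {e \<in> parcs G. fst e = v} \<le> 2" by (simp add: out_degree_def out_arcs_def)
  ultimately show False by simp
qed

definition rpath :: "'a list \<Rightarrow> bool" where
  "rpath p \<longleftrightarrow> vpath p (with_proj G) \<and> hd p = r"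

lemma rpath_iff: "rpath p \<longleftrightarrow> p \<noteq> [] \<and> set p \<subseteq> pverts G \<and> distinct p \<and> p ! 0 = r \<and>
    (\<forall>i. Suc i < length p \<longrightarrow> (p ! i, p ! Suc i) \<in> parcs G)"
  by (auto simp: rpath_def vpath_def vwalk_def vwalk_arcs_subset_iff successively_conv_nth hd_conv_nth)

lemma tree_le_iff: "tree_le G r s t \<longleftrightarrow> (\<exists>p. rpath p \<and> last p = t \<and> s \<in> set p)"
  by (auto simp: tree_le_def rpath_def)

lemma rpath_exists: "t \<in> pverts G \<Longrightarrow> \<exists>p. rpath p \<and> last p = t"
proof -
  assume t: "t \<in> pverts G"
  interpret pair_graph G by (rule pair_graph)
  have "strongly_connected (with_proj G)"
    using symmetric_connected_imp_strongly_connected[OF pair_sym_arcs] fan by (simp add: fan_def)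
  then have "r \<rightarrow>\<^sup>*\<^bsub>with_proj G\<^esub> t" using root_in t by (simp add: strongly_connected_def)
  then show ?thesis using reachable_vpath_conv by (auto simp: rpath_def)
qed

lemma rpath_nonroot:
  assumes "rpath p" "0 < i" "i < length p"
  shows "p ! i \<noteq> r" "p ! i \<in> pverts G"
proof -
  have "p ! i \<noteq> p ! 0" using assms by (subst nth_eq_iff_index_eq) (auto simp: rpath_iff)
  then show "p ! i \<noteq> r" using assms by (simp add: rpath_iff)
  show "p ! i \<in> pverts G" using assms by (auto simp: rpath_iff)
qed

text \<open>A vertex other than the root has at most two neighbours, and the path has just come from
  one of them, so its continuation is forced. There is a choice only at the root.\<close>

lemma rpath_agree:
  assumes p: "rpath p" and q: "rpath q" and one: "p ! 1 = q ! 1"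
    and i: "i < length p" "i < length q"
  shows "p ! i = q ! i"
  using i
proof (induction i rule: less_induct)
  case (less i)
  consider "i = 0" | "i = 1" | l where "i = Suc (Suc l)"
    by (metis One_nat_def not0_implies_Suc)
  then show ?case
  proof cases
    case 1 then show ?thesis using p q by (simp add: rpath_iff)
  next
    case 2 then show ?thesis using one by simp
  next
    case (3 l)
    have e: "p ! Suc l = q ! Suc l" "p ! l = q ! l" using less 3 by auto
    have "(p ! l, p ! Suc l) \<in> parcs G" "(p ! Suc l, p ! i) \<in> parcs G" "(q ! Suc l, q ! i) \<in> parcs G"
      using p q less.prems 3 by (auto simp: rpath_iff)
    moreover have "p ! i \<noteq> p ! l" "q ! i \<noteq> q ! l"
      using p q less.prems 3 by (auto simp: rpath_iff nth_eq_iff_index_eq)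
    moreover have "p ! Suc l \<noteq> r" "p ! Suc l \<in> pverts G"
      using rpath_nonroot[OF p, of "Suc l"] less.prems 3 by auto
    ultimately show ?thesis
      using two_neighbours[of "p ! Suc l" "p ! l" "p ! i" "q ! i"] arc_props(4)[of "p ! l" "p ! Suc l"] e
      by auto
  qed
qed

text \<open>Paths that leave the root along different edges and meet again close up to a cycle.
  Taking the first meeting point along \<open>p\<close> makes this cycle simple.\<close>

lemma rpath_meet:
  assumes p: "rpath p" and q: "rpath q"
    and meet: "p ! i = q ! j" "0 < i" "i < length p" "0 < j" "j < length q"
  shows "p ! 1 = q ! 1"
proof (rule ccontr)
  assume ne: "p ! 1 \<noteq> q ! 1"
  define i0 where "i0 = (LEAST i. 0 < i \<and> i < length p \<and> p ! i \<in> set q)"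
  have "0 < i \<and> i < length p \<and> p ! i \<in> set q" using meet by auto
  then have i0: "0 < i0" "i0 < length p" "p ! i0 \<in> set q"
    unfolding i0_def by (metis (mono_tags, lifting) LeastI)+
  have min: "p ! l \<notin> set q" if "0 < l" "l < i0" for l
    using not_less_Least[of l "\<lambda>i. 0 < i \<and> i < length p \<and> p ! i \<in> set q"] that i0 by (auto simp: i0_def)
  obtain j0 where j0: "j0 < length q" "q ! j0 = p ! i0" using i0(3) by (auto simp: in_set_conv_nth)
  have "j0 \<noteq> 0" using j0 rpath_nonroot(1)[OF p i0(1,2)] q by (cases j0) (auto simp: rpath_iff)
  \<comment> \<open>The closed walk will have \<open>i0 + j0\<close> arcs with both numbers
    positive, so this excludes exactly length 2, which is no contradiction in a symmetric
    digraph.\<close>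
  have ij: "\<not> (i0 = 1 \<and> j0 = 1)" using ne j0 by auto
  \<comment> \<open>Along \<open>p\<close> to the meeting point and back along \<open>q\<close>; the
    meeting point is listed once, by \<open>p\<close>, hence \<open>take j0 q\<close>.\<close>
  define w where "w = take (Suc i0) p @ rev (take j0 q)"
  have "p \<noteq> []" "q \<noteq> []" using p q by (auto simp: rpath_iff)
  have len: "length w = Suc (i0 + j0)" using i0 j0 by (simp add: w_def)
  have "hd w = r" using p \<open>p \<noteq> []\<close> by (simp add: w_def hd_append take_Suc rpath_iff hd_conv_nth)
  have "last w = r"
    using q j0 \<open>j0 \<noteq> 0\<close> \<open>q \<noteq> []\<close> by (simp add: w_def last_append last_rev hd_take rpath_iff hd_conv_nth)
  have succ: "successively (\<lambda>x y. (x, y) \<in> parcs G) w"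
  proof -
    have 1: "successively (\<lambda>x y. (x, y) \<in> parcs G) (take (Suc i0) p)"
      using p i0 by (auto simp: successively_conv_nth rpath_iff)
    have 2: "successively (\<lambda>x y. (x, y) \<in> parcs G) (rev (take j0 q))"
      unfolding successively_rev using q j0 arc_props(4) by (auto simp: successively_conv_nth rpath_iff)
    have 3: "last (take (Suc i0) p) = q ! j0" using i0 j0 by (simp add: take_Suc_conv_app_nth)
    have 4: "hd (rev (take j0 q)) = q ! (j0 - 1)"
      using j0 \<open>j0 \<noteq> 0\<close> \<open>q \<noteq> []\<close> by (simp add: hd_rev last_conv_nth min_absorb2)
    obtain l where l: "j0 = Suc l" using \<open>j0 \<noteq> 0\<close> not0_implies_Suc by blast
    have "\<forall>i. Suc i < length q \<longrightarrow> (q ! i, q ! Suc i) \<in> parcs G" using q unfolding rpath_iff by blast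
    then have "(q ! l, q ! Suc l) \<in> parcs G" using j0(1) l by blast
    then have "(q ! j0, q ! (j0 - 1)) \<in> parcs G" using arc_props(4) l by simp
    then show ?thesis unfolding w_def successively_append_iff using 1 2 3 4 by simp
  qed
  have dist: "distinct (tl w)"
  proof -
    have tl: "tl w = tl (take (Suc i0) p) @ rev (take j0 q)" using \<open>p \<noteq> []\<close> by (simp add: w_def)
    have "set (tl (take (Suc i0) p)) \<inter> set (take j0 q) = {}"
    proof (rule ccontr)
      assume "set (tl (take (Suc i0) p)) \<inter> set (take j0 q) \<noteq> {}"
      then obtain x where x: "x \<in> set (tl (take (Suc i0) p))" "x \<in> set (take j0 q)" by blast
      obtain l where l: "l < length (tl (take (Suc i0) p))" "x = tl (take (Suc i0) p) ! l"
        using x(1) by (auto simp: in_set_conv_nth)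
      then have l': "Suc l \<le> i0" "x = p ! Suc l" using i0 by (auto simp: nth_tl)
      have "x \<in> set q" using x(2) by (rule in_set_takeD)
      then have "Suc l = i0" using min[of "Suc l"] l' by force
      then have "x = q ! j0" using l' j0 by simp
      moreover obtain l2 where "l2 < j0" "x = q ! l2" using x(2) by (auto simp: in_set_conv_nth)
      moreover have "distinct q" using q by (simp add: rpath_iff)
      ultimately show False using j0(1) nth_eq_iff_index_eq[of q j0 l2] by auto
    qed
    moreover have "distinct p" "distinct q" using p q by (auto simp: rpath_iff)
    ultimately show ?thesis unfolding tl by (simp add: distinct_tl)
  qed
  have "w \<noteq> []" using len by auto
  have vw: "length (vwalk_arcs w) = i0 + j0" 
    using len vwalk_length_simp[of w] unfolding vwalk_length_def by simp
  interpret pair_graph G by (rule pair_graph)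
  have "cycle (vwalk_arcs w)"
    unfolding cycle_def awalk_def
    using awalk_vwalk_arcs[OF \<open>w \<noteq> []\<close>] \<open>hd w = r\<close> \<open>last w = r\<close> dist succ root_in vw i0(1)
    by (intro exI[of _ r]) (auto simp: vwalk_arcs_subset_iff)
  moreover have "3 \<le> length (vwalk_arcs w)" using vw ij i0(1) \<open>j0 \<noteq> 0\<close> by linarith
  ultimately show False using fan by (auto simp: fan_def)
qed

lemma rpath_meet_index:
  assumes p: "rpath p" and q: "rpath q"
    and meet: "p ! i = q ! j" "0 < i" "i < length p" "0 < j" "j < length q"
  shows "i = j"
proof -
  note ag = rpath_agree[OF p q rpath_meet[OF assms]]
  show ?thesis
  proof (cases "i < length q")
    case True
    then have "q ! i = q ! j" using ag[of i] meet by simp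
    then show ?thesis using q True meet by (simp add: rpath_iff nth_eq_iff_index_eq)
  next
    case False
    then have "p ! j = p ! i" using ag[of j] meet by simp
    moreover have "distinct p" using p by (simp add: rpath_iff)
    ultimately show ?thesis using nth_eq_iff_index_eq[of p j i] False meet by simp
  qed
qed

lemma rpath_unique:
  assumes p: "rpath p" and q: "rpath q" and last: "last p = last q"
  shows "p = q"
proof -
  have ne: "p \<noteq> []" "q \<noteq> []" using p q by (auto simp: rpath_iff)
  define i where "i = length p - 1"
  define j where "j = length q - 1"
  have eq: "p ! i = q ! j" using last ne by (simp add: i_def j_def last_conv_nth)
  have len: "length p = Suc i" "length q = Suc j" using ne by (auto simp: i_def j_def)
  have zero: "i = 0 \<longleftrightarrow> j = 0"
  proof -
    have "p ! 0 = r" "q ! 0 = r" using p q by (auto simp: rpath_iff)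
    then show ?thesis
      using eq rpath_nonroot(1)[OF p, of i] rpath_nonroot(1)[OF q, of j] len by (metis lessI neq0_conv)
  qed
  show ?thesis
  proof (cases "i = 0")
    case True
    then show ?thesis using zero len p q by (auto simp: rpath_iff length_Suc_conv)
  next
    case False
    then have "i = j" using rpath_meet_index[OF p q eq] zero len by simp
    moreover have "p ! 1 = q ! 1" using rpath_meet[OF p q eq] zero len False by simp
    ultimately show ?thesis
      using rpath_agree[OF p q] len by (intro nth_equalityI) auto
  qed
qed

definition pth :: "'a \<Rightarrow> 'a list" where
  "pth t = (SOME p. rpath p \<and> last p = t)"

lemma pth: assumes "t \<in> pverts G" shows "rpath (pth t)" "last (pth t) = t"
  using someI_ex[OF rpath_exists[OF assms]] by (simp_all add: pth_def)

lemma pth_eq: "rpath p \<Longrightarrow> pth (last p) = p"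
proof -
  assume p: "rpath p"
  then have "last p \<in> pverts G" by (auto simp: rpath_iff)
  from pth[OF this] show ?thesis using rpath_unique[OF _ p] by blast
qed

lemma tree_le_pth: "tree_le G r s t \<longleftrightarrow> t \<in> pverts G \<and> s \<in> set (pth t)"
proof
  assume "tree_le G r s t"
  then obtain p where p: "rpath p" "last p = t" "s \<in> set p" by (auto simp: tree_le_iff)
  then show "t \<in> pverts G \<and> s \<in> set (pth t)" using pth_eq[OF p(1)] by (auto simp: rpath_iff)
qed (use pth in \<open>auto simp: tree_le_iff\<close>)

lemma rpath_take: "rpath p \<Longrightarrow> i < length p \<Longrightarrow> rpath (take (Suc i) p) \<and> last (take (Suc i) p) = p ! i"
  by (auto simp: rpath_iff take_Suc_conv_app_nth[symmetric] dest: in_set_takeD) (simp add: take_Suc_conv_app_nth)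

definition depth :: "'a \<Rightarrow> nat" where "depth t = length (pth t) - 1"

text \<open>The first vertex after the root names the branch. For the root itself the index is out
  of range and the value arbitrary, which is why statements about rays set the root apart.\<close>

definition ray :: "'a \<Rightarrow> 'a" where "ray t = pth t ! 1"

lemma pth_depth: "t \<in> pverts G \<Longrightarrow> length (pth t) = Suc (depth t) \<and> pth t ! depth t = t \<and> pth t ! 0 = r"
  using pth[of t] by (auto simp: depth_def rpath_iff last_conv_nth)

lemma pth_nth:
  assumes "t \<in> pverts G" "i \<le> depth t"
  shows "pth (pth t ! i) = take (Suc i) (pth t)" "depth (pth t ! i) = i" "pth t ! i \<in> pverts G"
proof -
  have len: "i < length (pth t)" using pth_depth[OF assms(1)] assms(2) by simp
  from rpath_take[OF pth(1)[OF assms(1)] this]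
  show eq: "pth (pth t ! i) = take (Suc i) (pth t)" using pth_eq by metis
  show "depth (pth t ! i) = i" using len unfolding depth_def eq by simp
  show "pth t ! i \<in> pverts G" using pth(1)[OF assms(1)] len by (auto simp: rpath_iff)
qed

lemma depth_0: "t \<in> pverts G \<Longrightarrow> depth t = 0 \<longleftrightarrow> t = r"
proof
  show "t = r" if "t \<in> pverts G" "depth t = 0" using pth_depth[OF that(1)] that(2) by metis
  show "depth t = 0" if "t \<in> pverts G" "t = r"
    using pth_nth(2)[OF that(1), of 0] pth_depth[OF that(1)] that(2) by simp
qed

lemma same_ray:
  assumes "s \<in> pverts G" "t \<in> pverts G" "s \<noteq> r" "t \<noteq> r" "ray s = ray t" "depth s \<le> depth t"
  shows "pth t ! depth s = s"
  using rpath_agree[OF pth(1)[OF assms(1)] pth(1)[OF assms(2)], of "depth s"] pth_depth[OF assms(1)]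
    pth_depth[OF assms(2)] assms(5,6) by (simp add: ray_def)

lemma ray_pth_nth:
  assumes "t \<in> pverts G" "0 < i" "i \<le> depth t"
  shows "ray (pth t ! i) = ray t" "pth t ! i \<noteq> r"
proof -
  show "ray (pth t ! i) = ray t" using assms unfolding ray_def pth_nth(1)[OF assms(1,3)] by simp
  show "pth t ! i \<noteq> r" using depth_0[OF pth_nth(3)[OF assms(1,3)]] pth_nth(2)[OF assms(1,3)] assms(2) by simp
qed

lemma tree_le_coords: "tree_le G r s t \<longleftrightarrow> s \<in> pverts G \<and> t \<in> pverts G \<and>
    (s = r \<or> (s \<noteq> r \<and> t \<noteq> r \<and> ray s = ray t \<and> depth s \<le> depth t))"
proof
  assume "tree_le G r s t"
  then have t: "t \<in> pverts G" "s \<in> set (pth t)" by (auto simp: tree_le_pth)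
  then obtain i where i: "i \<le> depth t" "s = pth t ! i"
    using pth_depth[OF t(1)] by (auto simp: in_set_conv_nth less_Suc_eq_le)
  show "s \<in> pverts G \<and> t \<in> pverts G \<and>
    (s = r \<or> (s \<noteq> r \<and> t \<noteq> r \<and> ray s = ray t \<and> depth s \<le> depth t))"
  proof (cases "i = 0")
    case True then show ?thesis using i pth_depth[OF t(1)] t(1) root_in by simp
  next
    case False
    then have "t \<noteq> r" using depth_0[OF t(1)] i(1) by auto
    then show ?thesis
      using pth_nth[OF t(1) i(1)] ray_pth_nth[OF t(1) _ i(1)] i t(1) False by simp
  qed
next
  assume a: "s \<in> pverts G \<and> t \<in> pverts G \<and>
    (s = r \<or> (s \<noteq> r \<and> t \<noteq> r \<and> ray s = ray t \<and> depth s \<le> depth t))"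
  have "\<exists>i<length (pth t). pth t ! i = s"
  proof (cases "s = r")
    case True then show ?thesis using pth_depth[of t] a by (intro exI[of _ 0]) simp
  next
    case False
    then show ?thesis using same_ray[of s t] pth_depth[of t] a by (intro exI[of _ "depth s"]) simp
  qed
  then show "tree_le G r s t" using a by (auto simp: tree_le_pth in_set_conv_nth)
qed

end

text \<open>A fan is determined by a coordinate system: the ray on which a vertex lies and its distance
  from the root.\<close>

locale fan_coords =
  fixes G :: "'a pair_pre_digraph" and r :: 'a and ray :: "'a \<Rightarrow> 'b" and depth :: "'a \<Rightarrow> nat"
  assumes root_in: "r \<in> pverts G"
    and fin: "finite (pverts G)"
    and depth_0: "\<And>t. t \<in> pverts G \<Longrightarrow> depth t = 0 \<longleftrightarrow> t = r"
    and coords_inj: "\<And>s t. s \<in> pverts G \<Longrightarrow> t \<in> pverts G \<Longrightarrow> s \<noteq> r \<Longrightarrow> t \<noteq> r \<Longrightarrow> ray s = ray t \<Longrightarrow>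
      depth s = depth t \<Longrightarrow> s = t"
    and coords_ex: "\<And>t i. t \<in> pverts G \<Longrightarrow> 0 < i \<Longrightarrow> i \<le> depth t \<Longrightarrow>
      \<exists>s\<in>pverts G. s \<noteq> r \<and> ray s = ray t \<and> depth s = i"
    and tree_le: "\<And>s t. tree_le G r s t \<longleftrightarrow> s \<in> pverts G \<and> t \<in> pverts G \<and>
      (s = r \<or> (s \<noteq> r \<and> t \<noteq> r \<and> ray s = ray t \<and> depth s \<le> depth t))"
begin

text \<open>By \<open>coords_ex\<close> every depth in between is occupied, so the depths must be
  consecutive. The root lies on all rays, hence no condition on the ray when
  \<open>s = r\<close>.\<close>

lemma immediate_successor_iff:
  "immediate_successor G r s t \<longleftrightarrow> s \<in> pverts G \<and> t \<in> pverts G \<and> depth t = Suc (depth s) \<and>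
    (s = r \<or> ray s = ray t)"
proof
  assume im: "immediate_successor G r s t"
  then have st: "s \<in> pverts G" "t \<in> pverts G" "s \<noteq> t" and or: "s = r \<or> (s \<noteq> r \<and> t \<noteq> r \<and> ray s = ray t \<and> depth s \<le> depth t)"
    and none: "\<And>u. u \<noteq> s \<Longrightarrow> u \<noteq> t \<Longrightarrow> tree_le G r s u \<Longrightarrow> tree_le G r u t \<Longrightarrow> False"
    by (auto simp: immediate_successor_def tree_le)
  have tr: "t \<noteq> r" using or st(3) by auto
  have "depth s < depth t"
    using or coords_inj[of s t] depth_0[of s] depth_0[of t] st tr by (cases "s = r") (auto simp: le_less)
  have "depth t = Suc (depth s)"
  proof (rule ccontr)
    assume "depth t \<noteq> Suc (depth s)"
    then have lt: "Suc (depth s) < depth t" using \<open>depth s < depth t\<close> by simp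
    then obtain u where u: "u \<in> pverts G" "u \<noteq> r" "ray u = ray t" "depth u = Suc (depth s)"
      using coords_ex[OF st(2), of "Suc (depth s)"] by auto
    have "tree_le G r s u" "tree_le G r u t" using u st tr or lt by (auto simp: tree_le)
    moreover have "u \<noteq> s" "u \<noteq> t" using u lt by auto
    ultimately show False using none by blast
  qed
  then show "s \<in> pverts G \<and> t \<in> pverts G \<and> depth t = Suc (depth s) \<and> (s = r \<or> ray s = ray t)"
    using st or by auto
next
  assume a: "s \<in> pverts G \<and> t \<in> pverts G \<and> depth t = Suc (depth s) \<and> (s = r \<or> ray s = ray t)"
  then have tr: "t \<noteq> r" using depth_0[of t] by auto
  have "u = s \<or> u = t" if "tree_le G r s u" "tree_le G r u t" for u
  proof (cases "u = r")
    case True then show ?thesis using that by (auto simp: tree_le)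
  next
    case False
    then have u: "u \<in> pverts G" "ray u = ray t" "depth u \<le> depth t" "depth s \<le> depth u"
      using that depth_0[of s] by (auto simp: tree_le)
    show ?thesis
    proof (cases "depth u = depth t")
      case True then show ?thesis using coords_inj[of u t] u a False tr by auto
    next
      case neq: False
      then have "depth u = depth s" using u a by linarith
      then show ?thesis using coords_inj[of u s] u a False depth_0[of u] depth_0[of s] by auto
    qed
  qed
  moreover have "tree_le G r s t" using a tr by (auto simp: tree_le)
  moreover have "s \<noteq> t" using a by auto
  ultimately show "immediate_successor G r s t" by (auto simp: immediate_successor_def)
qed

definition arm :: "'b \<Rightarrow> 'a set" where
  "arm j = insert r {t \<in> pverts G - {r}. ray t = j}"

lemma chain_iff: "pred_on.chain (pverts G) (tree_le G r) b \<longleftrightarrow>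
    b \<subseteq> pverts G \<and> (\<forall>x\<in>b - {r}. \<forall>y\<in>b - {r}. ray x = ray y)"
proof -
  have *: "(tree_le G r)\<^sup>=\<^sup>= x y \<or> (tree_le G r)\<^sup>=\<^sup>= y x \<longleftrightarrow> x = r \<or> y = r \<or> ray x = ray y"
    if "x \<in> pverts G" "y \<in> pverts G" for x y
    using that root_in by (auto simp: tree_le)
  show ?thesis
  proof (cases "b \<subseteq> pverts G")
    case True
    then have "(\<forall>x\<in>b. \<forall>y\<in>b. (tree_le G r)\<^sup>=\<^sup>= x y \<or> (tree_le G r)\<^sup>=\<^sup>= y x) \<longleftrightarrow>
        (\<forall>x\<in>b. \<forall>y\<in>b. x = r \<or> y = r \<or> ray x = ray y)"
      by (intro ball_cong refl *) auto
    then show ?thesis unfolding pred_on.chain_def using True by auto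
  qed (simp add: pred_on.chain_def)
qed

text \<open>Maximal chains are whole rays together with the root. The one-vertex fan has no ray and
  forms a case of its own.\<close>

lemma branches_eq:
  "branches G r = (if pverts G = {r} then {{r}} else arm ` ray ` (pverts G - {r}))"
proof -
  have max: "pred_on.maxchain (pverts G) (tree_le G r) b \<longleftrightarrow>
     pred_on.chain (pverts G) (tree_le G r) b \<and>
     (\<forall>c. pred_on.chain (pverts G) (tree_le G r) c \<longrightarrow> b \<subseteq> c \<longrightarrow> c = b)" for b
    unfolding pred_on.maxchain_def by blast
  have branchI: "b \<in> branches G r" if "pred_on.chain (pverts G) (tree_le G r) b"
    "\<forall>c. pred_on.chain (pverts G) (tree_le G r) c \<longrightarrow> b \<subseteq> c \<longrightarrow> c = b" for b
    unfolding branches_def max mem_Collect_eq using that by (rule conjI)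
  have arm_chain: "pred_on.chain (pverts G) (tree_le G r) (arm j)" for j
  proof -
    have "arm j \<subseteq> pverts G" using root_in by (auto simp: arm_def)
    moreover have "ray x = j" if "x \<in> arm j - {r}" for x using that by (auto simp: arm_def)
    ultimately show ?thesis unfolding chain_iff by (metis (no_types))
  qed
  show ?thesis
  proof (cases "pverts G = {r}")
    case True
    have "branches G r = {{r}}"
    proof (intro equalityI subsetI)
      fix b assume "b \<in> branches G r"
      then have b: "pred_on.chain (pverts G) (tree_le G r) b"
        and mx: "\<forall>c. pred_on.chain (pverts G) (tree_le G r) c \<longrightarrow> b \<subseteq> c \<longrightarrow> c = b"
        unfolding branches_def max by simp_all
      have "b \<subseteq> {r}" using b True unfolding chain_iff by simp
      moreover have "pred_on.chain (pverts G) (tree_le G r) {r}" unfolding chain_iff using True by simp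
      ultimately have "{r} = b" using mx by blast
      then show "b \<in> {{r}}" by simp
    next
      fix b assume "b \<in> {{r}}"
      then have "b = {r}" by simp
      moreover have "c = b" if "pred_on.chain (pverts G) (tree_le G r) c" "b \<subseteq> c" for c
        using that True \<open>b = {r}\<close> unfolding chain_iff by blast
      moreover have "pred_on.chain (pverts G) (tree_le G r) {r}" unfolding chain_iff using True by simp
      ultimately show "b \<in> branches G r" using branchI[of b] by (metis (no_types))
    qed
    then show ?thesis using True by simp
  next
    case False
    have "branches G r = arm ` ray ` (pverts G - {r})"
    proof (intro equalityI subsetI)
      fix b assume "b \<in> branches G r"
      then have ch: "pred_on.chain (pverts G) (tree_le G r) b"
        and mx: "\<forall>c. pred_on.chain (pverts G) (tree_le G r) c \<longrightarrow> b \<subseteq> c \<longrightarrow> c = b"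
        unfolding branches_def max by simp_all
      from ch have b: "b \<subseteq> pverts G" "\<forall>x\<in>b - {r}. \<forall>y\<in>b - {r}. ray x = ray y"
        unfolding chain_iff by blast+
      obtain x where x: "x \<in> pverts G - {r}" "b \<subseteq> arm (ray x)"
      proof (cases "b - {r} = {}")
        case True
        obtain x where "x \<in> pverts G - {r}" using False root_in by blast
        moreover have "b \<subseteq> {r}" using True by blast
        then have "b \<subseteq> arm (ray x)" unfolding arm_def by blast
        ultimately show thesis by (rule that)
      next
        case False
        then obtain x where x: "x \<in> b - {r}" by blast
        then have "b \<subseteq> arm (ray x)" using b(1,2) unfolding arm_def by blast
        moreover have "x \<in> pverts G - {r}" using x b(1) by blast
        ultimately show thesis using that by blast
      qed
      then have "arm (ray x) = b" using mx arm_chain x(2) by blast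
      then show "b \<in> arm ` ray ` (pverts G - {r})" using x by blast
    next
      fix b assume "b \<in> arm ` ray ` (pverts G - {r})"
      then obtain x where x: "x \<in> pverts G" "x \<noteq> r" "b = arm (ray x)" by auto
      have "c = b" if c: "pred_on.chain (pverts G) (tree_le G r) c" "b \<subseteq> c" for c
      proof
        have "x \<in> c" using c(2) x by (auto simp: arm_def)
        show "c \<subseteq> b"
        proof
          fix y assume "y \<in> c"
          then have "y \<in> pverts G" "y \<noteq> r \<Longrightarrow> ray y = ray x"
            using c(1) \<open>x \<in> c\<close> x(2) unfolding chain_iff by blast+
          then show "y \<in> b" unfolding x(3) arm_def by blast
        qed
      qed (rule c(2))
      then show "b \<in> branches G r" unfolding x(3) by (intro branchI[OF arm_chain] allI impI)
    qed
    then show ?thesis using False by simp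
  qed
qed

end

lemma (in rooted_fan) fan_coords: "fan_coords G r ray depth"
proof (rule fan_coords.intro)
  fix s t assume a: "s \<in> pverts G" "t \<in> pverts G" "s \<noteq> r" "t \<noteq> r" "ray s = ray t" "depth s = depth t"
  have "pth t ! depth s = s" by (rule same_ray[OF a(1-5)]) (simp add: a(6))
  moreover have "pth t ! depth t = t" using pth_depth[OF a(2)] by blast
  ultimately show "s = t" unfolding a(6) by (rule trans[OF sym])
next
  fix t i assume a: "t \<in> pverts G" "0 < i" "i \<le> depth t"
  show "\<exists>s\<in>pverts G. s \<noteq> r \<and> ray s = ray t \<and> depth s = i"
    by (rule bexI[of _ "pth t ! i"]) (intro conjI ray_pth_nth[OF a] pth_nth(2,3)[OF a(1,3)])+
qed (fact root_in finite_verts depth_0 tree_le_coords)+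

section \<open>Coordinates of ordered fans\<close>

text \<open>In a grid the vertices \<open>v i 0\<close> all coincide with the root, and \<open>v i t\<close> is the vertex at
  height \<open>t\<close> of the \<open>i\<close>-th branch.\<close>

definition grid :: "(nat \<Rightarrow> nat \<Rightarrow> 'a) \<Rightarrow> nat \<Rightarrow> nat \<Rightarrow> 'a rel_struct \<Rightarrow> bool" where
  "grid v k n A \<longleftrightarrow> 0 < k \<and>
     (\<forall>i<k. \<forall>j<k. \<forall>s\<le>n. \<forall>t\<le>n. v i s = v j t \<longleftrightarrow> s = t \<and> (s = 0 \<or> i = j)) \<and>
     points A = discrete_topology {v i t | i t. i < k \<and> t \<le> n} \<and>
     rel_R A = {(v i s, v i t) | i s t. i < k \<and> s \<le> n \<and> t \<le> n \<and> (t = s \<or> t = Suc s)} \<and>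
     rel_S A = {(v i s, v j t) | i j s t. i \<le> j \<and> j < k \<and> s \<le> n \<and> t \<le> n}"

lemma grid_eq:
  "grid v k n A \<Longrightarrow> i < k \<Longrightarrow> j < k \<Longrightarrow> s \<le> n \<Longrightarrow> t \<le> n \<Longrightarrow> v i s = v j t \<longleftrightarrow> s = t \<and> (s = 0 \<or> i = j)"
  and grid_points: "grid v k n A \<Longrightarrow> points A = discrete_topology {v i t | i t. i < k \<and> t \<le> n}"
  and grid_R: "grid v k n A \<Longrightarrow> rel_R A = {(v i s, v i t) | i s t. i < k \<and> s \<le> n \<and> t \<le> n \<and> (t = s \<or> t = Suc s)}"
  and grid_S: "grid v k n A \<Longrightarrow> rel_S A = {(v i s, v j t) | i j s t. i \<le> j \<and> j < k \<and> s \<le> n \<and> t \<le> n}"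
  unfolding grid_def by presburger+

text \<open>Vertices are natural numbers because the class of fans is given over \<open>nat\<close>.
  The code forgets the branch at height 0, so that all branches share the root.\<close>

definition vtx :: "nat \<Rightarrow> nat \<Rightarrow> nat" where
  "vtx j t = prod_encode (if t = 0 then 0 else j, t)"

lemma vtx_eq: "vtx i s = vtx j t \<longleftrightarrow> s = t \<and> (s = 0 \<or> i = j)"
  by (auto simp: vtx_def)

definition vroot :: nat where "vroot = vtx 0 0"

lemma vtx_root [simp]: "vtx j 0 = vroot" "vtx j t = vroot \<longleftrightarrow> t = 0" "vroot = vtx j t \<longleftrightarrow> t = 0"
  by (auto simp: vroot_def vtx_eq)

definition std_fan :: "nat \<Rightarrow> nat \<Rightarrow> nat rel_struct" where
  "std_fan k n = \<lparr>points = discrete_topology {vtx i t | i t. i < k \<and> t \<le> n},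
     rel_R = {(vtx i s, vtx i t) | i s t. i < k \<and> s \<le> n \<and> t \<le> n \<and> (t = s \<or> t = Suc s)},
     rel_S = {(vtx i s, vtx j t) | i j s t. i \<le> j \<and> j < k \<and> s \<le> n \<and> t \<le> n}\<rparr>"

lemma grid_std_fan: "0 < k \<Longrightarrow> grid vtx k n (std_fan k n)"
  by (simp add: grid_def std_fan_def vtx_eq)

text \<open>Vertices are matched by coordinates. A vertex with several coordinates is the root, and
  both grids identify the same coordinates, so the choice in \<open>\<beta>\<close> is
  harmless.\<close>

lemma epimorphism_grids:
  assumes v: "grid v k n A" and w: "grid w k n B"
  shows "\<exists>\<beta>. epimorphism \<beta> A B \<and> inj_on \<beta> (topspace (points A))"
proof -
  have tv: "topspace (points A) = {v i t | i t. i < k \<and> t \<le> n}"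
    and tw: "topspace (points B) = {w i t | i t. i < k \<and> t \<le> n}"
    using v w by (simp_all add: grid_def)
  define P where "P x y \<longleftrightarrow> (\<exists>i t. i < k \<and> t \<le> n \<and> x = v i t \<and> y = w i t)" for x y
  define \<beta> where "\<beta> x = (SOME y. P x y)" for x
  have \<beta>: "\<beta> (v i t) = w i t" if it: "i < k" "t \<le> n" for i t
  proof -
    have "P (v i t) (w i t)" using it by (auto simp: P_def)
    then have "P (v i t) (\<beta> (v i t))" unfolding \<beta>_def by (rule someI)
    then obtain j s where js: "j < k" "s \<le> n" "v i t = v j s" "\<beta> (v i t) = w j s" by (auto simp: P_def)
    then have "w j s = w i t"
      using grid_eq[OF v it(1) js(1) it(2) js(2)] grid_eq[OF w js(1) it(1) js(2) it(2)] by auto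
    then show ?thesis using js(4) by simp
  qed
  have img: "\<beta> ` topspace (points A) = topspace (points B)"
  proof
    show "\<beta> ` topspace (points A) \<subseteq> topspace (points B)"
    proof
      fix y assume "y \<in> \<beta> ` topspace (points A)"
      then obtain i t where "i < k" "t \<le> n" "y = \<beta> (v i t)" unfolding tv by blast
      then show "y \<in> topspace (points B)" using \<beta> unfolding tw by auto
    qed
    show "topspace (points B) \<subseteq> \<beta> ` topspace (points A)"
    proof
      fix y assume "y \<in> topspace (points B)"
      then obtain i t where it: "i < k" "t \<le> n" "y = w i t" unfolding tw by blast
      then have "y = \<beta> (v i t)" "v i t \<in> topspace (points A)" using \<beta> unfolding tv by auto
      then show "y \<in> \<beta> ` topspace (points A)" by blast
    qed
  qed
  have R: "rel_R B = map_prod \<beta> \<beta> ` rel_R A"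
  proof (intro equalityI subrelI)
    fix x y assume "(x, y) \<in> rel_R B"
    then obtain i s t where st: "i < k" "s \<le> n" "t \<le> n" "t = s \<or> t = Suc s" "x = w i s" "y = w i t"
      unfolding grid_R[OF w] by blast
    then have "(v i s, v i t) \<in> rel_R A" "(x, y) = map_prod \<beta> \<beta> (v i s, v i t)"
      unfolding grid_R[OF v] using \<beta> by auto
    then show "(x, y) \<in> map_prod \<beta> \<beta> ` rel_R A" by blast
  next
    fix x y assume "(x, y) \<in> map_prod \<beta> \<beta> ` rel_R A"
    then obtain i s t where st: "i < k" "s \<le> n" "t \<le> n" "t = s \<or> t = Suc s"
      "x = \<beta> (v i s)" "y = \<beta> (v i t)"
      unfolding grid_R[OF v] by auto
    then show "(x, y) \<in> rel_R B" unfolding grid_R[OF w] using \<beta> by auto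
  qed
  have S: "rel_S B = map_prod \<beta> \<beta> ` rel_S A"
  proof (intro equalityI subrelI)
    fix x y assume "(x, y) \<in> rel_S B"
    then obtain i j s t where st: "i \<le> j" "j < k" "s \<le> n" "t \<le> n" "x = w i s" "y = w j t"
      unfolding grid_S[OF w] by blast
    then have "(v i s, v j t) \<in> rel_S A" "(x, y) = map_prod \<beta> \<beta> (v i s, v j t)"
      unfolding grid_S[OF v] using \<beta> by auto
    then show "(x, y) \<in> map_prod \<beta> \<beta> ` rel_S A" by blast
  next
    fix x y assume "(x, y) \<in> map_prod \<beta> \<beta> ` rel_S A"
    then obtain i j s t where st: "i \<le> j" "j < k" "s \<le> n" "t \<le> n"
      "x = \<beta> (v i s)" "y = \<beta> (v j t)"
      unfolding grid_S[OF v] by auto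
    then have "x = w i s" "y = w j t" using \<beta> by auto
    then show "(x, y) \<in> rel_S B" unfolding grid_S[OF w] using st by blast
  qed
  have "inj_on \<beta> (topspace (points A))"
  proof (rule inj_onI)
    fix x y assume xy: "x \<in> topspace (points A)" "y \<in> topspace (points A)" and eq: "\<beta> x = \<beta> y"
    obtain i s where x: "i < k" "s \<le> n" "x = v i s" using xy(1) unfolding tv by blast
    obtain j t where y: "j < k" "t \<le> n" "y = v j t" using xy(2) unfolding tv by blast
    have "w i s = w j t" using eq \<beta> x y by simp
    then have "v i s = v j t"
      unfolding grid_eq[OF w x(1) y(1) x(2) y(2)] grid_eq[OF v x(1) y(1) x(2) y(2)] .
    then show "x = y" using x(3) y(3) by simp
  qed
  moreover have "continuous_map (points A) (points B) \<beta>"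
  proof -
    have "\<beta> \<in> topspace (points A) \<rightarrow> topspace (points B)" using img by blast
    then show ?thesis unfolding grid_points[OF v] by (simp add: continuous_map_from_discrete_topology)
  qed
  ultimately show ?thesis unfolding epimorphism_def using img R S by blast
qed

context fan_coords
begin

lemma arm_grid:
  assumes x: "x \<in> pverts G" "x \<noteq> r"
  shows "bij_betw depth (arm (ray x)) {..height (arm (ray x))}"
proof -
  let ?b = "arm (ray x)"
  have sub: "?b \<subseteq> pverts G" using root_in by (auto simp: arm_def)
  have finb: "finite ?b" using sub fin finite_subset by blast
  have rb: "r \<in> ?b" "x \<in> ?b" using x by (auto simp: arm_def)
  have ray: "ray y = ray x" if "y \<in> ?b" "y \<noteq> r" for y using that by (auto simp: arm_def)
  have inj: "inj_on depth ?b"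
  proof (rule inj_onI)
    fix y z assume yz: "y \<in> ?b" "z \<in> ?b" "depth y = depth z"
    show "y = z"
    proof (cases "y = r \<or> z = r")
      case True
      then show ?thesis using yz sub depth_0[of y] depth_0[of z] depth_0[OF root_in] by (metis subsetD)
    next
      case False
      then show ?thesis using coords_inj[of y z] yz sub ray by (metis subsetD)
    qed
  qed
  define L where "L = Max (depth ` ?b)"
  have "L \<in> depth ` ?b" unfolding L_def using finb rb by (intro Max_in) auto
  then obtain z where z: "z \<in> ?b" "depth z = L" by blast
  have "depth x \<le> L" unfolding L_def using finb rb by (intro Max_ge) auto
  moreover have "0 < depth x" using depth_0[OF x(1)] x(2) by simp
  ultimately have "z \<noteq> r" using z depth_0[OF root_in] by auto
  have img: "depth ` ?b = {..L}"
  proof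
    show "depth ` ?b \<subseteq> {..L}" unfolding L_def using finb by auto
    show "{..L} \<subseteq> depth ` ?b"
    proof
      fix i assume i: "i \<in> {..L}"
      show "i \<in> depth ` ?b"
      proof (cases "i = 0")
        case True then show ?thesis using rb(1) depth_0[OF root_in] by force
      next
        case False
        then obtain s where s: "s \<in> pverts G" "s \<noteq> r" "ray s = ray z" "depth s = i"
          using coords_ex[of z i] z i sub by auto
        then have "s \<in> ?b" using ray[OF z(1) \<open>z \<noteq> r\<close>] by (simp add: arm_def)
        then show ?thesis using s(4) by blast
      qed
    qed
  qed
  have "card ?b = Suc L" using card_image[OF inj] img by simp
  then have "height ?b = L" by (simp add: height_def)
  then show ?thesis using inj img by (simp add: bij_betw_def)
qed

text \<open>On each branch depth is a bijection onto an initial segment, the same for all branches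
  since their heights agree; its inverse on the \<open>i\<close>-th listed branch gives the
  coordinates \<open>v i t\<close>.\<close>

lemma grid_exists:
  assumes hts: "\<forall>b\<in>branches G r. \<forall>c\<in>branches G r. height b = height c"
    and bs: "distinct bs" "set bs = branches G r"
    and A: "points A = discrete_topology (pverts G)"
      "rel_R A = {(s, t). s \<in> pverts G \<and> t \<in> pverts G \<and> (s = t \<or> immediate_successor G r s t)}"
      "rel_S A = {(x, y). \<exists>i j. i \<le> j \<and> j < length bs \<and> x \<in> bs ! i \<and> y \<in> bs ! j}"
  shows "\<exists>v k n. grid v k n A"
proof (cases "pverts G = {r}")
  case True
  then have "branches G r = {{r}}" using branches_eq by simp
  then have "bs = [{r}]"
    using bs by (metis distinct.simps(2) distinct_length_2_or_more insert_iff insert_not_empty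
        list.set(1) list.set(2) list.set_cases neq_Nil_conv singletonD singletonI list.exhaust set_empty)
  moreover have "\<not> immediate_successor G r r r" by (simp add: immediate_successor_def)
  ultimately have "grid (\<lambda>_ _. r) 1 0 A"
    unfolding grid_def A True by (auto simp: less_Suc_eq)
  then show ?thesis by blast
next
  case False
  have br: "branches G r = arm ` ray ` (pverts G - {r})" using branches_eq False by simp
  define k where "k = length bs"
  define n where "n = height (bs ! 0)"
  have "branches G r \<noteq> {}" using br False root_in by auto
  then have k: "0 < k" using bs by (auto simp: k_def)
  have bin: "bs ! i \<in> branches G r" if "i < k" for i using that bs nth_mem by (auto simp: k_def)
  have "\<exists>x\<in>pverts G - {r}. bs ! i = arm (ray x)" if "i < k" for i using bin[OF that] unfolding br by blast
  then obtain e where e: "\<And>i. i < k \<Longrightarrow> e i \<in> pverts G - {r}" "\<And>i. i < k \<Longrightarrow> bs ! i = arm (ray (e i))"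
    by metis
  have bij: "bij_betw depth (bs ! i) {..n}" if "i < k" for i
  proof -
    have "height (bs ! i) = n" unfolding n_def using hts bin that k by blast
    then show ?thesis using arm_grid[of "e i"] e[OF that] by simp
  qed
  define v where "v i t = inv_into (bs ! i) depth t" for i t
  have v: "v i t \<in> bs ! i" "depth (v i t) = t" if "i < k" "t \<le> n" for i t
    using bij_betw_inv_into_right[OF bij[OF that(1)]] bij_betwE[OF bij_betw_inv_into[OF bij[OF that(1)]]] that(2)
    by (simp_all add: v_def)
  have vd: "x = v i (depth x)" "depth x \<le> n" if "i < k" "x \<in> bs ! i" for i x
    using bij_betw_inv_into_left[OF bij[OF that(1)] that(2)] bij_betwE[OF bij[OF that(1)]] that(2)
    by (simp_all add: v_def)
  have bsv: "bs ! i = {v i t | t. t \<le> n}" if "i < k" for i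
    using v[OF that] vd[OF that] by blast
  have rb: "r \<in> bs ! i" if "i < k" for i using e(2)[OF that] by (simp add: arm_def)
  have bV: "bs ! i \<subseteq> pverts G" if "i < k" for i using e(2)[OF that] root_in by (auto simp: arm_def)
  have vV: "v i t \<in> pverts G" if "i < k" "t \<le> n" for i t using v(1)[OF that] bV[OF that(1)] by blast
  have ray: "ray x = ray (e i)" if "i < k" "x \<in> bs ! i" "x \<noteq> r" for i x
    using that e(2)[OF that(1)] by (simp add: arm_def)
  have inb: "x \<in> bs ! i" if "i < k" "x \<in> pverts G" "ray x = ray (e i)" "x \<noteq> r" for i x
    using that e(2)[OF that(1)] by (simp add: arm_def)
  have v0: "v i t = r \<longleftrightarrow> t = 0" if "i < k" "t \<le> n" for i t
    using depth_0[OF vV[OF that]] v(2)[OF that] by simp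
  have V: "pverts G = {v i t | i t. i < k \<and> t \<le> n}"
  proof
    show "pverts G \<subseteq> {v i t | i t. i < k \<and> t \<le> n}"
    proof
      fix x assume x: "x \<in> pverts G"
      have "\<exists>i<k. x \<in> bs ! i"
      proof (cases "x = r")
        case True then show ?thesis using rb k by blast
      next
        case False
        then have "arm (ray x) \<in> set bs" using x bs br by blast
        then obtain i where "i < k" "bs ! i = arm (ray x)" by (auto simp: in_set_conv_nth k_def)
        then show ?thesis using x False by (auto simp: arm_def)
      qed
      then show "x \<in> {v i t | i t. i < k \<and> t \<le> n}" using vd by blast
    qed
    show "{v i t | i t. i < k \<and> t \<le> n} \<subseteq> pverts G" using vV by blast
  qed
  have veq: "v i s = v j t \<longleftrightarrow> s = t \<and> (s = 0 \<or> i = j)" if "i < k" "j < k" "s \<le> n" "t \<le> n" for i j s t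
  proof
    assume eq: "v i s = v j t"
    then have st: "s = t" using v(2)[of i s] v(2)[of j t] that by simp
    have "i = j" if "s \<noteq> 0"
    proof -
      have "v i s \<noteq> r" using v0[of i s] \<open>i < k\<close> \<open>s \<le> n\<close> that by simp
      then have "ray (e i) = ray (e j)"
        using ray[of i "v i s"] ray[of j "v j t"] eq v(1)[of i s] v(1)[of j t] \<open>i < k\<close> \<open>j < k\<close> \<open>s \<le> n\<close> \<open>t \<le> n\<close>
        by simp
      then have "bs ! i = bs ! j" using e(2) \<open>i < k\<close> \<open>j < k\<close> by simp
      then show ?thesis using bs(1) \<open>i < k\<close> \<open>j < k\<close> by (simp add: nth_eq_iff_index_eq k_def)
    qed
    then show "s = t \<and> (s = 0 \<or> i = j)" using st by blast
  next
    assume "s = t \<and> (s = 0 \<or> i = j)"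
    then show "v i s = v j t" using v0[of i s] v0[of j t] that by auto
  qed
  have R: "rel_R A = {(v i s, v i t) | i s t. i < k \<and> s \<le> n \<and> t \<le> n \<and> (t = s \<or> t = Suc s)}"
  proof (intro equalityI subrelI)
    fix x y assume "(x, y) \<in> rel_R A"
    then have xy: "x \<in> pverts G" "y \<in> pverts G" "x = y \<or> immediate_successor G r x y" unfolding A by auto
    obtain i t where y: "i < k" "t \<le> n" "y = v i t" using xy(2) unfolding V by blast
    have "\<exists>s\<le>n. x = v i s \<and> (t = s \<or> t = Suc s)"
    proof (cases "x = y")
      case True then show ?thesis using y by blast
    next
      case False
      then have im: "depth y = Suc (depth x)" "x = r \<or> ray x = ray y"
        using xy(3) immediate_successor_iff by auto
      then have t: "t = Suc (depth x)" using y v(2) by simp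
      have "y \<noteq> r" using im(1) depth_0[OF xy(2)] by simp
      have "x \<in> bs ! i"
      proof (cases "x = r")
        case False
        then have "ray x = ray (e i)" using im(2) ray[of i y] y v(1) \<open>y \<noteq> r\<close> by simp
        then show ?thesis using inb[OF y(1) xy(1)] False by simp
      qed (use rb y(1) in simp)
      then show ?thesis using vd[OF y(1)] t by blast
    qed
    then show "(x, y) \<in> {(v i s, v i t) | i s t. i < k \<and> s \<le> n \<and> t \<le> n \<and> (t = s \<or> t = Suc s)}"
      using y by blast
  next
    fix x y assume "(x, y) \<in> {(v i s, v i t) | i s t. i < k \<and> s \<le> n \<and> t \<le> n \<and> (t = s \<or> t = Suc s)}"
    then obtain i s t where st: "i < k" "s \<le> n" "t \<le> n" "t = s \<or> t = Suc s" "x = v i s" "y = v i t" by blast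
    have xV: "x \<in> pverts G" "y \<in> pverts G" using vV st by auto
    have "x = y \<or> immediate_successor G r x y"
    proof (cases "t = s")
      case False
      then have t: "t = Suc s" using st(4) by simp
      have "y \<noteq> r" using v0[of i t] st t by simp
      have "x = r \<or> ray x = ray y"
        using ray[of i x] ray[of i y] v(1)[of i s] v(1)[of i t] st \<open>y \<noteq> r\<close> by auto
      then show ?thesis using immediate_successor_iff xV v(2) st t by simp
    qed (use st in simp)
    then show "(x, y) \<in> rel_R A" unfolding A using xV by blast
  qed
  have S: "rel_S A = {(v i s, v j t) | i j s t. i \<le> j \<and> j < k \<and> s \<le> n \<and> t \<le> n}"
  proof (intro equalityI subrelI)
    fix x y assume "(x, y) \<in> rel_S A"
    then obtain i j where ij: "i \<le> j" "j < k" "x \<in> bs ! i" "y \<in> bs ! j" unfolding A k_def by blast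
    then have "i < k" by simp
    then obtain s t where "s \<le> n" "t \<le> n" "x = v i s" "y = v j t" using ij bsv[of i] bsv[of j] by blast
    then show "(x, y) \<in> {(v i s, v j t) | i j s t. i \<le> j \<and> j < k \<and> s \<le> n \<and> t \<le> n}"
      using ij by blast
  next
    fix x y assume "(x, y) \<in> {(v i s, v j t) | i j s t. i \<le> j \<and> j < k \<and> s \<le> n \<and> t \<le> n}"
    then obtain i j s t where ij: "i \<le> j" "j < k" "s \<le> n" "t \<le> n" "x = v i s" "y = v j t" by blast
    then have "x \<in> bs ! i" "y \<in> bs ! j" using v(1) by auto
    then show "(x, y) \<in> rel_S A" unfolding A using ij k_def by blast
  qed
  have "grid v k n A" unfolding grid_def using k veq V R S A(1) by simp
  then show ?thesis by blast
qed

end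

lemma ordered_fan_grid:
  assumes "ordered_fan A"
  shows "\<exists>v k n. grid v k n A"
proof -
  from assms obtain G r bs where fan: "fan G r"
    and hts: "\<forall>b\<in>branches G r. \<forall>c\<in>branches G r. height b = height c"
    and bs: "distinct bs" "set bs = branches G r"
    and A: "points A = discrete_topology (pverts G)"
      "rel_R A = {(s, t). s \<in> pverts G \<and> t \<in> pverts G \<and> (s = t \<or> immediate_successor G r s t)}"
      "rel_S A = {(x, y). \<exists>i j. i \<le> j \<and> j < length bs \<and> x \<in> bs ! i \<and> y \<in> bs ! j}"
    unfolding ordered_fan_def by (elim exE conjE) (rule that)
  interpret rooted_fan G r by (rule rooted_fan.intro[OF fan])
  from fan_coords.grid_exists[OF fan_coords hts bs A] show ?thesis .
qed

section \<open>The standard ordered fans\<close>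

definition std_graph :: "nat \<Rightarrow> nat \<Rightarrow> nat pair_pre_digraph" where
  "std_graph k n = \<lparr>pverts = {vtx i t | i t. i < k \<and> t \<le> n},
     parcs = {(vtx i t, vtx i (Suc t)) | i t. i < k \<and> t < n} \<union> {(vtx i (Suc t), vtx i t) | i t. i < k \<and> t < n}\<rparr>"

definition vray :: "nat \<Rightarrow> nat" where "vray x = fst (prod_decode x)"

definition vdepth :: "nat \<Rightarrow> nat" where "vdepth x = snd (prod_decode x)"

lemma vdepth_vtx [simp]: "vdepth (vtx j t) = t" by (simp add: vdepth_def vtx_def)

lemma vdepth_root [simp]: "vdepth vroot = 0" using vdepth_vtx[of 0 0] by simp

lemma vray_vtx: "t \<noteq> 0 \<Longrightarrow> vray (vtx j t) = j" by (simp add: vray_def vtx_def)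

lemma std_graph_verts: "pverts (std_graph k n) = {vtx i t | i t. i < k \<and> t \<le> n}" by (simp add: std_graph_def)

lemma vtx_in: "i < k \<Longrightarrow> t \<le> n \<Longrightarrow> vtx i t \<in> pverts (std_graph k n)"
  unfolding std_graph_verts by blast

lemma std_graph_vertsE:
  assumes "x \<in> pverts (std_graph k n)"
  obtains i t where "i < k" "t \<le> n" "x = vtx i t"
  using assms unfolding std_graph_verts by blast

lemma std_graph_arcsI: "i < k \<Longrightarrow> t < n \<Longrightarrow> (vtx i t, vtx i (Suc t)) \<in> parcs (std_graph k n)"
  "i < k \<Longrightarrow> t < n \<Longrightarrow> (vtx i (Suc t), vtx i t) \<in> parcs (std_graph k n)"
  by (auto simp: std_graph_def)

lemma std_graph_arcsE:
  assumes "(x, y) \<in> parcs (std_graph k n)"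
  obtains i t where "i < k" "t < n" "x = vtx i t" "y = vtx i (Suc t)"
  | i t where "i < k" "t < n" "x = vtx i (Suc t)" "y = vtx i t"
  using assms unfolding std_graph_def by auto

lemma finite_std_graph_verts: "finite {vtx i t | i t. i < k \<and> t \<le> n}"
proof -
  have "{vtx i t | i t. i < k \<and> t \<le> n} = (\<lambda>(i, t). vtx i t) ` ({..<k} \<times> {..n})" by auto
  then show ?thesis by simp
qed

lemma pair_graph_std_graph: "pair_graph (std_graph k n)"
proof -
  have V: "fst e \<in> pverts (std_graph k n) \<and> snd e \<in> pverts (std_graph k n)" if "e \<in> parcs (std_graph k n)" for e
  proof -
    obtain x y where e: "e = (x, y)" by (cases e)
    from that[unfolded e] show ?thesis
      unfolding e by (cases rule: std_graph_arcsE) (auto intro!: vtx_in simp del: vtx_root)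
  qed
  have fV: "finite (pverts (std_graph k n))" unfolding std_graph_verts by (rule finite_std_graph_verts)
  have "parcs (std_graph k n) \<subseteq> pverts (std_graph k n) \<times> pverts (std_graph k n)" using V by (auto simp: mem_Times_iff)
  then have fA: "finite (parcs (std_graph k n))" using fV finite_subset by blast
  have "sym (parcs (std_graph k n))" unfolding std_graph_def by (rule symI) auto
  moreover have "fst e \<noteq> snd e" if "e \<in> parcs (std_graph k n)" for e
  proof -
    obtain x y where e: "e = (x, y)" by (cases e)
    from that[unfolded e] show ?thesis unfolding e by (cases rule: std_graph_arcsE) (auto simp: vtx_eq)
  qed
  ultimately show ?thesis
    using V fV fA by unfold_locales (simp_all add: symmetric_def)
qed

lemma std_graph_connected:
  assumes "0 < k"
  shows "Digraph_Component.connected (with_proj (std_graph k n))"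
proof -
  let ?V = "pverts (std_graph k n)" and ?E = "(parcs (std_graph k n))\<^sup>s"
  interpret pair_graph "std_graph k n" by (rule pair_graph_std_graph)
  have vV: "vtx i t \<in> ?V" if "i < k" "t \<le> n" for i t using that unfolding std_graph_verts by blast
  have up: "(vtx i s, vtx i (s + t)) \<in> rtrancl_on ?V ?E" if "i < k" "s + t \<le> n" for i s t
    using that(2)
  proof (induction t)
    case 0 then show ?case using vV that(1) by simp
  next
    case (Suc t)
    then have "(vtx i (s + t), vtx i (Suc (s + t))) \<in> ?E"
      using std_graph_arcsI(1)[OF that(1), of "s + t" n] by (simp add: symcl_def)
    moreover have "vtx i (Suc (s + t)) \<in> ?V" using vV[of i "Suc (s + t)"] Suc.prems that(1) by simp
    moreover have "(vtx i s, vtx i (s + t)) \<in> rtrancl_on ?V ?E" using Suc by simp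
    ultimately show ?case using rtrancl_on_into_rtrancl_on by (metis add_Suc_right)
  qed
  have down: "(vtx i t, vtx i 0) \<in> rtrancl_on ?V ?E" if "i < k" "t \<le> n" for i t
    using that(2)
  proof (induction t)
    case 0
    have "vtx i 0 \<in> ?V" using vV[OF that(1), of 0] by blast
    then show ?case by (rule rtrancl_on_refl)
  next
    case (Suc t)
    have "(vtx i (Suc t), vtx i t) \<in> ?E"
      using std_graph_arcsI(2)[OF that(1), of t n] Suc.prems by (simp add: symcl_def)
    moreover have "vtx i t \<in> ?V" "vtx i (Suc t) \<in> ?V" using vV[OF that(1)] Suc.prems by auto
    ultimately have "(vtx i (Suc t), vtx i t) \<in> rtrancl_on ?V ?E"
      using rtrancl_on_into_rtrancl_on[OF rtrancl_on_refl[of "vtx i (Suc t)"]] by blast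
    then show ?case using rtrancl_on_trans Suc by (metis Suc_leD)
  qed
  have "(x, y) \<in> rtrancl_on ?V ?E" if xy: "x \<in> ?V" "y \<in> ?V" for x y
  proof -
    obtain i s where x: "i < k" "s \<le> n" "x = vtx i s" using xy(1) by (rule std_graph_vertsE)
    obtain j t where y: "j < k" "t \<le> n" "y = vtx j t" using xy(2) by (rule std_graph_vertsE)
    have "(x, vroot) \<in> rtrancl_on ?V ?E" using down[OF x(1,2)] x(3) by simp
    moreover have "(vroot, y) \<in> rtrancl_on ?V ?E" using up[of j 0 t] y by simp
    ultimately show ?thesis by (rule rtrancl_on_trans)
  qed
  moreover have "?V \<noteq> {}" using vV[of 0 0] assms by blast
  ultimately show ?thesis unfolding connected_conv by simp
qed

text \<open>Adjacent vertices never have equal depth, so both \<open>a\<close> and \<open>b\<close>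
  are strictly lower than \<open>x\<close>, and there is one vertex just below
  \<open>x\<close>.\<close>

lemma std_graph_lower_neighbour:
  assumes "(x, a) \<in> parcs (std_graph k n)" "(x, b) \<in> parcs (std_graph k n)" "vdepth a \<le> vdepth x" "vdepth b \<le> vdepth x"
  shows "a = b"
proof -
  have *: "\<exists>i t. x = vtx i (Suc t) \<and> y = vtx i t" if "(x, y) \<in> parcs (std_graph k n)" "vdepth y \<le> vdepth x" for y
    using that(1) by (cases rule: std_graph_arcsE) (use that(2) in auto)
  obtain i s where 1: "x = vtx i (Suc s)" "a = vtx i s" using *[OF assms(1,3)] by blast
  obtain j t where 2: "x = vtx j (Suc t)" "b = vtx j t" using *[OF assms(2,4)] by blast
  have "s = t \<and> i = j" using 1(1) 2(1) by (simp add: vtx_eq)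
  then show ?thesis using 1(2) 2(2) by simp
qed

text \<open>At a vertex of maximal depth both neighbours along the cycle are lower, hence equal,
  which is impossible on a cycle of length at least 3.\<close>

lemma std_graph_acyclic: "\<nexists>p. pre_digraph.cycle (with_proj (std_graph k n)) p \<and> 3 \<le> length p"
proof
  assume "\<exists>p. pre_digraph.cycle (with_proj (std_graph k n)) p \<and> 3 \<le> length p"
  then obtain p where p: "pre_digraph.cycle (with_proj (std_graph k n)) p" "3 \<le> length p" by blast
  interpret pair_graph "std_graph k n" by (rule pair_graph_std_graph)
  obtain u where u: "awalk u p u" "distinct (tl (pawalk_verts u p))" using p(1) unfolding cycle_def by blast
  define w where "w = pawalk_verts u p"
  define L where "L = length p"
  have gen: "length (pawalk_verts x q) = Suc (length q) \<and> pawalk_verts x q ! 0 = x \<and>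
      pawalk_verts x q ! length q = y \<and>
      (\<forall>i<length q. (pawalk_verts x q ! i, pawalk_verts x q ! Suc i) \<in> set q)" if "pcas x q y" for x q y
    using that
  proof (induction q arbitrary: x)
    case (Cons e q)
    have IH: "length (pawalk_verts (snd e) q) = Suc (length q)" "pawalk_verts (snd e) q ! 0 = snd e"
      "pawalk_verts (snd e) q ! length q = y"
      "\<forall>i<length q. (pawalk_verts (snd e) q ! i, pawalk_verts (snd e) q ! Suc i) \<in> set q"
      using Cons.IH[of "snd e"] Cons.prems by simp_all
    have "(pawalk_verts x (e # q) ! i, pawalk_verts x (e # q) ! Suc i) \<in> set (e # q)" if "i < length (e # q)" for i
      using that IH by (cases i) auto
    then show ?case using IH Cons.prems by simp
  qed simp
  have arcs: "set p \<subseteq> parcs (std_graph k n)" "pcas u p u" using u(1) unfolding awalk_def by auto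
  have w: "length w = Suc L" "w ! 0 = w ! L" "\<And>i. i < L \<Longrightarrow> (w ! i, w ! Suc i) \<in> parcs (std_graph k n)"
    using gen[OF arcs(2)] arcs(1) unfolding w_def L_def by auto
  have inj: "i = j" if "0 < i" "0 < j" "i \<le> L" "j \<le> L" "w ! i = w ! j" for i j
  proof -
    have "tl w ! (i - 1) = tl w ! (j - 1)" using that w(1) by (simp add: nth_tl)
    moreover have "i - 1 < length (tl w)" "j - 1 < length (tl w)" using that w(1) by auto
    ultimately have "i - 1 = j - 1" using u(2) unfolding w_def[symmetric] by (simp add: nth_eq_iff_index_eq)
    then show ?thesis using that by simp
  qed
  have L3: "3 \<le> L" using p(2) by (simp add: L_def)
  define D where "D = (\<lambda>i. vdepth (w ! i)) ` {1..L}"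
  have "Max D \<in> D" unfolding D_def using L3 by (intro Max_in) auto
  then obtain i where i: "1 \<le> i" "i \<le> L" "vdepth (w ! i) = Max D" unfolding D_def by auto
  have max: "vdepth (w ! j) \<le> vdepth (w ! i)" if "j \<le> L" for j
  proof -
    have "vdepth (w ! j) \<in> D" if "1 \<le> j" "j \<le> L" for j using that unfolding D_def by auto
    then have "vdepth (w ! j) \<in> D" using that w(2) L3 by (cases "j = 0") auto
    then show ?thesis unfolding i(3) by (intro Max_ge) (auto simp: D_def)
  qed
  \<comment> \<open>Positions run over \<open>{1..L}\<close>, where vertices are distinct, with
    \<open>w ! 0 = w ! L\<close>: the position before 1 is 0, later traded for \<open>L\<close>, and
    the one after \<open>L\<close> is 1.\<close>
  define a where "a = i - 1"
  define b where "b = (if i = L then 1 else Suc i)"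
  have "(w ! a, w ! Suc a) \<in> parcs (std_graph k n)" using w(3)[of a] i by (simp add: a_def)
  then have A: "(w ! i, w ! a) \<in> parcs (std_graph k n)" using i pair_sym_arcs by (simp add: a_def symmetric_def symD)
  have B: "(w ! i, w ! b) \<in> parcs (std_graph k n)"
  proof (cases "i = L")
    case True then show ?thesis using w(3)[of 0] w(2) L3 by (simp add: b_def)
  next
    case False then show ?thesis using w(3)[of i] i by (simp add: b_def)
  qed
  have "a \<le> L" "b \<le> L" using i L3 by (auto simp: a_def b_def)
  then have "w ! a = w ! b" using std_graph_lower_neighbour[OF A B] max by blast
  moreover define a' where "a' = (if a = 0 then L else a)"
  moreover have "w ! a = w ! a'" using w(2) by (cases "a = 0") (simp_all add: a'_def)
  moreover have "0 < a'" "a' \<le> L" "0 < b" using \<open>a \<le> L\<close> L3 by (auto simp: a'_def b_def)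
  ultimately have "a' = b" using inj[of a' b] \<open>b \<le> L\<close> by metis
  then show False using i L3 by (auto simp: a'_def a_def b_def split: if_splits)
qed

lemma fan_std_graph:
  assumes "0 < k"
  shows "fan (std_graph k n) (vroot)"
  unfolding fan_def
proof (intro conjI ballI)
  show "pair_graph (std_graph k n)" by (rule pair_graph_std_graph)
  show "Digraph_Component.connected (with_proj (std_graph k n))" by (rule std_graph_connected[OF assms])
  show "\<nexists>p. pre_digraph.cycle (with_proj (std_graph k n)) p \<and> 3 \<le> length p" by (rule std_graph_acyclic)
  show "vroot \<in> pverts (std_graph k n)" using assms vtx_in[of 0 k 0 n] by simp
  fix v assume v: "v \<in> pverts (std_graph k n) - {vroot}"
  then obtain i t where it: "v = vtx i t" "t \<noteq> 0" unfolding std_graph_verts by auto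
  have "out_arcs (with_proj (std_graph k n)) v \<subseteq> {(v, vtx i (t - 1)), (v, vtx i (Suc t))}"
  proof
    fix e assume "e \<in> out_arcs (with_proj (std_graph k n)) v"
    then obtain y where e: "e = (v, y)" "(v, y) \<in> parcs (std_graph k n)" by (cases e) auto
    from e(2) show "e \<in> {(v, vtx i (t - 1)), (v, vtx i (Suc t))}"
      by (cases rule: std_graph_arcsE) (use it e(1) in \<open>auto simp: vtx_eq\<close>)
  qed
  then have "out_degree (with_proj (std_graph k n)) v \<le> card {(v, vtx i (t - 1)), (v, vtx i (Suc t))}"
    unfolding out_degree_def by (intro card_mono) auto
  also have "\<dots> \<le> 2" by (simp add: card_insert_if)
  finally show "out_degree (with_proj (std_graph k n)) v \<le> 2" .
qed

lemma std_graph_tree_le: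
  assumes k: "0 < k" and j: "j < k" "t \<le> n"
  shows "tree_le (std_graph k n) (vroot) s (vtx j t) \<longleftrightarrow> (\<exists>i\<le>t. s = vtx j i)"
proof -
  interpret rooted_fan "std_graph k n" "vroot" by (rule rooted_fan.intro[OF fan_std_graph[OF k]])
  define p where "p = map (vtx j) [0..<Suc t]"
  have len: "length p = Suc t" by (simp add: p_def)
  have nth: "p ! i = vtx j i" if "i \<le> t" for i using that by (simp add: p_def nth_map_upt del: upt_Suc)
  have set: "set p = {vtx j i | i. i \<le> t}" by (auto simp: p_def less_Suc_eq_le simp del: upt_Suc)
  have "rpath p"
    unfolding rpath_iff
  proof (intro conjI allI impI)
    show "p \<noteq> []" using len by auto
    show "set p \<subseteq> pverts (std_graph k n)" unfolding set std_graph_verts using j order_trans by blast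
    show "distinct p" unfolding p_def distinct_map by (auto simp: inj_on_def vtx_eq simp del: upt_Suc)
    show "p ! 0 = vroot" using nth[of 0] by simp
    fix i assume "Suc i < length p"
    then show "(p ! i, p ! Suc i) \<in> parcs (std_graph k n)"
      using nth[of i] nth[of "Suc i"] std_graph_arcsI(1)[OF j(1), of i n] j(2) len by simp
  qed
  moreover have "last p = vtx j t" using nth[of t] len last_conv_nth[of p] by fastforce
  ultimately have "pth (vtx j t) = p" using pth_eq[of p] by simp
  moreover have "vtx j t \<in> pverts (std_graph k n)" unfolding std_graph_verts using j by blast
  ultimately show ?thesis unfolding tree_le_pth using set by auto
qed

lemma std_graph_coords:
  assumes k: "0 < k"
  shows "fan_coords (std_graph k n) (vroot) vray vdepth"
proof (rule fan_coords.intro)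
  show "vroot \<in> pverts (std_graph k n)" using k vtx_in[of 0 k 0 n] by simp
  show "finite (pverts (std_graph k n))" unfolding std_graph_verts by (rule finite_std_graph_verts)
  show "vdepth t = 0 \<longleftrightarrow> t = vroot" if "t \<in> pverts (std_graph k n)" for t
    using that unfolding std_graph_verts by (auto simp: vtx_eq)
  show "s = t" if a: "s \<in> pverts (std_graph k n)" "t \<in> pverts (std_graph k n)" "s \<noteq> vroot" "t \<noteq> vroot"
    "vray s = vray t" "vdepth s = vdepth t" for s t
  proof -
    obtain i a where s: "s = vtx i a" using a(1) by (rule std_graph_vertsE)
    obtain j b where t: "t = vtx j b" using a(2) by (rule std_graph_vertsE)
    have "a \<noteq> 0" "b \<noteq> 0" using a(3,4) s t by (auto simp: vtx_eq)
    then show ?thesis using a(5,6) unfolding s t by (simp add: vray_vtx)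
  qed
  show "\<exists>s\<in>pverts (std_graph k n). s \<noteq> vroot \<and> vray s = vray t \<and> vdepth s = i"
    if a: "t \<in> pverts (std_graph k n)" "0 < i" "i \<le> vdepth t" for t i
  proof -
    obtain j b where t: "j < k" "b \<le> n" "t = vtx j b" using a(1) by (rule std_graph_vertsE)
    then have "i \<le> b" "b \<noteq> 0" using a by auto
    then show ?thesis using a(2) t
      by (intro bexI[of _ "vtx j i"]) (auto simp: vray_vtx vtx_eq intro!: vtx_in)
  qed
  show "tree_le (std_graph k n) (vroot) s t \<longleftrightarrow> s \<in> pverts (std_graph k n) \<and> t \<in> pverts (std_graph k n) \<and>
      (s = vroot \<or> (s \<noteq> vroot \<and> t \<noteq> vroot \<and> vray s = vray t \<and> vdepth s \<le> vdepth t))" for s t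
  proof (cases "t \<in> pverts (std_graph k n)")
    case False
    interpret rooted_fan "std_graph k n" "vroot" by (rule rooted_fan.intro[OF fan_std_graph[OF k]])
    show ?thesis using False tree_le_pth by simp
  next
    case True
    then obtain j b where t: "j < k" "b \<le> n" "t = vtx j b" unfolding std_graph_verts by blast
    have "(\<exists>i\<le>b. s = vtx j i) \<longleftrightarrow> s \<in> pverts (std_graph k n) \<and>
      (s = vroot \<or> (s \<noteq> vroot \<and> t \<noteq> vroot \<and> vray s = vray t \<and> vdepth s \<le> vdepth t))"
    proof
      assume "\<exists>i\<le>b. s = vtx j i"
      then obtain i where i: "i \<le> b" "s = vtx j i" by blast
      then have "s \<in> pverts (std_graph k n)" using t vtx_in[of j k i n] by simp
      moreover have "s = vroot \<or> (s \<noteq> vroot \<and> t \<noteq> vroot \<and> vray s = vray t \<and> vdepth s \<le> vdepth t)"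
        using i t by (cases "i = 0") (auto simp: vray_vtx vtx_eq)
      ultimately show "s \<in> pverts (std_graph k n) \<and>
        (s = vroot \<or> (s \<noteq> vroot \<and> t \<noteq> vroot \<and> vray s = vray t \<and> vdepth s \<le> vdepth t))" by blast
    next
      assume a: "s \<in> pverts (std_graph k n) \<and>
        (s = vroot \<or> (s \<noteq> vroot \<and> t \<noteq> vroot \<and> vray s = vray t \<and> vdepth s \<le> vdepth t))"
      show "\<exists>i\<le>b. s = vtx j i"
      proof (cases "s = vroot")
        case True then show ?thesis by (intro exI[of _ 0]) simp
      next
        case False
        obtain i c where s: "i < k" "c \<le> n" "s = vtx i c" using a unfolding std_graph_verts by blast
        have "c \<noteq> 0" "b \<noteq> 0" using False a s t by (auto simp: vtx_eq)
        then have "i = j" "c \<le> b" using a False s t by (simp_all add: vray_vtx)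
        then show ?thesis using s by blast
      qed
    qed
    then show ?thesis using std_graph_tree_le[OF k t(1,2), of s] True t(3) by simp
  qed
qed

lemma ordered_fan_std_fan:
  assumes k: "0 < k" and n: "0 < n"
  shows "ordered_fan (std_fan k n)"
proof -
  interpret fan_coords "std_graph k n" "vroot" vray vdepth by (rule std_graph_coords[OF k])
  define A where "A j = {vtx j t | t. t \<le> n}" for j
  have arm: "arm j = A j" if "j < k" for j
  proof
    show "arm j \<subseteq> A j"
    proof
      fix x assume x: "x \<in> arm j"
      show "x \<in> A j"
      proof (cases "x = vroot")
        case True then have "x = vtx j 0" by simp then show ?thesis unfolding A_def by blast
      next
        case False
        then have "x \<in> pverts (std_graph k n)" "vray x = j" using x by (auto simp: arm_def)
        moreover from this obtain i t where "t \<le> n" "x = vtx i t" unfolding std_graph_verts by blast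
        ultimately show ?thesis using False unfolding A_def by (auto simp: vtx_eq vray_vtx)
      qed
    qed
    show "A j \<subseteq> arm j"
    proof
      fix x assume "x \<in> A j"
      then obtain t where "t \<le> n" "x = vtx j t" unfolding A_def by blast
      then show "x \<in> arm j" using \<open>j < k\<close> vtx_in[of j k t n]
        by (cases "t = 0") (auto simp: arm_def vray_vtx)
    qed
  qed
  have rays: "vray ` (pverts (std_graph k n) - {vroot}) = {..<k}"
  proof
    show "vray ` (pverts (std_graph k n) - {vroot}) \<subseteq> {..<k}"
    proof
      fix j assume "j \<in> vray ` (pverts (std_graph k n) - {vroot})"
      then obtain i t where "i < k" "vtx i t \<noteq> vroot" "j = vray (vtx i t)" unfolding std_graph_verts by blast
      then show "j \<in> {..<k}" by (auto simp: vtx_eq vray_vtx)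
    qed
    show "{..<k} \<subseteq> vray ` (pverts (std_graph k n) - {vroot})"
    proof
      fix j assume "j \<in> {..<k}"
      then have "vtx j 1 \<in> pverts (std_graph k n) - {vroot}" "j = vray (vtx j 1)"
        using n vtx_in[of j k 1 n] by (auto simp: vtx_eq vray_vtx)
      then show "j \<in> vray ` (pverts (std_graph k n) - {vroot})" by blast
    qed
  qed
  have "vtx 0 1 \<in> pverts (std_graph k n)" "vtx 0 1 \<noteq> vroot" using k n vtx_in[of 0 k 1 n] by (auto simp: vtx_eq)
  then have "pverts (std_graph k n) \<noteq> {vroot}" by blast
  then have br: "branches (std_graph k n) (vroot) = A ` {..<k}"
    unfolding branches_eq rays using arm by (simp cong: image_cong_simp)
  define bs where "bs = map A [0..<k]"
  \<comment> \<open>Positive height enters here: at height 0 the sets \<open>A j\<close> would all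
    consist of the root, and \<open>bs\<close> would list one set \<open>k\<close> times.\<close>
  have inj: "inj_on A {..<k}"
  proof (rule inj_onI)
    fix i j assume "A i = A j"
    moreover have "vtx i 1 \<in> A i" using n unfolding A_def by auto
    ultimately show "i = j" unfolding A_def by (auto simp: vtx_eq)
  qed
  have bsn: "bs ! i = A i" if "i < k" for i using that by (simp add: bs_def)
  have len: "length bs = k" by (simp add: bs_def)
  have ht: "height (A j) = n" for j
  proof -
    have "A j = vtx j ` {..n}" unfolding A_def by auto
    moreover have "inj_on (vtx j) {..n}" by (auto simp: inj_on_def vtx_eq)
    ultimately have "card (A j) = Suc n" by (simp add: card_image)
    then show ?thesis by (simp add: height_def)
  qed
  have im: "immediate_successor (std_graph k n) (vroot) x y \<longleftrightarrow>
    (\<exists>i t. i < k \<and> t < n \<and> x = vtx i t \<and> y = vtx i (Suc t))" (is "_ \<longleftrightarrow> ?r") for x y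
    unfolding immediate_successor_iff
  proof
    assume a: "x \<in> pverts (std_graph k n) \<and> y \<in> pverts (std_graph k n) \<and> vdepth y = Suc (vdepth x) \<and>
      (x = vroot \<or> vray x = vray y)"
    obtain i s where x: "i < k" "s \<le> n" "x = vtx i s" using a unfolding std_graph_verts by blast
    obtain j t where y: "j < k" "t \<le> n" "y = vtx j t" using a unfolding std_graph_verts by blast
    have t: "t = Suc s" using a x y by simp
    have "x = vtx j s"
      using a x y t by (cases "s = 0") (auto simp: vray_vtx vtx_eq)
    then show ?r using y t by (intro exI[of _ j] exI[of _ s]) simp
  next
    assume ?r
    then obtain i t where "i < k" "t < n" "x = vtx i t" "y = vtx i (Suc t)" by blast
    then show "x \<in> pverts (std_graph k n) \<and> y \<in> pverts (std_graph k n) \<and> vdepth y = Suc (vdepth x) \<and>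
      (x = vroot \<or> vray x = vray y)"
      using vtx_in[of i k t n] vtx_in[of i k "Suc t" n] by (cases "t = 0") (auto simp: vray_vtx)
  qed
  show ?thesis
    unfolding ordered_fan_def
  proof (intro exI conjI)
    show "fan (std_graph k n) (vroot)" by (rule fan_std_graph[OF k])
    show "\<forall>b\<in>branches (std_graph k n) (vroot). \<forall>c\<in>branches (std_graph k n) (vroot). height b = height c"
      unfolding br using ht by simp
    show "distinct bs" unfolding bs_def distinct_map using inj by (simp add: atLeast0LessThan)
    show "set bs = branches (std_graph k n) (vroot)" unfolding br bs_def by (simp add: atLeast0LessThan)
    show "points (std_fan k n) = discrete_topology (pverts (std_graph k n))" by (simp add: std_fan_def std_graph_verts)
    show "rel_R (std_fan k n) = {(s, t). s \<in> pverts (std_graph k n) \<and> t \<in> pverts (std_graph k n) \<and>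
      (s = t \<or> immediate_successor (std_graph k n) (vroot) s t)}"
    proof (intro equalityI subrelI)
      fix x y assume "(x, y) \<in> rel_R (std_fan k n)"
      then obtain i s t where st: "i < k" "s \<le> n" "t \<le> n" "t = s \<or> t = Suc s" "x = vtx i s" "y = vtx i t"
        by (auto simp: std_fan_def)
      then have "x \<in> pverts (std_graph k n)" "y \<in> pverts (std_graph k n)" using vtx_in by blast+
      moreover have "x = y \<or> immediate_successor (std_graph k n) (vroot) x y"
      proof (cases "t = s")
        case False
        then have "i < k \<and> s < n \<and> x = vtx i s \<and> y = vtx i (Suc s)" using st by auto
        then show ?thesis unfolding im by blast
      qed (use st in simp)
      ultimately show "(x, y) \<in> {(s, t). s \<in> pverts (std_graph k n) \<and> t \<in> pverts (std_graph k n) \<and>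
        (s = t \<or> immediate_successor (std_graph k n) (vroot) s t)}" by blast
    next
      fix x y assume "(x, y) \<in> {(s, t). s \<in> pverts (std_graph k n) \<and> t \<in> pverts (std_graph k n) \<and>
        (s = t \<or> immediate_successor (std_graph k n) (vroot) s t)}"
      then have a: "x \<in> pverts (std_graph k n)" "x = y \<or> (\<exists>i t. i < k \<and> t < n \<and> x = vtx i t \<and> y = vtx i (Suc t))"
        unfolding im by auto
      have "\<exists>i s t. i < k \<and> s \<le> n \<and> t \<le> n \<and> (t = s \<or> t = Suc s) \<and> x = vtx i s \<and> y = vtx i t"
        using a(2)
      proof
        assume "x = y"
        moreover obtain i s where "i < k" "s \<le> n" "x = vtx i s" using a(1) by (rule std_graph_vertsE)
        ultimately show ?thesis by (intro exI[of _ i] exI[of _ s]) simp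
      next
        assume "\<exists>i t. i < k \<and> t < n \<and> x = vtx i t \<and> y = vtx i (Suc t)"
        then obtain i t where "i < k" "t < n" "x = vtx i t" "y = vtx i (Suc t)" by blast
        then show ?thesis by (intro exI[of _ i] exI[of _ t] exI[of _ "Suc t"]) simp
      qed
      then obtain i s t where "i < k" "s \<le> n" "t \<le> n" "t = s \<or> t = Suc s" "x = vtx i s" "y = vtx i t"
        by blast
      then show "(x, y) \<in> rel_R (std_fan k n)" unfolding std_fan_def by auto
    qed
    show "rel_S (std_fan k n) = {(x, y). \<exists>i j. i \<le> j \<and> j < length bs \<and> x \<in> bs ! i \<and> y \<in> bs ! j}"
    proof (intro equalityI subrelI)
      fix x y assume "(x, y) \<in> rel_S (std_fan k n)"
      then obtain i j s t where "i \<le> j" "j < k" "s \<le> n" "t \<le> n" "x = vtx i s" "y = vtx j t"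
        by (auto simp: std_fan_def)
      then have "i \<le> j \<and> j < length bs \<and> x \<in> bs ! i \<and> y \<in> bs ! j" by (auto simp: len bsn A_def)
      then show "(x, y) \<in> {(x, y). \<exists>i j. i \<le> j \<and> j < length bs \<and> x \<in> bs ! i \<and> y \<in> bs ! j}" by blast
    next
      fix x y assume "(x, y) \<in> {(x, y). \<exists>i j. i \<le> j \<and> j < length bs \<and> x \<in> bs ! i \<and> y \<in> bs ! j}"
      then obtain i j where ij: "i \<le> j" "j < k" "x \<in> A i" "y \<in> A j" by (auto simp: len bsn)
      then show "(x, y) \<in> rel_S (std_fan k n)" by (auto simp: std_fan_def A_def)
    qed
  qed
qed

section \<open>Epimorphisms between standard fans\<close>

lemma epimorphism_comp:
  assumes "epimorphism f M N" "epimorphism g N K"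
  shows "epimorphism (g \<circ> f) M K"
proof -
  have f: "continuous_map (points M) (points N) f" "f ` topspace (points M) = topspace (points N)"
      "rel_R N = map_prod f f ` rel_R M" "rel_S N = map_prod f f ` rel_S M"
    and g: "continuous_map (points N) (points K) g" "g ` topspace (points N) = topspace (points K)"
      "rel_R K = map_prod g g ` rel_R N" "rel_S K = map_prod g g ` rel_S N"
    using assms by (simp_all add: epimorphism_def)
  have "map_prod (g \<circ> f) (g \<circ> f) ` X = map_prod g g ` map_prod f f ` X" for X
    by (simp add: image_comp map_prod_compose)
  moreover have "(g \<circ> f) ` topspace (points M) = topspace (points K)"
    unfolding image_comp[symmetric] f(2) g(2) by (rule refl)
  ultimately show ?thesis
    unfolding epimorphism_def g(3,4) f(3,4) using continuous_map_compose[OF f(1) g(1)] by blast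
qed

lemma topspace_std_fan: "topspace (points (std_fan k n)) = {vtx i t | i t. i < k \<and> t \<le> n}"
  by (simp add: std_fan_def)

lemma std_fan_in: "i < k \<Longrightarrow> t \<le> n \<Longrightarrow> vtx i t \<in> topspace (points (std_fan k n))"
  unfolding topspace_std_fan by blast

lemma std_fan_E:
  assumes "x \<in> topspace (points (std_fan k n))"
  obtains i t where "i < k" "t \<le> n" "x = vtx i t"
  using assms unfolding topspace_std_fan by blast

lemma std_fan_R_I: "i < k \<Longrightarrow> s \<le> n \<Longrightarrow> t \<le> n \<Longrightarrow> t = s \<or> t = Suc s \<Longrightarrow> (vtx i s, vtx i t) \<in> rel_R (std_fan k n)"
  unfolding std_fan_def by auto

lemma std_fan_R_E:
  assumes "(x, y) \<in> rel_R (std_fan k n)"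
  obtains i s t where "i < k" "s \<le> n" "t \<le> n" "t = s \<or> t = Suc s" "x = vtx i s" "y = vtx i t"
  using assms unfolding std_fan_def by auto

lemma std_fan_S_I: "i \<le> j \<Longrightarrow> j < k \<Longrightarrow> s \<le> n \<Longrightarrow> t \<le> n \<Longrightarrow> (vtx i s, vtx j t) \<in> rel_S (std_fan k n)"
  unfolding std_fan_def by auto

lemma std_fan_S_E:
  assumes "(x, y) \<in> rel_S (std_fan k n)"
  obtains i j s t where "i \<le> j" "j < k" "s \<le> n" "t \<le> n" "x = vtx i s" "y = vtx j t"
  using assms unfolding std_fan_def by auto

lemma epimorphism_std_fan_I:
  assumes "f ` topspace (points (std_fan k n)) = topspace (points B)"
    "rel_R B = map_prod f f ` rel_R (std_fan k n)" "rel_S B = map_prod f f ` rel_S (std_fan k n)"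
  shows "epimorphism f (std_fan k n) B"
proof -
  have "f \<in> {vtx i t | i t. i < k \<and> t \<le> n} \<rightarrow> topspace (points B)"
    using assms(1) unfolding topspace_std_fan by blast
  then have "continuous_map (points (std_fan k n)) (points B) f"
    by (simp add: std_fan_def continuous_map_from_discrete_topology)
  then show ?thesis using assms by (simp add: epimorphism_def)
qed

text \<open>A labelled word codes a map of fans: its \<open>i\<close>-th letter \<open>(F, j)\<close> sends the \<open>i\<close>-th branch into the
  \<open>j\<close>-th one by \<open>F\<close>, and the branches beyond its length collapse to the root.\<close>

definition word_map :: "lword \<Rightarrow> nat \<Rightarrow> nat" where
  "word_map x y = (if vray y < length x then vtx (snd (x ! vray y)) (fst (x ! vray y) (vdepth y)) else vroot)"

text \<open>At \<open>t = 0\<close> the index \<open>i\<close> cannot be recovered from the vertex,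
  and \<open>word_map\<close> reads letter 0 instead; the formula survives because all letters
  vanish at 0.\<close>

lemma word_map_vtx:
  assumes "\<And>F j. (F, j) \<in> set x \<Longrightarrow> F \<in> steps"
  shows "word_map x (vtx i t) = (if i < length x then vtx (snd (x ! i)) (fst (x ! i) t) else vroot)"
proof (cases "t = 0")
  case False then show ?thesis by (simp add: word_map_def vray_vtx)
next
  case True
  have "fst (x ! l) 0 = 0" if "l < length x" for l
    using assms[of "fst (x ! l)" "snd (x ! l)"] that by (simp add: steps_0)
  then show ?thesis using True by (simp add: word_map_def)
qed

lemma steps_hit:
  assumes F: "F \<in> steps" and s: "s \<le> F m"
  shows "\<exists>t\<le>m. F t = s"
  using s
proof (induction m)
  case 0 then show ?case using F by (simp add: steps_0)
next
  case (Suc m)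
  show ?case
  proof (cases "s \<le> F m")
    case True then show ?thesis using Suc.IH le_SucI by blast
  next
    case False
    then have "F (Suc m) = s" using Suc.prems steps_Suc[OF F, of m] by auto
    then show ?thesis by blast
  qed
qed

text \<open>Lifts an edge of the target branch to an edge of the source; lifting its two ends
  separately would not exhibit \<open>R\<close> as an image.\<close>

lemma steps_hit_Suc:
  assumes F: "F \<in> steps" and s: "Suc s \<le> F m"
  shows "\<exists>t<m. F t = s \<and> F (Suc t) = Suc s"
  using s
proof (induction m)
  case 0 then show ?case using F by (simp add: steps_0)
next
  case (Suc m)
  show ?case
  proof (cases "Suc s \<le> F m")
    case True then show ?thesis using Suc.IH less_SucI by blast
  next
    case False
    then have "F m = s" "F (Suc m) = Suc s" using Suc.prems steps_Suc[OF F, of m] by auto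
    then show ?thesis by blast
  qed
qed

text \<open>Full letters supply preimages of vertices, edges and \<open>S\<close>-related pairs.
  Step functions preserve \<open>R\<close>, sorted labels preserve \<open>S\<close>, and the
  branches without a letter, which come last, collapse to the root, a point of every branch.\<close>

lemma word_map_epimorphism:
  assumes len: "length x \<le> N" and k: "0 < k"
    and st: "\<And>F j. (F, j) \<in> set x \<Longrightarrow> F \<in> steps \<and> (\<forall>t. F t \<le> n) \<and> j < k"
    and sorted: "sorted (map snd x)"
    and full: "\<And>j. j < k \<Longrightarrow> \<exists>F. (F, j) \<in> set x \<and> F M = n"
  shows "epimorphism (word_map x) (std_fan N M) (std_fan k n)"
proof -
  have ev: "word_map x (vtx i t) = (if i < length x then vtx (snd (x ! i)) (fst (x ! i) t) else vroot)" for i t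
    by (rule word_map_vtx) (use st in blast)
  have nth: "fst (x ! i) \<in> steps" "fst (x ! i) t \<le> n" "snd (x ! i) < k" if "i < length x" for i t
    using st[of "fst (x ! i)" "snd (x ! i)"] that by simp_all
  have full': "\<exists>i<length x. snd (x ! i) = j \<and> fst (x ! i) M = n" if "j < k" for j
    using full[OF that] by (metis fst_conv in_set_conv_nth snd_conv)
  have root: "(vroot, vroot) \<in> rel_R (std_fan k n)" "(vroot, vroot) \<in> rel_S (std_fan k n)" "vroot \<in> topspace (points (std_fan k n))"
    using std_fan_R_I[OF k, of 0 n 0] std_fan_S_I[OF order_refl k, of 0 n 0] std_fan_in[OF k, of 0 n] by simp_all
  show ?thesis
  proof (rule epimorphism_std_fan_I)
    show "word_map x ` topspace (points (std_fan N M)) = topspace (points (std_fan k n))"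
    proof
      show "word_map x ` topspace (points (std_fan N M)) \<subseteq> topspace (points (std_fan k n))"
      proof
        fix y assume "y \<in> word_map x ` topspace (points (std_fan N M))"
        then obtain i t where "y = word_map x (vtx i t)" unfolding topspace_std_fan by blast
        then show "y \<in> topspace (points (std_fan k n))"
          using ev[of i t] root(3) nth[of i] std_fan_in by (cases "i < length x") auto
      qed
      show "topspace (points (std_fan k n)) \<subseteq> word_map x ` topspace (points (std_fan N M))"
      proof
        fix y assume "y \<in> topspace (points (std_fan k n))"
        then obtain j s where y: "j < k" "s \<le> n" "y = vtx j s" by (rule std_fan_E)
        obtain i where i: "i < length x" "snd (x ! i) = j" "fst (x ! i) M = n" using full'[OF y(1)] by blast
        obtain t where t: "t \<le> M" "fst (x ! i) t = s" using steps_hit[OF nth(1)[OF i(1)], of s M] i y by auto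
        have "y = word_map x (vtx i t)" using ev[of i t] i t y by simp
        moreover have "vtx i t \<in> topspace (points (std_fan N M))" using std_fan_in i(1) len t(1) by simp
        ultimately show "y \<in> word_map x ` topspace (points (std_fan N M))" by blast
      qed
    qed
    show "rel_R (std_fan k n) = map_prod (word_map x) (word_map x) ` rel_R (std_fan N M)"
    proof (intro equalityI subrelI)
      fix a b assume "(a, b) \<in> rel_R (std_fan k n)"
      then obtain j s t where a: "j < k" "s \<le> n" "t \<le> n" "t = s \<or> t = Suc s" "a = vtx j s" "b = vtx j t"
        by (rule std_fan_R_E)
      obtain i where i: "i < length x" "snd (x ! i) = j" "fst (x ! i) M = n" using full'[OF a(1)] by blast
      have "\<exists>u v. u \<le> M \<and> v \<le> M \<and> (v = u \<or> v = Suc u) \<and> fst (x ! i) u = s \<and> fst (x ! i) v = t"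
      proof (cases "t = s")
        case True
        then show ?thesis using steps_hit[OF nth(1)[OF i(1)], of s M] a(2) i(3) by auto
      next
        case False
        then have t: "t = Suc s" using a(4) by simp
        then obtain u where "u < M" "fst (x ! i) u = s" "fst (x ! i) (Suc u) = Suc s"
          using steps_hit_Suc[OF nth(1)[OF i(1)], of s M] a(3) i(3) by auto
        then show ?thesis using t by (intro exI[of _ u] exI[of _ "Suc u"]) simp
      qed
      then obtain u v where uv: "u \<le> M" "v \<le> M" "v = u \<or> v = Suc u" "fst (x ! i) u = s" "fst (x ! i) v = t"
        by blast
      have "(vtx i u, vtx i v) \<in> rel_R (std_fan N M)" using std_fan_R_I uv i(1) len by simp
      moreover have "(a, b) = map_prod (word_map x) (word_map x) (vtx i u, vtx i v)"
        using ev[of i u] ev[of i v] i uv a by simp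
      ultimately show "(a, b) \<in> map_prod (word_map x) (word_map x) ` rel_R (std_fan N M)" by (rule rev_image_eqI)
    next
      fix a b assume "(a, b) \<in> map_prod (word_map x) (word_map x) ` rel_R (std_fan N M)"
      then obtain a' b' where ab: "(a', b') \<in> rel_R (std_fan N M)" "a = word_map x a'" "b = word_map x b'" by auto
      from ab(1) obtain i s t where i: "t = s \<or> t = Suc s" "a' = vtx i s" "b' = vtx i t" by (rule std_fan_R_E)
      show "(a, b) \<in> rel_R (std_fan k n)"
      proof (cases "i < length x")
        case True
        have "fst (x ! i) t = fst (x ! i) s \<or> fst (x ! i) t = Suc (fst (x ! i) s)"
          using i(1) steps_Suc[OF nth(1)[OF True], of s] by auto
        then show ?thesis using ev[of i s] ev[of i t] ab i True nth[OF True] std_fan_R_I by simp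
      next
        case False then show ?thesis using ev[of i s] ev[of i t] ab i root by simp
      qed
    qed
    show "rel_S (std_fan k n) = map_prod (word_map x) (word_map x) ` rel_S (std_fan N M)"
    proof (intro equalityI subrelI)
      fix a b assume "(a, b) \<in> rel_S (std_fan k n)"
      then obtain j1 j2 s1 s2 where a: "j1 \<le> j2" "j2 < k" "s1 \<le> n" "s2 \<le> n" "a = vtx j1 s1" "b = vtx j2 s2"
        by (rule std_fan_S_E)
      have "\<exists>i1 i2. i1 \<le> i2 \<and> i2 < length x \<and> snd (x ! i1) = j1 \<and> snd (x ! i2) = j2 \<and>
        fst (x ! i1) M = n \<and> fst (x ! i2) M = n"
      proof (cases "j1 = j2")
        case True then show ?thesis using full'[OF a(2)] by auto
      next
        case False
        obtain i2 where i2: "i2 < length x" "snd (x ! i2) = j2" "fst (x ! i2) M = n" using full'[OF a(2)] by blast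
        have "j1 < k" using a by simp
        then obtain i1 where i1: "i1 < length x" "snd (x ! i1) = j1" "fst (x ! i1) M = n" using full' by blast
        have "i1 \<le> i2"
        proof (rule ccontr)
          assume "\<not> i1 \<le> i2"
          then have "snd (x ! i2) \<le> snd (x ! i1)"
            using sorted_nth_mono[OF sorted, of i2 i1] i1(1) by simp
          then show False using i1 i2 a(1) False by simp
        qed
        then show ?thesis using i1 i2 by blast
      qed
      then obtain i1 i2 where i: "i1 \<le> i2" "i2 < length x" "snd (x ! i1) = j1" "snd (x ! i2) = j2"
        "fst (x ! i1) M = n" "fst (x ! i2) M = n" by blast
      then have i1: "i1 < length x" by simp
      obtain t1 where t1: "t1 \<le> M" "fst (x ! i1) t1 = s1" using steps_hit[OF nth(1)[OF i1], of s1 M] i a by auto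
      obtain t2 where t2: "t2 \<le> M" "fst (x ! i2) t2 = s2" using steps_hit[OF nth(1)[OF i(2)], of s2 M] i a by auto
      have "(vtx i1 t1, vtx i2 t2) \<in> rel_S (std_fan N M)" using std_fan_S_I i t1 t2 len by simp
      moreover have "(a, b) = map_prod (word_map x) (word_map x) (vtx i1 t1, vtx i2 t2)"
        using ev[of i1 t1] ev[of i2 t2] i i1 t1 t2 a by simp
      ultimately show "(a, b) \<in> map_prod (word_map x) (word_map x) ` rel_S (std_fan N M)" by (rule rev_image_eqI)
    next
      fix a b assume "(a, b) \<in> map_prod (word_map x) (word_map x) ` rel_S (std_fan N M)"
      then obtain a' b' where ab: "(a', b') \<in> rel_S (std_fan N M)" "a = word_map x a'" "b = word_map x b'" by auto
      from ab(1) obtain i1 i2 s t where i: "i1 \<le> i2" "a' = vtx i1 s" "b' = vtx i2 t" by (rule std_fan_S_E)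
      consider "i2 < length x" | "i1 < length x" "\<not> i2 < length x" | "\<not> i1 < length x" using i by linarith
      then show "(a, b) \<in> rel_S (std_fan k n)"
      proof cases
        case 1
        then have i1: "i1 < length x" using i by simp
        have "snd (x ! i1) \<le> snd (x ! i2)" using sorted_nth_mono[OF sorted i(1)] 1 i1 by simp
        then show ?thesis using ev[of i1 s] ev[of i2 t] ab i 1 i1 nth[OF 1] nth[OF i1] std_fan_S_I by simp
      next
        case 2
        \<comment> \<open>The second image is the root, written here as a vertex on the branch of
          the first image.\<close>
        have "(vtx (snd (x ! i1)) (fst (x ! i1) s), vtx (snd (x ! i1)) 0) \<in> rel_S (std_fan k n)"
          using nth[OF 2(1)] by (intro std_fan_S_I) auto
        then show ?thesis using ev[of i1 s] ev[of i2 t] ab i 2 by simp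
      next
        case 3 then show ?thesis using ev[of i1 s] ev[of i2 t] ab i root by simp
      qed
    qed
  qed
qed

lemma epimorphism_R: "epimorphism f M N \<Longrightarrow> (x, y) \<in> rel_R M \<Longrightarrow> (f x, f y) \<in> rel_R N"
  and epimorphism_S: "epimorphism f M N \<Longrightarrow> (x, y) \<in> rel_S M \<Longrightarrow> (f x, f y) \<in> rel_S N"
  unfolding epimorphism_def by auto

lemma epimorphism_in: "epimorphism f M N \<Longrightarrow> x \<in> topspace (points M) \<Longrightarrow> f x \<in> topspace (points N)"
  unfolding epimorphism_def by blast

text \<open>Along the \<open>i\<close>-th branch, the depth of the image is the step function and
  the branch it runs into is the label. Labels of branches that collapse to the root are
  undetermined and have to be chosen so that the word becomes sorted.\<close>

lemma epimorphism_word_map: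
  assumes g: "epimorphism g (std_fan K m) (std_fan k n)" and pos: "0 < K" "0 < k" "0 < n"
  shows "\<exists>\<delta>\<in>frag m n k K. (\<forall>j<k. full m n \<delta> j) \<and>
    (\<forall>y\<in>topspace (points (std_fan K m)). g y = word_map \<delta> y)"
proof -
  have gin: "g (vtx i t) \<in> topspace (points (std_fan k n))" if "i < K" "t \<le> m" for i t
    by (rule epimorphism_in[OF g std_fan_in[OF that]])
  have stp: "\<exists>j a b. j < k \<and> (b = a \<or> b = Suc a) \<and> g (vtx i t) = vtx j a \<and> g (vtx i (Suc t)) = vtx j b"
    if "i < K" "Suc t \<le> m" for i t
  proof -
    have "(vtx i t, vtx i (Suc t)) \<in> rel_R (std_fan K m)" using that by (intro std_fan_R_I) auto
    from epimorphism_R[OF g this] show ?thesis by (rule std_fan_R_E) blast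
  qed
  \<comment> \<open>Stopping the time at \<open>m\<close> makes the function constant from
    \<open>m\<close> on, as \<open>bounded_steps m\<close> demands.\<close>
  define D where "D i t = vdepth (g (vtx i (min t m)))" for i t
  have Dstep: "D i (Suc t) = D i t \<or> D i (Suc t) = Suc (D i t)" if "i < K" for i t
  proof (cases "Suc t \<le> m")
    case True
    then show ?thesis using stp[OF that True] unfolding D_def by (auto simp: min_absorb1)
  next
    case False then show ?thesis unfolding D_def by (simp add: min_absorb2)
  qed
  have Dmono: "D i s \<le> D i t" if "i < K" "s \<le> t" for i s t
    by (rule lift_Suc_mono_le[OF _ that(2)]) (use Dstep[OF that(1)] in \<open>metis le_Suc_eq order_refl\<close>)
  have Dn: "D i t \<le> n" if "i < K" for i t
    using gin[OF that, of "min t m"] unfolding D_def by (auto elim!: std_fan_E)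
  \<comment> \<open>Some vertex is sent to the root; the depth of the image never decreases along a
    branch, so it is 0 at the start of that branch, which is the root.\<close>
  have groot: "vdepth (g vroot) = 0"
  proof -
    have "vroot \<in> g ` topspace (points (std_fan K m))"
      using g std_fan_in[OF pos(2), of 0 n] unfolding epimorphism_def by simp
    then obtain i t where it: "i < K" "t \<le> m" "g (vtx i t) = vroot" unfolding topspace_std_fan by auto
    then have "D i t = 0" unfolding D_def by (simp add: min_absorb1)
    then have "D i 0 = 0" using Dmono[OF it(1), of 0 t] by simp
    then show ?thesis unfolding D_def by simp
  qed
  have D0: "D i 0 = 0" for i using groot unfolding D_def by simp
  have Dbs: "D i \<in> bounded_steps m" if "i < K" for i
  proof -
    have "D i t = D i m" if "m \<le> t" for t unfolding D_def using that by (simp add: min_absorb2)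
    then show ?thesis using D0 Dstep[OF that] unfolding bounded_steps_def steps_def by blast
  qed
  have "\<exists>j<k. g (vtx i m) = vtx j (D i m)" if "i < K" for i
    using gin[OF that, of m] unfolding D_def by (auto elim!: std_fan_E)
  then obtain J where J: "\<And>i. i < K \<Longrightarrow> J i < k" "\<And>i. i < K \<Longrightarrow> g (vtx i m) = vtx (J i) (D i m)" by metis
  \<comment> \<open>Downwards from the end of the branch: an image other than the root determines
    its branch, and below an image equal to the root all images are the root.\<close>
  have gJ: "g (vtx i t) = vtx (J i) (D i t)" if i: "i < K" and t: "t \<le> m" for i t
    using t
  proof (induction rule: inc_induct)
    case base then show ?case using J(2)[OF i] .
  next
    case (step t)
    obtain j a b where ab: "b = a \<or> b = Suc a" "g (vtx i t) = vtx j a" "g (vtx i (Suc t)) = vtx j b"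
      using stp[OF i, of t] step.hyps by auto
    have Da: "D i t = a" using ab(2) step.hyps unfolding D_def by (simp add: min_absorb1)
    have "vtx j b = vtx (J i) (D i (Suc t))" using step.IH ab(3) by simp
    then have "b = 0 \<or> j = J i" by (auto simp: vtx_eq)
    then have "a = 0 \<or> j = J i" using ab(1) by auto
    then show ?case using ab(2) Da by (auto simp: vtx_eq)
  qed
  have Jmono: "J i \<le> J i'" if "i \<le> i'" "i' < K" "0 < D i m" "0 < D i' m" for i i'
  proof -
    have "(vtx i m, vtx i' m) \<in> rel_S (std_fan K m)" using that by (intro std_fan_S_I) auto
    from epimorphism_S[OF g this] obtain a b s t where ab: "a \<le> b" "g (vtx i m) = vtx a s" "g (vtx i' m) = vtx b t"
      by (rule std_fan_S_E)
    have "i < K" using that by simp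
    then have "J i = a" "J i' = b" using ab J(2)[of i] J(2)[of i'] that by (auto simp: vtx_eq)
    then show ?thesis using ab by simp
  qed
  \<comment> \<open>The largest label of a non-collapsing branch up to \<open>i\<close> is monotone
    in \<open>i\<close> and agrees with \<open>J\<close> wherever the label is visible; 0 is there
    in case no such branch exists.\<close>
  define I where "I i = insert 0 (J ` {i'. i' \<le> i \<and> 0 < D i' m})" for i
  define l where "l i = Max (I i)" for i
  have finI: "finite (I i)" for i unfolding I_def by simp
  have lJ: "l i = J i" if "i < K" "0 < D i m" for i
    unfolding l_def
  proof (rule Max_eqI[OF finI])
    fix y assume "y \<in> I i"
    then show "y \<le> J i" unfolding I_def using Jmono[of _ i] that by auto
  next
    show "J i \<in> I i" unfolding I_def using that by blast
  qed
  have lk: "l i < k" if "i < K" for i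
  proof -
    have "l i \<in> I i" unfolding l_def by (rule Max_in[OF finI]) (simp add: I_def)
    then show ?thesis unfolding I_def using J(1) that pos by auto
  qed
  have lmono: "l i \<le> l i'" if "i \<le> i'" for i i'
    unfolding l_def by (rule Max_mono[OF _ _ finI]) (use that in \<open>auto simp: I_def\<close>)
  define \<delta> where "\<delta> = map (\<lambda>i. (D i, l i)) [0..<K]"
  have len: "length \<delta> = K" by (simp add: \<delta>_def)
  have nth: "\<delta> ! i = (D i, l i)" if "i < K" for i using that by (simp add: \<delta>_def)
  have set: "set \<delta> = (\<lambda>i. (D i, l i)) ` {..<K}" by (auto simp: \<delta>_def)
  have "sorted (map snd \<delta>)"
    unfolding sorted_iff_nth_mono by (auto simp: len nth intro: lmono)
  moreover have "set \<delta> \<subseteq> {d \<in> bounded_steps m. d m \<le> n} \<times> {..<k}"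
    unfolding set using Dbs Dn lk by auto
  ultimately have "\<delta> \<in> frag m n k K" unfolding frag_def using len by blast
  moreover have "full m n \<delta> j" if j: "j < k" for j
  proof -
    have "vtx j n \<in> g ` topspace (points (std_fan K m))"
      using g std_fan_in[OF j, of n n] unfolding epimorphism_def by simp
    then obtain i t where it: "i < K" "t \<le> m" "vtx j n = g (vtx i t)" unfolding topspace_std_fan by auto
    then have "vtx j n = vtx (J i) (D i t)" using gJ by simp
    then have "D i t = n" "J i = j" using pos(3) by (auto simp: vtx_eq)
    moreover have "D i m = n" using Dmono[OF it(1,2)] Dn[OF it(1), of m] \<open>D i t = n\<close> by simp
    ultimately show ?thesis using lJ[OF it(1)] pos(3) it(1) unfolding full_def set by (intro exI[of _ "D i"]) auto
  qed
  moreover have "g y = word_map \<delta> y" if yin: "y \<in> topspace (points (std_fan K m))" for y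
  proof -
    obtain i t where y: "i < K" "t \<le> m" "y = vtx i t" using yin by (rule std_fan_E)
    have "F \<in> steps" if "(F, j) \<in> set \<delta>" for F j
      using that Dbs bounded_steps_steps unfolding set by blast
    from word_map_vtx[of \<delta> i t, OF this] have "word_map \<delta> y = vtx (l i) (D i t)" using y len nth by simp
    moreover have "vtx (l i) (D i t) = vtx (J i) (D i t)"
    proof (cases "D i t = 0")
      case False
      then have "0 < D i m" using Dmono[OF y(1,2)] by simp
      then show ?thesis using lJ[OF y(1)] by simp
    qed simp
    ultimately show ?thesis using gJ[OF y(1,2)] y(3) by simp
  qed
  ultimately show ?thesis by blast
qed

section \<open>Blocks as maps onto an intermediate fan, and substitution as composition\<close>

definition blocks :: "wrd list \<Rightarrow> lword" where
  "blocks ps = concat (map2 lab [0..<length ps] ps)"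

lemma blocks_snoc: "blocks (ps @ [p]) = blocks ps @ lab (length ps) p"
  by (simp add: blocks_def)

lemma blocks_set: "(F, j) \<in> set (blocks ps) \<longleftrightarrow> j < length ps \<and> F \<in> set (ps ! j)"
proof (induction ps rule: rev_induct)
  case Nil then show ?case by (simp add: blocks_def)
next
  case (snoc p ps)
  have "(F, j) \<in> set (lab (length ps) p) \<longleftrightarrow> j = length ps \<and> F \<in> set p" by (auto simp: lab_def)
  then show ?case using snoc by (auto simp: blocks_snoc nth_append less_Suc_eq)
qed

lemma blocks_length: "length (blocks ps) = length (concat ps)"
  by (induction ps rule: rev_induct) (simp_all add: blocks_snoc lab_def, simp add: blocks_def)

lemma blocks_sorted: "sorted (map snd (blocks ps))"
proof (induction ps rule: rev_induct)
  case Nil then show ?case by (simp add: blocks_def)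
next
  case (snoc p ps)
  have "j \<le> length ps" if "(F, j) \<in> set (blocks ps)" for F j using that blocks_set by auto
  moreover have "map snd (lab (length ps) p) = replicate (length p) (length ps)"
    by (simp add: lab_def o_def map_replicate_const)
  ultimately show ?case using snoc by (auto simp: blocks_snoc sorted_append)
qed

lemma substitute_blocks:
  "length \<delta> = length ps \<Longrightarrow> substitute \<delta> ps = map (\<lambda>(F, s). (fst (\<delta> ! s) \<circ> F, snd (\<delta> ! s))) (blocks ps)"
proof (induction ps arbitrary: \<delta> rule: rev_induct)
  case Nil then show ?case by (simp add: blocks_def substitute_def)
next
  case (snoc p ps)
  then obtain \<delta>' e where \<delta>: "\<delta> = \<delta>' @ [e]" "length \<delta>' = length ps"
    by (cases \<delta> rule: rev_cases) auto
  have "map (\<lambda>(F, s). (fst (\<delta>' ! s) \<circ> F, snd (\<delta>' ! s))) (blocks ps) =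
      map (\<lambda>(F, s). (fst (\<delta> ! s) \<circ> F, snd (\<delta> ! s))) (blocks ps)"
    using \<delta> blocks_set by (intro map_cong refl) (auto simp: nth_append)
  moreover have "lab (snd e) (act (fst e) p) =
      map (\<lambda>(F, s). (fst (\<delta> ! s) \<circ> F, snd (\<delta> ! s))) (lab (length ps) p)"
    using \<delta> by (simp add: lab_def act_def nth_append)
  moreover have "substitute \<delta> (ps @ [p]) = substitute \<delta>' ps @ lab (snd e) (act (fst e) p)"
    unfolding \<delta>(1) by (rule substitute_snoc[OF \<delta>(2)])
  ultimately show ?case
    unfolding blocks_snoc map_append using snoc.IH[OF \<delta>(2)] by (simp only:)
qed

text \<open>A letter \<open>F\<close> of the \<open>s\<close>-th block becomes
  \<open>fst (\<delta> ! s) \<circ> F\<close> with the label of \<open>\<delta> ! s\<close>, which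
  is evaluation in two stages. Branches beyond the blocks go to the root, and
  \<open>\<delta>\<close> fixes the root.\<close>

lemma word_map_substitute:
  assumes len: "length \<delta> = length ps"
    and \<delta>: "\<And>F j. (F, j) \<in> set \<delta> \<Longrightarrow> F \<in> steps"
    and ps: "\<And>p F. p \<in> set ps \<Longrightarrow> F \<in> set p \<Longrightarrow> F \<in> steps"
  shows "word_map (substitute \<delta> ps) (vtx i t) = word_map \<delta> (word_map (blocks ps) (vtx i t))"
proof -
  have b: "F \<in> steps" if "(F, j) \<in> set (blocks ps)" for F j
    using that ps[of "ps ! j" F] by (auto simp: blocks_set)
  have d: "fst (\<delta> ! s) \<in> steps" if "s < length ps" for s
    using \<delta>[of "fst (\<delta> ! s)" "snd (\<delta> ! s)"] that len by simp
  have s: "F \<in> steps" if "(F, j) \<in> set (substitute \<delta> ps)" for F j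
    using that b d blocks_set steps_comp unfolding substitute_blocks[OF len] by fastforce
  have lens: "length (substitute \<delta> ps) = length (blocks ps)" by (simp add: substitute_blocks[OF len])
  show ?thesis
  proof (cases "i < length (blocks ps)")
    case True
    obtain F j where Fj: "blocks ps ! i = (F, j)" by (cases "blocks ps ! i")
    then have j: "j < length \<delta>" using True blocks_set[of F j ps] len by (metis nth_mem)
    have "word_map (substitute \<delta> ps) (vtx i t) = vtx (snd (\<delta> ! j)) (fst (\<delta> ! j) (F t))"
      using word_map_vtx[of "substitute \<delta> ps" i t, OF s] True lens Fj by (simp add: substitute_blocks[OF len])
    moreover have "word_map (blocks ps) (vtx i t) = vtx j (F t)"
      using word_map_vtx[of "blocks ps" i t, OF b] True Fj by simp
    ultimately show ?thesis using word_map_vtx[of \<delta> j "F t", OF \<delta>] j by simp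
  next
    case False
    have "word_map \<delta> (vtx 0 0) = vroot"
      using word_map_vtx[of \<delta> 0 0, OF \<delta>] d[of 0] len by (auto simp: steps_0)
    then show ?thesis
      using False lens word_map_vtx[of "substitute \<delta> ps" i t, OF s] word_map_vtx[of "blocks ps" i t, OF b] by simp
  qed
qed

lemma blocks_epimorphism:
  assumes "0 < length ps" "length (concat ps) \<le> N"
    and "\<forall>p\<in>set ps. has_level m p \<and> (\<exists>F\<in>set p. F N = m)"
  shows "epimorphism (word_map (blocks ps)) (std_fan N N) (std_fan (length ps) m)"
proof (rule word_map_epimorphism)
  show "length (blocks ps) \<le> N" using assms(2) by (simp add: blocks_length)
  show "0 < length ps" by (rule assms(1))
  show "sorted (map snd (blocks ps))" by (rule blocks_sorted)
  show "F \<in> steps \<and> (\<forall>t. F t \<le> m) \<and> j < length ps" if "(F, j) \<in> set (blocks ps)" for F j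
  proof -
    have "ps ! j \<in> set ps" "F \<in> set (ps ! j)" "j < length ps" using that by (auto simp: blocks_set)
    then show ?thesis using assms(3) unfolding has_level_def by blast
  qed
  show "\<exists>F. (F, j) \<in> set (blocks ps) \<and> F N = m" if "j < length ps" for j
    using assms(3) that unfolding blocks_set by (metis nth_mem)
qed

section \<open>Homeomorphism groups\<close>

lemma carrier_homeo_group:
  "f \<in> carrier (homeo_group X) \<longleftrightarrow> f \<in> extensional (topspace X) \<and> homeomorphic_map X X f"
  using homeomorphic_imp_surjective_map[of X X f] homeomorphic_imp_injective_map[of X X f]
  by (auto simp: homeo_group_def Bij_def bij_betw_def)

lemma homeo_group_mult:
  "f \<in> carrier (homeo_group X) \<Longrightarrow> g \<in> carrier (homeo_group X) \<Longrightarrow>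
     f \<otimes>\<^bsub>homeo_group X\<^esub> g = compose (topspace X) f g"
  by (simp add: homeo_group_def BijGroup_def)

lemma subgroup_homeo: "subgroup {f \<in> Bij (topspace X). homeomorphic_map X X f} (BijGroup (topspace X))"
proof (rule group.subgroupI[OF group_BijGroup])
  let ?H = "{f \<in> Bij (topspace X). homeomorphic_map X X f}"
  have id: "(\<lambda>x\<in>topspace X. x) \<in> ?H"
    using id_Bij homeomorphic_map_eq[of X X id "\<lambda>x\<in>topspace X. x"] by (simp add: homeomorphic_map_id)
  show "?H \<subseteq> carrier (BijGroup (topspace X))" by (auto simp: BijGroup_def)
  show "?H \<noteq> {}" using id by blast
  show "inv\<^bsub>BijGroup (topspace X)\<^esub> f \<in> ?H" if f: "f \<in> ?H" for f
  proof -
    have "homeomorphic_map X X f" using f by simp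
    then obtain g where g: "homeomorphic_maps X X f g" unfolding homeomorphic_map_maps by blast
    then have gm: "homeomorphic_map X X g" using homeomorphic_maps_map by blast
    have "inv_into (topspace X) f x = g x" if "x \<in> topspace X" for x
    proof (rule inv_into_f_eq)
      show "inj_on f (topspace X)" using f homeomorphic_imp_injective_map by blast
      show "g x \<in> topspace X" using gm that homeomorphic_imp_surjective_map by blast
      show "f (g x) = x" using g that unfolding homeomorphic_maps_def by blast
    qed
    then have "homeomorphic_map X X (\<lambda>x\<in>topspace X. inv_into (topspace X) f x)"
      using homeomorphic_map_eq[OF gm] by simp
    then show ?thesis using f restrict_inv_into_Bij[of f "topspace X"] by (simp add: inv_BijGroup)
  qed
  show "f \<otimes>\<^bsub>BijGroup (topspace X)\<^esub> g \<in> ?H" if f: "f \<in> ?H" and g: "g \<in> ?H" for f g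
  proof -
    have "homeomorphic_map X X (f \<circ> g)" using f g homeomorphic_map_compose by blast
    then have "homeomorphic_map X X (compose (topspace X) f g)"
      by (rule homeomorphic_map_eq) (simp add: compose_eq)
    then show ?thesis using f g compose_Bij[of f "topspace X" g] by (simp add: BijGroup_def)
  qed
qed

lemma group_homeo_group: "group (homeo_group X)"
  unfolding homeo_group_def using subgroup.subgroup_is_group[OF subgroup_homeo group_BijGroup] .

lemma homeo_group_inv:
  assumes "f \<in> carrier (homeo_group X)" "x \<in> topspace X"
  shows "(inv\<^bsub>homeo_group X\<^esub> f) (f x) = x" "f ((inv\<^bsub>homeo_group X\<^esub> f) x) = x"
    "(inv\<^bsub>homeo_group X\<^esub> f) x \<in> topspace X" "f x \<in> topspace X"
proof -
  interpret group "homeo_group X" by (rule group_homeo_group)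
  have i: "inv\<^bsub>homeo_group X\<^esub> f \<in> carrier (homeo_group X)" using assms(1) by simp
  have in': "h y \<in> topspace X" if "h \<in> carrier (homeo_group X)" "y \<in> topspace X" for h y
    using that homeomorphic_imp_surjective_map[of X X h] unfolding carrier_homeo_group by blast
  show "(inv\<^bsub>homeo_group X\<^esub> f) x \<in> topspace X" "f x \<in> topspace X" using in' i assms by auto
  have "compose (topspace X) (inv\<^bsub>homeo_group X\<^esub> f) f = \<one>\<^bsub>homeo_group X\<^esub>"
    using l_inv[OF assms(1)] homeo_group_mult[OF i assms(1)] by simp
  from fun_cong[OF this, of x] show "(inv\<^bsub>homeo_group X\<^esub> f) (f x) = x"
    using assms(2) by (simp add: compose_eq homeo_group_def BijGroup_def)
  have "compose (topspace X) f (inv\<^bsub>homeo_group X\<^esub> f) = \<one>\<^bsub>homeo_group X\<^esub>"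
    using r_inv[OF assms(1)] homeo_group_mult[OF assms(1) i] by simp
  from fun_cong[OF this, of x] show "f ((inv\<^bsub>homeo_group X\<^esub> f) x) = x"
    using assms(2) by (simp add: compose_eq homeo_group_def BijGroup_def)
qed

section \<open>The compact-open topology on a homeomorphism group\<close>

definition cosub :: "'a topology \<Rightarrow> 'a set \<Rightarrow> 'a set \<Rightarrow> ('a \<Rightarrow> 'a) set" where
  "cosub X K U = {f \<in> carrier (homeo_group X). f ` K \<subseteq> U}"

lemma compact_open_cosub:
  "compact_open X = topology_generated_by {cosub X K U | K U. compactin X K \<and> openin X U}"
  by (simp add: compact_open_def cosub_def)

lemma openin_cosub: "compactin X K \<Longrightarrow> openin X U \<Longrightarrow> openin (compact_open X) (cosub X K U)"
  unfolding compact_open_cosub by (rule topology_generated_by_Basis) blast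

lemma topspace_compact_open: "topspace (compact_open X) = carrier (homeo_group X)"
proof -
  have "cosub X {} {} = carrier (homeo_group X)" by (simp add: cosub_def)
  moreover have "cosub X {} {} \<in> {cosub X K U | K U. compactin X K \<and> openin X U}"
    using compactin_empty openin_empty by blast
  moreover have "A \<subseteq> carrier (homeo_group X)" if "A \<in> {cosub X K U | K U. compactin X K \<and> openin X U}" for A
    using that by (auto simp: cosub_def)
  ultimately show ?thesis unfolding compact_open_cosub topology_generated_by_topspace by blast
qed

lemma continuous_map_into_compact_open:
  assumes "\<And>x. x \<in> topspace Y \<Longrightarrow> h x \<in> carrier (homeo_group X)"
    and "\<And>K U. compactin X K \<Longrightarrow> openin X U \<Longrightarrow> openin Y {x \<in> topspace Y. h x ` K \<subseteq> U}"
  shows "continuous_map Y (compact_open X) h"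
  unfolding compact_open_cosub
proof (rule continuous_on_generated_topo)
  fix A assume "A \<in> {cosub X K U | K U. compactin X K \<and> openin X U}"
  then obtain K U where "compactin X K" "openin X U" "A = cosub X K U" by blast
  moreover from this have "h -` A \<inter> topspace Y = {x \<in> topspace Y. h x ` K \<subseteq> U}"
    using assms(1) by (auto simp: cosub_def)
  ultimately show "openin Y (h -` A \<inter> topspace Y)" using assms(2) by simp
next
  show "h ` topspace Y \<subseteq> \<Union> {cosub X K U | K U. compactin X K \<and> openin X U}"
    using assms(1) topspace_compact_open[of X]
    unfolding compact_open_cosub topology_generated_by_topspace by blast
qed

lemma normal_spaceD:
  "normal_space X \<Longrightarrow> closedin X S \<Longrightarrow> closedin X T \<Longrightarrow> disjnt S T \<Longrightarrow>
    \<exists>U V. openin X U \<and> openin X V \<and> S \<subseteq> U \<and> T \<subseteq> V \<and> disjnt U V"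
  unfolding normal_space_def by simp

text \<open>For products, normality inserts an open \<open>A\<close> and a compact
  \<open>topspace X - B\<close> containing it between the image of \<open>K\<close> under
  \<open>g\<close> and the preimage of \<open>U\<close> under \<open>f\<close>; these two sets
  define the neighbourhood of \<open>(f, g)\<close>. For inverses, mapping \<open>K\<close> into
  \<open>U\<close> by the inverse means mapping the complement of \<open>U\<close> into that of
  \<open>K\<close>, again a subbasic condition.\<close>

theorem topological_group_homeo:
  assumes cpt: "compact_space X" and haus: "Hausdorff_space X"
  shows "topological_group (homeo_group X) (compact_open X)"
proof -
  interpret group "homeo_group X" by (rule group_homeo_group)
  let ?T = "compact_open X"
  have norm: "normal_space X" using compact_Hausdorff_or_regular_imp_normal_space[OF cpt] haus by blast
  have mult: "continuous_map (prod_topology ?T ?T) ?T (\<lambda>(x, y). x \<otimes>\<^bsub>homeo_group X\<^esub> y)"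
  proof (rule continuous_map_into_compact_open)
    fix p assume "p \<in> topspace (prod_topology ?T ?T)"
    then show "(case p of (x, y) \<Rightarrow> x \<otimes>\<^bsub>homeo_group X\<^esub> y) \<in> carrier (homeo_group X)"
      by (cases p) (simp add: topspace_compact_open)
  next
    fix K U assume K: "compactin X K" and U: "openin X U"
    let ?W = "{p \<in> topspace (prod_topology ?T ?T). (case p of (x, y) \<Rightarrow> x \<otimes>\<^bsub>homeo_group X\<^esub> y) ` K \<subseteq> U}"
    have KX: "K \<subseteq> topspace X" using K by (rule compactin_subset_topspace)
    show "openin (prod_topology ?T ?T) ?W"
    proof (subst openin_subopen, intro ballI)
      fix p assume p: "p \<in> ?W"
      obtain f g where fg: "p = (f, g)" by (cases p)
      have f: "f \<in> carrier (homeo_group X)" and g: "g \<in> carrier (homeo_group X)"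
        using p unfolding fg by (simp_all add: topspace_compact_open)
      have fc: "continuous_map X X f" and gc: "continuous_map X X g"
        using f g homeomorphic_imp_continuous_map unfolding carrier_homeo_group by auto
      have fgK: "f (g x) \<in> U" if "x \<in> K" for x
      proof -
        have "(f \<otimes>\<^bsub>homeo_group X\<^esub> g) x \<in> U" using p that unfolding fg by auto
        then show ?thesis using that KX homeo_group_mult[OF f g] by (auto simp: compose_eq)
      qed
      have cgK: "closedin X (g ` K)"
        using compactin_imp_closedin[OF haus image_compactin[OF K gc]] .
      have of: "openin X {x \<in> topspace X. f x \<in> U}"
        using openin_continuous_map_preimage[OF fc U] .
      have cD: "closedin X (topspace X - {x \<in> topspace X. f x \<in> U})"
        by (rule closedin_diff[OF closedin_topspace of])
      have dD: "disjnt (g ` K) (topspace X - {x \<in> topspace X. f x \<in> U})"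
        using fgK by (auto simp: disjnt_iff)
      from normal_spaceD[OF norm cgK cD dD] obtain A B where AB: "openin X A" "openin X B" "g ` K \<subseteq> A"
        "topspace X - {x \<in> topspace X. f x \<in> U} \<subseteq> B" "disjnt A B"
        by (elim exE conjE) (rule that)
      have C: "compactin X (topspace X - B)"
        using closedin_compact_space[OF cpt] AB(2) by blast
      have AC: "A \<subseteq> topspace X - B" using AB openin_subset[OF AB(1)] by (auto simp: disjnt_iff)
      have CU: "f ` (topspace X - B) \<subseteq> U" using AB(4) by blast
      let ?N = "cosub X (topspace X - B) U \<times> cosub X K A"
      have "openin (prod_topology ?T ?T) ?N"
        using openin_cosub[OF C U] openin_cosub[OF K AB(1)] by (simp add: openin_prod_Times_iff)
      moreover have "p \<in> ?N" unfolding fg using f g CU AB(3) by (simp add: cosub_def)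
      moreover have "?N \<subseteq> ?W"
      proof
        fix q assume q: "q \<in> ?N"
        obtain f' g' where fg': "q = (f', g')" by (cases q)
        have f': "f' \<in> carrier (homeo_group X)" "f' ` (topspace X - B) \<subseteq> U"
          and g': "g' \<in> carrier (homeo_group X)" "g' ` K \<subseteq> A"
          using q unfolding fg' by (simp_all add: cosub_def)
        have "(f' \<otimes>\<^bsub>homeo_group X\<^esub> g') x \<in> U" if "x \<in> K" for x
        proof -
          have "f' (g' x) \<in> U" using that g'(2) AC f'(2) by blast
          then show ?thesis using that KX homeo_group_mult[OF f'(1) g'(1)] by (auto simp: compose_eq)
        qed
        then show "q \<in> ?W" unfolding fg' using f' g' by (auto simp: topspace_compact_open)
      qed
      ultimately show "\<exists>N. openin (prod_topology ?T ?T) N \<and> p \<in> N \<and> N \<subseteq> ?W" by blast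
    qed
  qed
  have inv: "continuous_map ?T ?T (\<lambda>x. inv\<^bsub>homeo_group X\<^esub> x)"
  proof (rule continuous_map_into_compact_open)
    fix f assume "f \<in> topspace ?T"
    then show "inv\<^bsub>homeo_group X\<^esub> f \<in> carrier (homeo_group X)" by (simp add: topspace_compact_open)
  next
    fix K U assume K: "compactin X K" and U: "openin X U"
    have KX: "K \<subseteq> topspace X" using K by (rule compactin_subset_topspace)
    have "{f \<in> topspace ?T. (inv\<^bsub>homeo_group X\<^esub> f) ` K \<subseteq> U} = cosub X (topspace X - U) (topspace X - K)"
    proof (intro equalityI subsetI)
      fix f assume "f \<in> {f \<in> topspace ?T. (inv\<^bsub>homeo_group X\<^esub> f) ` K \<subseteq> U}"
      then have f: "f \<in> carrier (homeo_group X)" "(inv\<^bsub>homeo_group X\<^esub> f) ` K \<subseteq> U"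
        by (simp_all add: topspace_compact_open)
      have "f x \<in> topspace X - K" if x: "x \<in> topspace X - U" for x
      proof -
        have "f x \<notin> K"
        proof
          assume "f x \<in> K"
          then have "(inv\<^bsub>homeo_group X\<^esub> f) (f x) \<in> U" using f(2) by blast
          then show False using x homeo_group_inv(1)[OF f(1), of x] by simp
        qed
        then show ?thesis using homeo_group_inv(4)[OF f(1), of x] x by simp
      qed
      then show "f \<in> cosub X (topspace X - U) (topspace X - K)" using f(1) by (auto simp: cosub_def)
    next
      fix f assume "f \<in> cosub X (topspace X - U) (topspace X - K)"
      then have f: "f \<in> carrier (homeo_group X)" "f ` (topspace X - U) \<subseteq> topspace X - K"
        by (simp_all add: cosub_def)
      have "(inv\<^bsub>homeo_group X\<^esub> f) x \<in> U" if x: "x \<in> K" for x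
      proof (rule ccontr)
        assume "(inv\<^bsub>homeo_group X\<^esub> f) x \<notin> U"
        then have "(inv\<^bsub>homeo_group X\<^esub> f) x \<in> topspace X - U"
          using homeo_group_inv(3)[OF f(1), of x] x KX by blast
        then have "f ((inv\<^bsub>homeo_group X\<^esub> f) x) \<in> topspace X - K" using f(2) by blast
        then show False using homeo_group_inv(2)[OF f(1), of x] x KX by auto
      qed
      then show "f \<in> {f \<in> topspace ?T. (inv\<^bsub>homeo_group X\<^esub> f) ` K \<subseteq> U}"
        using f(1) by (auto simp: topspace_compact_open)
    qed
    moreover have "compactin X (topspace X - U)"
      using closedin_compact_space[OF cpt] U by blast
    moreover have "openin X (topspace X - K)" using compactin_imp_closedin[OF haus K] by blast
    ultimately show "openin ?T {f \<in> topspace ?T. (inv\<^bsub>homeo_group X\<^esub> f) ` K \<subseteq> U}"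
      using openin_cosub by metis
  qed
  show ?thesis
    unfolding topological_group_def using group_homeo_group topspace_compact_open mult inv by blast
qed

lemma subgroup_closure_of:
  assumes tg: "topological_group G T" and K: "subgroup K G"
  shows "subgroup (T closure_of K) G"
proof -
  interpret group G using tg by (simp add: topological_group_def)
  have top: "topspace T = carrier G" using tg by (simp add: topological_group_def)
  have mult: "continuous_map (prod_topology T T) T (\<lambda>(x, y). x \<otimes>\<^bsub>G\<^esub> y)"
    and inv: "continuous_map T T (\<lambda>x. inv\<^bsub>G\<^esub> x)" using tg by (simp_all add: topological_group_def)
  have KT: "K \<subseteq> T closure_of K"
    using closure_of_subset[of K T] subgroup.subset[OF K] top by simp
  show ?thesis
  proof (rule subgroupI)
    show "T closure_of K \<subseteq> carrier G" using closure_of_subset_topspace[of T K] top by simp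
    show "T closure_of K \<noteq> {}" using KT subgroup.one_closed[OF K] by blast
    show "inv\<^bsub>G\<^esub> x \<in> T closure_of K" if "x \<in> T closure_of K" for x
    proof -
      have "(\<lambda>x. inv\<^bsub>G\<^esub> x) ` K \<subseteq> K" using subgroup.m_inv_closed[OF K] by blast
      then have "T closure_of ((\<lambda>x. inv\<^bsub>G\<^esub> x) ` K) \<subseteq> T closure_of K" by (rule closure_of_mono)
      then show ?thesis using continuous_map_image_closure_subset[OF inv, of K] that by blast
    qed
    show "x \<otimes>\<^bsub>G\<^esub> y \<in> T closure_of K" if "x \<in> T closure_of K" "y \<in> T closure_of K" for x y
    proof -
      have "(\<lambda>(x, y). x \<otimes>\<^bsub>G\<^esub> y) ` (K \<times> K) \<subseteq> K" using subgroup.m_closed[OF K] by auto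
      then have "T closure_of ((\<lambda>(x, y). x \<otimes>\<^bsub>G\<^esub> y) ` (K \<times> K)) \<subseteq> T closure_of K" by (rule closure_of_mono)
      moreover have "(x, y) \<in> prod_topology T T closure_of (K \<times> K)" using that by (simp add: closure_of_Times)
      then have "(\<lambda>(x, y). x \<otimes>\<^bsub>G\<^esub> y) (x, y) \<in> T closure_of ((\<lambda>(x, y). x \<otimes>\<^bsub>G\<^esub> y) ` (K \<times> K))"
        using continuous_map_image_closure_subset[OF mult, of "K \<times> K"] by blast
      ultimately show ?thesis by auto
    qed
  qed
qed

lemma topological_subgroup:
  assumes tg: "topological_group G T" and H: "subgroup H G"
  shows "topological_group (G\<lparr>carrier := H\<rparr>) (subtopology T H)"
proof -
  interpret group G using tg by (simp add: topological_group_def)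
  have top: "topspace T = carrier G" using tg by (simp add: topological_group_def)
  have mult: "continuous_map (prod_topology T T) T (\<lambda>(x, y). x \<otimes>\<^bsub>G\<^esub> y)"
    and inv: "continuous_map T T (\<lambda>x. inv\<^bsub>G\<^esub> x)" using tg by (simp_all add: topological_group_def)
  have HG: "H \<subseteq> carrier G" by (rule subgroup.subset[OF H])
  have topH: "topspace (subtopology T H) = H" using HG top by auto
  have "continuous_map (prod_topology (subtopology T H) (subtopology T H)) (subtopology T H) (\<lambda>(x, y). x \<otimes>\<^bsub>G\<^esub> y)"
  proof (rule continuous_map_into_subtopology)
    show "continuous_map (prod_topology (subtopology T H) (subtopology T H)) T (\<lambda>(x, y). x \<otimes>\<^bsub>G\<^esub> y)"
      unfolding subtopology_Times[symmetric] by (rule continuous_map_from_subtopology[OF mult])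
    show "(\<lambda>(x, y). x \<otimes>\<^bsub>G\<^esub> y) \<in> topspace (prod_topology (subtopology T H) (subtopology T H)) \<rightarrow> H"
      using subgroup.m_closed[OF H] topH by auto
  qed
  moreover have "continuous_map (subtopology T H) (subtopology T H) (\<lambda>x. inv\<^bsub>G\<lparr>carrier := H\<rparr>\<^esub> x)"
  proof (rule continuous_map_into_subtopology)
    have "continuous_map (subtopology T H) T (\<lambda>x. inv\<^bsub>G\<^esub> x)" by (rule continuous_map_from_subtopology[OF inv])
    then show "continuous_map (subtopology T H) T (\<lambda>x. inv\<^bsub>G\<lparr>carrier := H\<rparr>\<^esub> x)"
      by (rule continuous_map_eq) (use topH m_inv_consistent[OF H] in simp)
    show "(\<lambda>x. inv\<^bsub>G\<lparr>carrier := H\<rparr>\<^esub> x) \<in> topspace (subtopology T H) \<rightarrow> H"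
      using subgroup.m_inv_closed[OF H] topH m_inv_consistent[OF H] by auto
  qed
  moreover have "group (G\<lparr>carrier := H\<rparr>)" by (rule subgroup.subgroup_is_group[OF H is_group])
  ultimately show ?thesis unfolding topological_group_def using topH by simp
qed

section \<open>Quotients by closed equivalence relations\<close>

locale closed_equiv =
  fixes M :: "'a rel_struct"
  assumes top: "topological_structure M"
    and equiv: "equiv (topspace (points M)) (rel_R M \<union> (rel_R M)\<inverse>)"
begin

abbreviation "S \<equiv> topspace (points M)"
abbreviation "E \<equiv> rel_R M \<union> (rel_R M)\<inverse>"
abbreviation "\<pi> \<equiv> quotient_proj M"
abbreviation "Q \<equiv> quotient_space M"

lemma compact: "compact_space (points M)" and Hausdorff: "Hausdorff_space (points M)"
  and dim0: "points M dim_le 0"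
  and closed_R: "closedin (prod_topology (points M) (points M)) (rel_R M)"
  using top metrizable_imp_Hausdorff_space by (auto simp: topological_structure_def)

lemma pi_eq: "x \<in> S \<Longrightarrow> y \<in> S \<Longrightarrow> \<pi> x = \<pi> y \<longleftrightarrow> (x, y) \<in> E"
  unfolding quotient_proj_def using eq_equiv_class_iff[OF equiv] by blast

lemma quotient_map: "quotient_map (points M) Q \<pi>"
  unfolding quotient_space_def by (rule quotient_map_quotient_topology)

lemma topspace_Q: "topspace Q = \<pi> ` S"
  using quotient_imp_surjective_map[OF quotient_map] by simp

lemma continuous_pi: "continuous_map (points M) Q \<pi>"
  by (rule quotient_imp_continuous_map[OF quotient_map])

lemma compact_Q: "compact_space Q"
  using image_compactin[OF _ continuous_pi, of S] compact topspace_Q by (simp add: compact_space_def)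

lemma closed_E: "closedin (prod_topology (points M) (points M)) E"
proof -
  have "continuous_map (prod_topology (points M) (points M)) (prod_topology (points M) (points M)) (\<lambda>p. (snd p, fst p))"
    by (intro continuous_intros)
  from closedin_continuous_map_preimage[OF this closed_R]
  have "closedin (prod_topology (points M) (points M)) {p \<in> S \<times> S. (snd p, fst p) \<in> rel_R M}" by simp
  moreover have "{p \<in> S \<times> S. (snd p, fst p) \<in> rel_R M} = (rel_R M)\<inverse>"
    using closedin_subset[OF closed_R] by auto
  ultimately show ?thesis using closed_R by (simp add: closedin_Un)
qed

text \<open>The saturation of \<open>C\<close> is the second projection of
  \<open>E \<inter> (C \<times> S)\<close>, which is closed in a compact square and hence has a
  compact image.\<close>

lemma closed_map_pi: "closed_map (points M) Q \<pi>"
  unfolding closed_map_def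
proof (intro allI impI)
  fix C assume C: "closedin (points M) C"
  have CS: "C \<subseteq> S" by (rule closedin_subset[OF C])
  let ?P = "prod_topology (points M) (points M)"
  have "closedin ?P (E \<inter> (C \<times> S))"
    using C by (intro closedin_Int closed_E) (simp add: closedin_prod_Times_iff)
  moreover have "compact_space ?P" using compact by (simp add: compact_space_prod_topology)
  ultimately have "compactin ?P (E \<inter> (C \<times> S))" by (rule closedin_compact_space[rotated])
  then have "compactin (points M) (snd ` (E \<inter> (C \<times> S)))"
    by (rule image_compactin) (rule continuous_map_snd)
  then have "closedin (points M) (snd ` (E \<inter> (C \<times> S)))" by (rule compactin_imp_closedin[OF Hausdorff])
  moreover have "snd ` (E \<inter> (C \<times> S)) = {x \<in> S. \<pi> x \<in> \<pi> ` C}"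
  proof (intro equalityI subsetI)
    fix y assume "y \<in> snd ` (E \<inter> (C \<times> S))"
    then obtain x where x: "(x, y) \<in> E" "x \<in> C" "y \<in> S" by (elim imageE IntE) (auto simp only: snd_conv mem_Sigma_iff split_paired_all)
    then have "\<pi> x = \<pi> y" using pi_eq[of x y] CS by blast
    then show "y \<in> {x \<in> S. \<pi> x \<in> \<pi> ` C}" using x by (metis (mono_tags) image_eqI mem_Collect_eq)
  next
    fix y assume "y \<in> {x \<in> S. \<pi> x \<in> \<pi> ` C}"
    then obtain x where x: "y \<in> S" "x \<in> C" "\<pi> y = \<pi> x" by blast
    then have "(x, y) \<in> E" using pi_eq[of x y] CS by auto
    then have "(x, y) \<in> E \<inter> (C \<times> S)" using x by blast
    then show "y \<in> snd ` (E \<inter> (C \<times> S))" by (rule rev_image_eqI) simp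
  qed
  moreover have "\<pi> ` C \<subseteq> topspace Q" using CS topspace_Q by blast
  ultimately show "closedin Q (\<pi> ` C)"
    using quotient_map unfolding quotient_map_closedin by simp
qed

text \<open>Closed continuous maps carry normal Hausdorff spaces to Hausdorff spaces, and
  compactness supplies normality.\<close>

lemma Hausdorff_Q: "Hausdorff_space Q"
  using normal_Hausdorff_space_closed_continuous_map_image[OF _ Hausdorff closed_map_pi continuous_pi]
    compact_Hausdorff_or_regular_imp_normal_space[OF compact] Hausdorff topspace_Q by blast

lemma topological_group_Q: "topological_group (homeo_group Q) (compact_open Q)"
  by (rule topological_group_homeo[OF compact_Q Hausdorff_Q])

end

section \<open>The limit of the ordered fans\<close>

text \<open>The heights \<open>2 * t\<close> and \<open>2 * t + 1\<close> are identified, so height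
  \<open>2 * n + 1\<close> is mapped exactly onto height \<open>n\<close>. The minimum bounds the
  letters at later times, as words of height \<open>n\<close> require.\<close>

definition halving :: "nat \<Rightarrow> nat \<Rightarrow> lword" where
  "halving k n = map (\<lambda>i. (\<lambda>t. min (t div 2) n, i)) [0..<k]"

lemma steps_half: "(\<lambda>t. min (t div 2) n) \<in> steps"
  unfolding steps_def by (auto simp: min_def)

lemma halving_set: "(F, j) \<in> set (halving k n) \<longleftrightarrow> j < k \<and> F = (\<lambda>t. min (t div 2) n)"
  by (auto simp: halving_def)

lemma word_map_halving:
  assumes "i < k" "t \<le> 2 * n + 1"
  shows "word_map (halving k n) (vtx i t) = vtx i (t div 2)"
proof -
  have "F \<in> steps" if "(F, j) \<in> set (halving k n)" for F j
    using that steps_half unfolding halving_set by blast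
  from word_map_vtx[of "halving k n" i t, OF this] show ?thesis
    using assms by (simp add: halving_def min_def)
qed

lemma halving_epimorphism:
  assumes "0 < k"
  shows "epimorphism (word_map (halving k n)) (std_fan k (2 * n + 1)) (std_fan k n)"
proof (rule word_map_epimorphism)
  show "length (halving k n) \<le> k" by (simp add: halving_def)
  show "0 < k" by (rule assms)
  show "F \<in> steps \<and> (\<forall>t. F t \<le> n) \<and> j < k" if "(F, j) \<in> set (halving k n)" for F j
    using that steps_half unfolding halving_set by auto
  have "map snd (halving k n) = [0..<k]" by (simp add: halving_def o_def)
  then show "sorted (map snd (halving k n))" by simp
  show "\<exists>F. (F, j) \<in> set (halving k n) \<and> F (2 * n + 1) = n" if "j < k" for j
    using that unfolding halving_set by auto
qed

locale fan_limit =
  fixes M :: "'a rel_struct"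
  assumes lim: "projective_Fraisse_limit {A. ordered_fan A} M"
begin

abbreviation "S \<equiv> topspace (points M)"

lemma top: "topological_structure M" using lim by (simp add: projective_Fraisse_limit_def)

lemma compact: "compact_space (points M)" and Hausdorff: "Hausdorff_space (points M)"
  and dim0: "points M dim_le 0"
  and closed_R: "closedin (prod_topology (points M) (points M)) (rel_R M)"
  and closed_S: "closedin (prod_topology (points M) (points M)) (rel_S M)"
  using top metrizable_imp_Hausdorff_space by (auto simp: topological_structure_def)

lemma rel_subset: "rel_R M \<subseteq> S \<times> S" "rel_S M \<subseteq> S \<times> S"
  using closedin_subset[OF closed_R] closedin_subset[OF closed_S] by simp_all

lemma onto_std_fan:
  assumes "0 < k" "0 < n"
  shows "\<exists>f. epimorphism f M (std_fan k n)"
  using lim ordered_fan_std_fan[OF assms] by (simp add: projective_Fraisse_limit_def)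

lemma homogeneous:
  assumes "0 < k" "0 < n" "epimorphism f1 M (std_fan k n)" "epimorphism f2 M (std_fan k n)"
  shows "\<exists>h. automorphism M h \<and> (\<forall>x\<in>S. f2 x = f1 (h x))"
  using lim ordered_fan_std_fan[OF assms(1,2)] assms(3,4) unfolding projective_Fraisse_limit_def by simp

lemma factor_nat:
  fixes X :: "nat set"
  assumes X: "finite X" "continuous_map (points M) (discrete_topology X) g"
  shows "\<exists>k n f g'. 0 < k \<and> 0 < n \<and> epimorphism f M (std_fan k n) \<and> (\<forall>x\<in>S. g x = g' (f x))"
proof -
  have "\<forall>(X :: nat set) g. finite X \<longrightarrow> continuous_map (points M) (discrete_topology X) g \<longrightarrow>
        (\<exists>A\<in>{A :: nat rel_struct. ordered_fan A}. \<exists>f g'. epimorphism f M A \<and> g' \<in> topspace (points A) \<rightarrow> X \<and>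
           (\<forall>x\<in>S. g x = g' (f x)))"
    using lim unfolding projective_Fraisse_limit_def by (elim conjE)
  from this[THEN spec, THEN spec, THEN mp, OF X(1), THEN mp, OF X(2)] obtain A f g' where A: "ordered_fan A" and f: "epimorphism f M (A :: nat rel_struct)" and g': "\<forall>x\<in>S. g x = g' (f x)"
    by (elim bexE exE conjE CollectE) (rule that)
  obtain v k n where v: "grid v k n A" using ordered_fan_grid[OF A] by blast
  then have k: "0 < k" by (simp add: grid_def)
  obtain \<beta> where \<beta>: "epimorphism \<beta> A (std_fan k n)" "inj_on \<beta> (topspace (points A))"
    using epimorphism_grids[OF v grid_std_fan[OF k]] by blast
  have f1: "epimorphism (\<beta> \<circ> f) M (std_fan k n)" by (rule epimorphism_comp[OF f \<beta>(1)])
  define g1 where "g1 y = g' (inv_into (topspace (points A)) \<beta> y)" for y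
  have g1: "g x = g1 ((\<beta> \<circ> f) x)" if "x \<in> S" for x
    using g' that inv_into_f_f[OF \<beta>(2) epimorphism_in[OF f that]] by (simp add: g1_def)
  show ?thesis
  proof (cases "n = 0")
    case False then show ?thesis using k f1 g1 by blast
  next
    \<comment> \<open>At height 0 the fan is a point and \<open>g\<close> is constant, so any
      epimorphism will do; height 1 is taken because the standard fans are used with positive
      height.\<close>
    case True
    have "(\<beta> \<circ> f) x = vroot" if "x \<in> S" for x
      using epimorphism_in[OF f1 that] True by (auto elim!: std_fan_E)
    then have "g x = g1 vroot" if "x \<in> S" for x using g1[OF that] that by simp
    moreover obtain f2 where "epimorphism f2 M (std_fan k 1)" using onto_std_fan[OF k, of 1] by auto
    ultimately show ?thesis using k
      by (intro exI[of _ k] exI[of _ 1] exI[of _ f2] exI[of _ "\<lambda>_. g1 vroot"]) simp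
  qed
qed

text \<open>The values may lie in any type, so that clopen sets, epimorphisms and tuples of such
  maps are treated alike; for factoring they are coded by natural numbers.\<close>

definition locally_const :: "('a \<Rightarrow> 'b) \<Rightarrow> bool" where
  "locally_const g \<longleftrightarrow> finite (g ` S) \<and> (\<forall>c. openin (points M) {x \<in> S. g x = c})"

lemma factor_locally_const:
  assumes "locally_const g"
  shows "\<exists>k n f g'. 0 < k \<and> 0 < n \<and> epimorphism f M (std_fan k n) \<and> (\<forall>x\<in>S. g x = g' (f x))"
proof -
  have fin: "finite (g ` S)" and op: "\<And>c. openin (points M) {x \<in> S. g x = c}"
    using assms by (auto simp: locally_const_def)
  obtain e :: "_ \<Rightarrow> nat" where e: "inj_on e (g ` S)" using finite_imp_inj_to_nat_seg[OF fin] by blast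
  define X where "X = e ` g ` S"
  have "continuous_map (points M) (discrete_topology X) (e \<circ> g)"
    unfolding continuous_map_def
  proof (intro conjI allI impI)
    show "e \<circ> g \<in> S \<rightarrow> topspace (discrete_topology X)" by (auto simp: X_def)
    fix U assume "openin (discrete_topology X) U"
    have "{x \<in> S. (e \<circ> g) x \<in> U} = (\<Union>c\<in>{c. e c \<in> U}. {x \<in> S. g x = c})" by auto
    then show "openin (points M) {x \<in> S. (e \<circ> g) x \<in> U}" using op by (simp add: openin_Union image_iff openin_clauses(3))
  qed
  from factor_nat[OF _ this] obtain k n f g' where
    f: "0 < k" "0 < n" "epimorphism f M (std_fan k n)" "\<forall>x\<in>S. (e \<circ> g) x = g' (f x)"
    using fin unfolding X_def by blast
  have "g x = inv_into (g ` S) e (g' (f x))" if "x \<in> S" for x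
    using f(4) that inv_into_f_f[OF e, of "g x"] by (metis comp_apply imageI)
  then show ?thesis using f(1-3)
    by (intro exI[of _ k] exI[of _ n] exI[of _ f] exI[of _ "\<lambda>y. inv_into (g ` S) e (g' y)"]) simp
qed

text \<open>Finitely many maps are one map into a finite product. Restricting the tuples to
  \<open>I\<close> makes them extensional, so that only finitely many occur.\<close>

lemma factor_family:
  assumes I: "finite I" and locally_const: "\<And>i. i \<in> I \<Longrightarrow> locally_const (g i)"
  shows "\<exists>k n f g'. 0 < k \<and> 0 < n \<and> epimorphism f M (std_fan k n) \<and> (\<forall>i\<in>I. \<forall>x\<in>S. g i x = g' i (f x))"
proof -
  define G where "G x = restrict (\<lambda>i. g i x) I" for x
  have "locally_const G"
    unfolding locally_const_def
  proof (intro conjI allI)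
    have "G ` S \<subseteq> (\<Pi>\<^sub>E i\<in>I. g i ` S)" by (auto simp: G_def)
    moreover have "finite (\<Pi>\<^sub>E i\<in>I. g i ` S)" using I locally_const by (intro finite_PiE) (auto simp: locally_const_def)
    ultimately show "finite (G ` S)" by (rule finite_subset)
    fix c
    show "openin (points M) {x \<in> S. G x = c}"
    proof (cases "c \<in> extensional I")
      case True
      have "G x = c \<longleftrightarrow> (\<forall>i\<in>I. g i x = c i)" for x
      proof
        assume "\<forall>i\<in>I. g i x = c i"
        then show "G x = c" using True unfolding G_def by (intro extensionalityI[of _ I]) auto
      qed (auto simp: G_def)
      then have "{x \<in> S. G x = c} = S \<inter> (\<Inter>i\<in>I. {x \<in> S. g i x = c i})" by auto
      moreover have "openin (points M) (S \<inter> (\<Inter>i\<in>I. {x \<in> S. g i x = c i}))"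
      proof (cases "I = {}")
        case False
        have "openin (points M) (\<Inter>i\<in>I. {x \<in> S. g i x = c i})"
          using locally_const by (intro openin_INT2[OF I False]) (simp add: locally_const_def)
        then show ?thesis by blast
      qed simp
      ultimately show ?thesis by simp
    next
      case False
      have "G x \<in> extensional I" for x by (simp add: G_def)
      then have e: "{x \<in> S. G x = c} = {}" using False by auto
      show ?thesis unfolding e by (rule openin_empty)
    qed
  qed
  from factor_locally_const[OF this] obtain k n f g' where
    f: "0 < k" "0 < n" "epimorphism f M (std_fan k n)" "\<forall>x\<in>S. G x = g' (f x)" by blast
  have "g i x = g' (f x) i" if "i \<in> I" "x \<in> S" for i x
  proof -
    have "g' (f x) = G x" using f(4) that by simp
    then show ?thesis using that by (simp add: G_def)
  qed
  then show ?thesis using f(1-3)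
    by (intro exI[of _ k] exI[of _ n] exI[of _ f] exI[of _ "\<lambda>i y. g' y i"]) simp
qed

lemma locally_const_clopen:
  assumes "openin (points M) P" "closedin (points M) P"
  shows "locally_const (\<lambda>x. x \<in> P)"
  unfolding locally_const_def
proof (intro conjI allI)
  show "finite ((\<lambda>x. x \<in> P) ` S)" by (rule finite_subset[of _ UNIV]) auto
  fix c :: bool
  have "P \<subseteq> S" using assms(1) by (rule openin_subset)
  then have "{x \<in> S. (x \<in> P) = c} = (if c then P else S - P)" by auto
  then show "openin (points M) {x \<in> S. (x \<in> P) = c}"
    using assms openin_diff[OF openin_topspace assms(2)] by simp
qed

lemma locally_const_epimorphism:
  assumes "epimorphism f M (std_fan k n)"
  shows "locally_const f"
  unfolding locally_const_def
proof (intro conjI allI)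
  have "f ` S = topspace (points (std_fan k n))" using assms by (simp add: epimorphism_def)
  then show "finite (f ` S)" using finite_std_graph_verts by (simp add: topspace_std_fan)
  fix c
  have cm: "continuous_map (points M) (points (std_fan k n)) f" using assms by (simp add: epimorphism_def)
  have "openin (points (std_fan k n)) ({c} \<inter> topspace (points (std_fan k n)))" by (simp add: std_fan_def)
  from openin_continuous_map_preimage[OF cm this]
  have "openin (points M) {x \<in> S. f x \<in> {c} \<inter> topspace (points (std_fan k n))}" .
  moreover have "{x \<in> S. f x \<in> {c} \<inter> topspace (points (std_fan k n))} = {x \<in> S. f x = c}"
    using epimorphism_in[OF assms] by blast
  ultimately show "openin (points M) {x \<in> S. f x = c}" by simp
qed

lemma clopen_nbhd:
  assumes "openin (points M) U" "x \<in> U"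
  shows "\<exists>P. openin (points M) P \<and> closedin (points M) P \<and> x \<in> P \<and> P \<subseteq> U"
proof -
  have xS: "x \<in> S" using assms openin_subset by blast
  have "neighbourhood_base_of (\<lambda>U. closedin (points M) U \<and> openin (points M) U) (points M)"
    using dim0 dimension_le_0_neighbourhood_base_of_clopen by blast
  then have "\<exists>A V. openin (points M) A \<and> (closedin (points M) V \<and> openin (points M) V) \<and> x \<in> A \<and> A \<subseteq> V \<and> V \<subseteq> U"
    using xS assms unfolding neighbourhood_base_of_def neighbourhood_base_at_def by simp
  then show ?thesis by blast
qed

lemma clopen_between:
  assumes C: "closedin (points M) C" and U: "openin (points M) U" "C \<subseteq> U"
  shows "\<exists>P. openin (points M) P \<and> closedin (points M) P \<and> C \<subseteq> P \<and> P \<subseteq> U"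
proof -
  have "\<forall>x\<in>C. \<exists>P. openin (points M) P \<and> closedin (points M) P \<and> x \<in> P \<and> P \<subseteq> U"
    using clopen_nbhd[OF U(1)] U(2) by blast
  then obtain p where p: "\<And>x. x \<in> C \<Longrightarrow> openin (points M) (p x) \<and> closedin (points M) (p x) \<and> x \<in> p x \<and> p x \<subseteq> U"
    by metis
  have cC: "compactin (points M) C" by (rule closedin_compact_space[OF compact C])
  have "(\<forall>U\<in>p ` C. openin (points M) U) \<and> C \<subseteq> \<Union>(p ` C)" using p by blast
  from cC[unfolded compactin_def, THEN conjunct2, THEN spec, THEN mp, OF this] obtain \<F> where F: "finite \<F>" "\<F> \<subseteq> p ` C" "C \<subseteq> \<Union>\<F>" by blast
  have Fp: "openin (points M) A \<and> closedin (points M) A \<and> A \<subseteq> U" if "A \<in> \<F>" for A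
    using that F(2) p by blast
  have "openin (points M) (\<Union>\<F>)" using Fp by (intro openin_Union) blast
  moreover have "closedin (points M) (\<Union>\<F>)" using Fp F(1) by (intro closedin_Union) blast+
  moreover have "\<Union>\<F> \<subseteq> U" using Fp by blast
  ultimately show ?thesis using F(3) by blast
qed

lemma separate:
  assumes "x \<in> S" "y \<in> S" "x \<noteq> y"
  shows "\<exists>P. openin (points M) P \<and> closedin (points M) P \<and> x \<in> P \<and> y \<notin> P"
proof -
  obtain U V where UV: "openin (points M) U" "openin (points M) V" "x \<in> U" "y \<in> V" "disjnt U V"
    using Hausdorff assms unfolding Hausdorff_space_def by metis
  then have "y \<notin> U" by (auto simp: disjnt_iff)
  then show ?thesis using clopen_nbhd[OF UV(1,3)] by blast
qed

text \<open>If \<open>(x, x)\<close> were missing, closedness would give a clopen \<open>P\<close>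
  containing \<open>x\<close> with no related pair inside. But \<open>P\<close> is a union of fibres
  of some \<open>f\<close>, and the loop at \<open>f x\<close> lifts to a related pair in the fibre
  of \<open>x\<close>.\<close>

lemma R_refl:
  assumes x: "x \<in> S"
  shows "(x, x) \<in> rel_R M"
proof (rule ccontr)
  assume "(x, x) \<notin> rel_R M"
  then have "(x, x) \<in> topspace (prod_topology (points M) (points M)) - rel_R M" using x by simp
  moreover have "openin (prod_topology (points M) (points M)) (topspace (prod_topology (points M) (points M)) - rel_R M)"
    by (rule openin_diff[OF openin_topspace closed_R])
  ultimately obtain U V where UV: "openin (points M) U" "openin (points M) V" "x \<in> U" "x \<in> V"
    "U \<times> V \<subseteq> topspace (prod_topology (points M) (points M)) - rel_R M"
    unfolding openin_prod_topology_alt by metis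
  obtain P where P: "openin (points M) P" "closedin (points M) P" "x \<in> P" "P \<subseteq> U \<inter> V"
    using clopen_nbhd[of "U \<inter> V" x] UV by auto
  obtain k n f g' where f: "0 < k" "epimorphism f M (std_fan k n)" "\<forall>y\<in>S. (y \<in> P) = g' (f y)"
    using factor_locally_const[OF locally_const_clopen[OF P(1,2)]] by blast
  obtain i t where "i < k" "t \<le> n" "f x = vtx i t" using epimorphism_in[OF f(2) x] by (rule std_fan_E)
  then have "(f x, f x) \<in> rel_R (std_fan k n)" using std_fan_R_I[of i k t n t] by simp
  then have "(f x, f x) \<in> map_prod f f ` rel_R M" using f(2) by (simp add: epimorphism_def)
  then obtain a b where ab: "(a, b) \<in> rel_R M" "f a = f x" "f b = f x" by auto
  then have "a \<in> S" "b \<in> S" using rel_subset by auto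
  then have "a \<in> P" "b \<in> P" using f(3) ab(2,3) x P(3) by auto
  then show False using UV(5) P(4) ab(1) by blast
qed

text \<open>Halving after any epimorphism onto the taller fan has the same target as
  \<open>f\<close>, so homogeneity provides an automorphism that turns one into the other.\<close>

lemma refine:
  assumes "0 < k" "0 < n" "epimorphism f M (std_fan k n)"
  shows "\<exists>f2. epimorphism f2 M (std_fan k (2 * n + 1)) \<and> (\<forall>x\<in>S. f x = word_map (halving k n) (f2 x))"
proof -
  obtain f0 where f0: "epimorphism f0 M (std_fan k (2 * n + 1))" using onto_std_fan[OF assms(1), of "2 * n + 1"] by auto
  obtain h where h: "automorphism M h" "\<forall>x\<in>S. f x = (word_map (halving k n) \<circ> f0) (h x)"
    using homogeneous[OF assms(1,2) epimorphism_comp[OF f0 halving_epimorphism[OF assms(1)]] assms(3)] by blast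
  have "epimorphism (f0 \<circ> h) M (std_fan k (2 * n + 1))"
    using h(1) f0 unfolding automorphism_def by (intro epimorphism_comp) auto
  then show ?thesis using h(2) by (intro exI[of _ "f0 \<circ> h"]) simp
qed

lemma std_fan_adjacent:
  assumes "(p, q) \<in> rel_R (std_fan k n) \<union> (rel_R (std_fan k n))\<inverse>" "p \<noteq> q" "q = vtx i b" "0 < b"
  shows "p = vtx i (b - 1) \<or> p = vtx i (Suc b)"
  using assms(1)
proof
  assume "(p, q) \<in> rel_R (std_fan k n)"
  then obtain j s t where "t = s \<or> t = Suc s" "p = vtx j s" "q = vtx j t" by (rule std_fan_R_E)
  then show ?thesis using assms(2-4) by (auto simp: vtx_eq)
next
  assume "(p, q) \<in> (rel_R (std_fan k n))\<inverse>"
  then have "(q, p) \<in> rel_R (std_fan k n)" by simp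
  then obtain j s t where "t = s \<or> t = Suc s" "q = vtx j s" "p = vtx j t" by (rule std_fan_R_E)
  then show ?thesis using assms(2-4) by (auto simp: vtx_eq)
qed

lemma std_fan_adjacent_root:
  assumes "(p, vroot) \<in> rel_R (std_fan k n) \<union> (rel_R (std_fan k n))\<inverse>"
  shows "\<exists>j<k. \<exists>t\<le>1. t \<le> n \<and> p = vtx j t"
  using assms
proof
  assume "(p, vroot) \<in> rel_R (std_fan k n)"
  then obtain j s t where "j < k" "t = s \<or> t = Suc s" "p = vtx j s" "vroot = vtx j t" by (rule std_fan_R_E)
  then show ?thesis by (intro exI[of _ j] conjI exI[of _ s]) auto
next
  assume "(p, vroot) \<in> (rel_R (std_fan k n))\<inverse>"
  then have "(vroot, p) \<in> rel_R (std_fan k n)" by simp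
  then obtain j s t where "j < k" "t \<le> n" "t = s \<or> t = Suc s" "vroot = vtx j s" "p = vtx j t" by (rule std_fan_R_E)
  then show ?thesis by (intro exI[of _ j] conjI exI[of _ t]) auto
qed

text \<open>Halving the heights identifies two of any three consecutive vertices, so by refining an
  epimorphism that separates \<open>x\<close>, \<open>y\<close>, \<open>z\<close> one sees that a point has at most one neighbour.\<close>

lemma no_three:
  assumes xyz: "x \<in> S" "y \<in> S" "z \<in> S" "x \<noteq> y" "y \<noteq> z" "x \<noteq> z"
    and E: "(x, y) \<in> rel_R M \<union> (rel_R M)\<inverse>" "(z, y) \<in> rel_R M \<union> (rel_R M)\<inverse>"
  shows False
proof -
  obtain P1 where P1: "openin (points M) P1" "closedin (points M) P1" "x \<in> P1" "y \<notin> P1"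
    using separate[OF xyz(1,2,4)] by blast
  obtain P2 where P2: "openin (points M) P2" "closedin (points M) P2" "y \<in> P2" "z \<notin> P2"
    using separate[OF xyz(2,3,5)] by blast
  obtain P3 where P3: "openin (points M) P3" "closedin (points M) P3" "x \<in> P3" "z \<notin> P3"
    using separate[OF xyz(1,3,6)] by blast
  have "locally_const (\<lambda>x. x \<in> P)" if "P \<in> {P1, P2, P3}" for P
    using that locally_const_clopen[OF P1(1,2)] locally_const_clopen[OF P2(1,2)] locally_const_clopen[OF P3(1,2)] by auto
  from factor_family[of "{P1, P2, P3}" "\<lambda>P x. x \<in> P", OF _ this]
  obtain k n f g' where kn: "0 < k" "0 < n" and f: "epimorphism f M (std_fan k n)"
    and g': "\<forall>P\<in>{P1, P2, P3}. \<forall>x\<in>S. (x \<in> P) = g' P (f x)" by auto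
  have "f x \<noteq> f y" "f z \<noteq> f y" "f x \<noteq> f z"
    using g' xyz(1-3) P1(3,4) P2(3,4) P3(3,4) by (metis insertCI)+
  moreover obtain f2 where f2: "epimorphism f2 M (std_fan k (2 * n + 1))" "\<forall>x\<in>S. f x = word_map (halving k n) (f2 x)"
    using refine[OF kn f] by blast
  ultimately have ne: "word_map (halving k n) (f2 x) \<noteq> word_map (halving k n) (f2 y)"
    "word_map (halving k n) (f2 z) \<noteq> word_map (halving k n) (f2 y)" "word_map (halving k n) (f2 x) \<noteq> word_map (halving k n) (f2 z)"
    using xyz(1-3) by auto
  have E2: "(f2 a, f2 b) \<in> rel_R (std_fan k (2 * n + 1)) \<union> (rel_R (std_fan k (2 * n + 1)))\<inverse>"
    if "(a, b) \<in> rel_R M \<union> (rel_R M)\<inverse>" for a b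
    using that epimorphism_R[OF f2(1)] by blast
  obtain i b where y: "i < k" "b \<le> 2 * n + 1" "f2 y = vtx i b"
    using epimorphism_in[OF f2(1) xyz(2)] by (rule std_fan_E)
  show False
  proof (cases "b = 0")
    case True
    then have q: "f2 y = vroot" using y by simp
    \<comment> \<open>Neighbours of the root have height at most 1, on whatever branch, and heights
      0 and 1 are both halved to the root; so \<open>f\<close> would not separate \<open>x\<close>
      from \<open>y\<close>.\<close>
    obtain j t where "j < k" "t \<le> 1" "t \<le> 2 * n + 1" "f2 x = vtx j t"
      using std_fan_adjacent_root[OF E2[OF E(1), unfolded q]] by blast
    moreover have "word_map (halving k n) (f2 y) = vroot" using word_map_halving[OF y(1,2)] y(3) True by simp
    ultimately show False using ne(1) word_map_halving[of j k t n] by (simp add: div_eq_0_iff)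
  next
    case False
    have xz: "f2 x \<noteq> f2 y" "f2 z \<noteq> f2 y" "f2 x \<noteq> f2 z" using ne by auto
    have "f2 x = vtx i (b - 1) \<or> f2 x = vtx i (Suc b)" "f2 z = vtx i (b - 1) \<or> f2 z = vtx i (Suc b)"
      using std_fan_adjacent[OF E2[OF E(1)] xz(1) y(3)] std_fan_adjacent[OF E2[OF E(2)] xz(2) y(3)] False by auto
    \<comment> \<open>Two distinct neighbours of \<open>f2 y\<close> must be the one below and the
      one above; which of them belongs to \<open>x\<close> is left open.\<close>
    then obtain u w where uw: "{u, w} = {x, z}" "f2 u = vtx i (b - 1)" "f2 w = vtx i (Suc b)" using xz(3) by auto
    have "w \<in> S" using uw(1) xyz by (auto simp: doubleton_eq_iff)
    then obtain j c where jc: "j < k" "c \<le> 2 * n + 1" "f2 w = vtx j c" using epimorphism_in[OF f2(1)] std_fan_E by metis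
    have Sb: "Suc b \<le> 2 * n + 1" using jc uw(3) by (auto simp: vtx_eq)
    have "word_map (halving k n) (f2 u) = vtx i ((b - 1) div 2)" "word_map (halving k n) (f2 y) = vtx i (b div 2)"
      "word_map (halving k n) (f2 w) = vtx i (Suc b div 2)"
      using word_map_halving[OF y(1), of "b - 1" n] word_map_halving[OF y(1), of b n] word_map_halving[OF y(1), of "Suc b" n] uw y Sb by simp_all
    moreover have "(b - 1) div 2 = b div 2 \<or> b div 2 = Suc b div 2" using False by presburger
    ultimately have "word_map (halving k n) (f2 u) = word_map (halving k n) (f2 y) \<or> word_map (halving k n) (f2 w) = word_map (halving k n) (f2 y)" by metis
    then show False using uw(1) ne(1,2) by (auto simp: doubleton_eq_iff)
  qed
qed

text \<open>Since \<open>no_three\<close> excludes three distinct points in a row, transitivity only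
  concerns coinciding points: every class has at most two elements.\<close>

lemma closed_equiv: "closed_equiv M"
proof (rule closed_equiv.intro[OF top])
  let ?E = "rel_R M \<union> (rel_R M)\<inverse>"
  have sub: "?E \<subseteq> S \<times> S" using rel_subset(1) by blast
  show "equiv S ?E"
  proof (rule equivI)
    show "?E \<subseteq> S \<times> S" by (rule sub)
    show "refl_on S ?E" using R_refl by (auto simp: refl_on_def)
    show "sym ?E" by (auto simp: sym_def)
    show "trans ?E"
    proof (rule transI)
      fix x y z assume xy: "(x, y) \<in> ?E" and yz: "(y, z) \<in> ?E"
      then have S: "x \<in> S" "y \<in> S" "z \<in> S" using sub by blast+
      have zy: "(z, y) \<in> ?E" using yz by blast
      show "(x, z) \<in> ?E"
      proof (cases "x = y \<or> y = z \<or> x = z")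
        case True then show ?thesis using xy yz R_refl[OF S(1)] by blast
      next
        case False then show ?thesis using no_three[OF S _ _ _ xy zy] by blast
      qed
    qed
  qed
qed

end

section \<open>The Ramsey property of the automorphism group\<close>

context fan_limit
begin

lemma automorphism_id: "automorphism M (\<lambda>x. x)"
  by (simp add: automorphism_def epimorphism_def map_prod_def)

lemma automorphism_in: "automorphism M h \<Longrightarrow> x \<in> S \<Longrightarrow> h x \<in> S"
  unfolding automorphism_def by (blast intro: epimorphism_in)

lemma automorphism_comp:
  assumes "automorphism M g" "automorphism M h"
  shows "automorphism M (g \<circ> h)"
proof -
  have "h ` S = S" "inj_on g S" "inj_on h S" using assms by (auto simp: automorphism_def epimorphism_def)
  then have "inj_on (g \<circ> h) S" by (intro comp_inj_on) simp_all
  then show ?thesis using assms epimorphism_comp unfolding automorphism_def by blast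
qed

lemma epimorphism_automorphism:
  "epimorphism f M N \<Longrightarrow> automorphism M h \<Longrightarrow> epimorphism (f \<circ> h) M N"
  unfolding automorphism_def by (blast intro: epimorphism_comp)

lemma automorphism_inverse:
  assumes h: "automorphism M h"
  shows "automorphism M (inv_into S h)"
proof -
  have hS: "h ` S = S" and inj: "inj_on h S" and cont: "continuous_map (points M) (points M) h"
    and R: "rel_R M = map_prod h h ` rel_R M" and SS: "rel_S M = map_prod h h ` rel_S M"
    using h by (auto simp: automorphism_def epimorphism_def)
  have "homeomorphic_map (points M) (points M) h"
    by (rule continuous_imp_homeomorphic_map[OF cont compact Hausdorff hS inj])
  then obtain g where g: "homeomorphic_maps (points M) (points M) h g" unfolding homeomorphic_map_maps by blast
  have gi: "g x = inv_into S h x" if "x \<in> S" for x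
  proof -
    have "h (g x) = x" "g x \<in> S" using g that continuous_map_image_subset_topspace[of "points M" "points M" g]
      unfolding homeomorphic_maps_def by auto
    then show ?thesis using inv_into_f_f[OF inj, of "g x"] by simp
  qed
  have "continuous_map (points M) (points M) g" using g by (simp add: homeomorphic_maps_def)
  then have "continuous_map (points M) (points M) (inv_into S h)"
    by (rule continuous_map_eq) (rule gi)
  moreover have "inv_into S h ` S = S" using inv_into_image_cancel[OF inj subset_refl] hS by simp
  moreover have "X = map_prod (inv_into S h) (inv_into S h) ` X"
    if X: "X = map_prod h h ` X" "X \<subseteq> S \<times> S" for X
  proof -
    have "map_prod (inv_into S h) (inv_into S h) ` map_prod h h ` X = (\<lambda>p. p) ` X"
      unfolding image_image using X(2) inv_into_f_f[OF inj] by (intro image_cong refl) auto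
    then show ?thesis using X(1) by simp
  qed
  moreover have "inj_on (inv_into S h) S" using inj_on_inv_into[of S h S] hS by simp
  ultimately show ?thesis
    using R SS rel_subset unfolding automorphism_def epimorphism_def by blast
qed

text \<open>The relations of a target are images, and taking images along \<open>\<psi>\<close> and
  then \<open>\<gamma>\<close> amounts to taking them along \<open>f\<close>.\<close>

lemma factor_epimorphism:
  assumes \<psi>: "epimorphism \<psi> M (std_fan K m)" and f: "epimorphism f M N"
    and eq: "\<And>x. x \<in> S \<Longrightarrow> f x = \<gamma> (\<psi> x)"
  shows "epimorphism \<gamma> (std_fan K m) N"
proof (rule epimorphism_std_fan_I)
  have "\<gamma> ` \<psi> ` S = f ` S" unfolding image_image using eq by (intro image_cong refl) simp
  then show "\<gamma> ` topspace (points (std_fan K m)) = topspace (points N)"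
    using \<psi> f by (simp add: epimorphism_def)
  have *: "map_prod \<gamma> \<gamma> ` map_prod \<psi> \<psi> ` X = map_prod f f ` X" if "X \<subseteq> S \<times> S" for X
    unfolding image_image using that eq by (intro image_cong refl) auto
  show "rel_R N = map_prod \<gamma> \<gamma> ` rel_R (std_fan K m)"
    using \<psi> f *[OF rel_subset(1)] by (simp add: epimorphism_def)
  show "rel_S N = map_prod \<gamma> \<gamma> ` rel_S (std_fan K m)"
    using \<psi> f *[OF rel_subset(2)] by (simp add: epimorphism_def)
qed

text \<open>The composites \<open>\<phi> \<circ> g\<close> factor through one \<open>\<psi>\<close>
  and become words \<open>\<delta> g\<close>. By homogeneity there is an \<open>h\<close> for which
  \<open>\<psi> \<circ> h\<close> is the map of the blocks read on a large fan. Then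
  \<open>\<phi> \<circ> g \<circ> h\<close> is the map of \<open>substitute (\<delta> g) ps\<close>,
  and these words have a common colour.\<close>

theorem automorphism_Ramsey:
  fixes col :: "('a \<Rightarrow> 'a) \<Rightarrow> 'c"
  assumes kn: "0 < k" "0 < n" and \<phi>: "epimorphism \<phi> M (std_fan k n)"
    and F: "finite F" "\<And>g. g \<in> F \<Longrightarrow> automorphism M g" and col: "finite (range col)"
  shows "\<exists>c h. automorphism M h \<and>
    (\<forall>g\<in>F. \<exists>h'. automorphism M h' \<and> col h' = c \<and> (\<forall>x\<in>S. \<phi> (g (h x)) = \<phi> (h' x)))"
proof -
  have "locally_const (\<phi> \<circ> g)" if "g \<in> F" for g
    by (rule locally_const_epimorphism[OF epimorphism_automorphism[OF \<phi> F(2)[OF that]]])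
  from factor_family[OF F(1), of "\<lambda>g. \<phi> \<circ> g", OF this] obtain K m \<psi> \<gamma> where
    Km: "0 < K" "0 < m" and \<psi>: "epimorphism \<psi> M (std_fan K m)"
    and \<gamma>: "\<forall>g\<in>F. \<forall>x\<in>S. (\<phi> \<circ> g) x = \<gamma> g (\<psi> x)" by blast
  have "\<exists>\<delta>\<in>frag m n k K. (\<forall>j<k. full m n \<delta> j) \<and> (\<forall>y\<in>topspace (points (std_fan K m)). \<gamma> g y = word_map \<delta> y)"
    if g: "g \<in> F" for g
  proof (rule epimorphism_word_map[OF _ Km(1) kn])
    show "epimorphism (\<gamma> g) (std_fan K m) (std_fan k n)"
      by (rule factor_epimorphism[OF \<psi> epimorphism_automorphism[OF \<phi> F(2)[OF g]]]) (use \<gamma> g in blast)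
  qed
  then obtain \<delta> where \<delta>: "\<And>g. g \<in> F \<Longrightarrow> \<delta> g \<in> frag m n k K" "\<And>g. g \<in> F \<Longrightarrow> \<forall>j<k. full m n (\<delta> g) j"
    "\<And>g y. g \<in> F \<Longrightarrow> y \<in> topspace (points (std_fan K m)) \<Longrightarrow> \<gamma> g y = word_map (\<delta> g) y" by metis
  \<comment> \<open>A reference epimorphism for each size, through which a word on the fan of size
    \<open>N\<close> becomes a map on the limit.\<close>
  define \<xi> where "\<xi> N = (SOME f. epimorphism f M (std_fan N N))" for N
  have \<xi>: "epimorphism (\<xi> N) M (std_fan N N)" if "0 < N" for N
    unfolding \<xi>_def by (rule someI_ex[OF onto_std_fan[OF that that]])
  \<comment> \<open>A word is coloured through a chosen automorphism that induces the same map. For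
    a word without such an automorphism the choice is arbitrary; it only makes the colouring
    total.\<close>
  define hx where "hx N x = (SOME h. automorphism M h \<and> (\<forall>z\<in>S. word_map x (\<xi> N z) = \<phi> (h z)))" for N x
  have "range (\<lambda>(N, x). col (hx N x)) \<subseteq> range col" by auto
  then have "finite (range (\<lambda>(N, x). col (hx N x)))" using col by (rule finite_subset)
  from labelled_words_Ramsey[of "\<lambda>N x. col (hx N x)", OF this kn(1), of K m n]
  obtain c ps N where ps: "length ps = K" "\<forall>p\<in>set ps. has_level m p \<and> (\<exists>F\<in>set p. F N = m)"
    "length (concat ps) \<le> N" and
    mono: "\<forall>\<delta>\<in>frag m n k K. (\<forall>j<k. full m n \<delta> j) \<longrightarrow> col (hx N (substitute \<delta> ps)) = c" by blast
  have psst: "F \<in> steps" if "p \<in> set ps" "F \<in> set p" for p F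
    using ps(2) that unfolding has_level_def by blast
  \<comment> \<open>A letter with value \<open>m\<close> at time \<open>N\<close> excludes
    \<open>N = 0\<close>, since letters vanish at 0 and \<open>m\<close> is positive.\<close>
  have N: "0 < N"
  proof (rule ccontr)
    assume "\<not> 0 < N"
    moreover have "ps ! 0 \<in> set ps" using ps(1) Km(1) by simp
    then obtain G where "G \<in> set (ps ! 0)" "G N = m" "G \<in> steps" using ps(2) psst by blast
    ultimately show False using Km(2) steps_0[of G] by simp
  qed
  have \<Gamma>: "epimorphism (word_map (blocks ps)) (std_fan N N) (std_fan K m)"
    using blocks_epimorphism[OF _ ps(3,2)] Km(1) ps(1) by simp
  obtain h where h: "automorphism M h" "\<forall>x\<in>S. (word_map (blocks ps) \<circ> \<xi> N) x = \<psi> (h x)"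
    using homogeneous[OF Km \<psi> epimorphism_comp[OF \<xi>[OF N] \<Gamma>]] by blast
  have "\<exists>h'. automorphism M h' \<and> col h' = c \<and> (\<forall>x\<in>S. \<phi> (g (h x)) = \<phi> (h' x))" if g: "g \<in> F" for g
  proof -
    have eq: "\<phi> (g (h x)) = word_map (substitute (\<delta> g) ps) (\<xi> N x)" if x: "x \<in> S" for x
    proof -
      have hxS: "h x \<in> S" by (rule automorphism_in[OF h(1) x])
      have "\<phi> (g (h x)) = \<gamma> g (\<psi> (h x))" using \<gamma> g hxS by simp
      also have "\<dots> = word_map (\<delta> g) (\<psi> (h x))" by (rule \<delta>(3)[OF g epimorphism_in[OF \<psi> hxS]])
      also have "\<psi> (h x) = word_map (blocks ps) (\<xi> N x)" using h(2) x by simp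
      also have "word_map (\<delta> g) (word_map (blocks ps) (\<xi> N x)) = word_map (substitute (\<delta> g) ps) (\<xi> N x)"
      proof -
        obtain i t where it: "\<xi> N x = vtx i t" using epimorphism_in[OF \<xi>[OF N] x] by (rule std_fan_E)
        have "F \<in> steps" if "(F, j) \<in> set (\<delta> g)" for F j
          using \<delta>(1)[OF g] that bounded_steps_steps unfolding frag_def by blast
        moreover have "length (\<delta> g) = length ps" using \<delta>(1)[OF g] ps(1) by (simp add: frag_def)
        ultimately show ?thesis unfolding it using word_map_substitute[of "\<delta> g" ps i t] psst by simp
      qed
      finally show ?thesis .
    qed
    have "epimorphism (\<phi> \<circ> (g \<circ> h)) M (std_fan k n)"
      by (rule epimorphism_automorphism[OF \<phi> automorphism_comp[OF F(2)[OF g] h(1)]])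
    from homogeneous[OF kn \<phi> this] obtain h0 where "automorphism M h0 \<and> (\<forall>x\<in>S. word_map (substitute (\<delta> g) ps) (\<xi> N x) = \<phi> (h0 x))"
      using eq by auto
    then have "automorphism M (hx N (substitute (\<delta> g) ps)) \<and>
        (\<forall>x\<in>S. word_map (substitute (\<delta> g) ps) (\<xi> N x) = \<phi> (hx N (substitute (\<delta> g) ps) x))"
      unfolding hx_def
      by (rule someI[of "\<lambda>h. automorphism M h \<and> (\<forall>x\<in>S. word_map (substitute (\<delta> g) ps) (\<xi> N x) = \<phi> (h x))"])
    moreover have "col (hx N (substitute (\<delta> g) ps)) = c" using mono \<delta>(1,2)[OF g] by blast
    ultimately show ?thesis using eq by (intro exI[of _ "hx N (substitute (\<delta> g) ps)"]) simp
  qed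
  then show ?thesis using h(1) by blast
qed

section \<open>The induced homeomorphisms\<close>

interpretation quo?: closed_equiv M by (rule closed_equiv)

text \<open>The induced homeomorphism, built from chosen representatives; \<open>star_pi\<close>
  shows that the choice does not matter. Restriction makes it extensional, as elements of the
  homeomorphism group are.\<close>

definition star :: "('a \<Rightarrow> 'a) \<Rightarrow> 'a set \<Rightarrow> 'a set" where
  "star h = restrict (\<lambda>c. \<pi> (h (SOME x. x \<in> S \<and> \<pi> x = c))) (topspace Q)"

lemma star_pi:
  assumes h: "automorphism M h" and x: "x \<in> S"
  shows "star h (\<pi> x) = \<pi> (h x)"
proof -
  define y where "y = (SOME y. y \<in> S \<and> \<pi> y = \<pi> x)"
  have "\<exists>y. y \<in> S \<and> \<pi> y = \<pi> x" using x by blast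
  then have y: "y \<in> S" "\<pi> y = \<pi> x" unfolding y_def by (metis (mono_tags, lifting) someI_ex)+
  then have "(y, x) \<in> E" using pi_eq[OF y(1) x] by simp
  then have "(h y, h x) \<in> E"
    using h epimorphism_R[of h M M] unfolding automorphism_def by blast
  then have "\<pi> (h y) = \<pi> (h x)" using pi_eq automorphism_in[OF h] x y(1) by blast
  moreover have "\<pi> x \<in> topspace Q" using x topspace_Q by blast
  ultimately show ?thesis unfolding star_def y_def by simp
qed

lemma star_carrier:
  assumes h: "automorphism M h"
  shows "star h \<in> carrier (homeo_group Q)"
proof -
  have hS: "h ` S = S" and cont: "continuous_map (points M) (points M) h"
    using h by (auto simp: automorphism_def epimorphism_def)
  have "continuous_map (points M) Q (star h \<circ> \<pi>)"
    using continuous_map_eq[OF continuous_map_compose[OF cont continuous_pi], of "star h \<circ> \<pi>"] star_pi[OF h] by simp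
  then have c: "continuous_map Q Q (star h)" by (rule continuous_compose_quotient_map[OF quotient_map])
  have "star h ` topspace Q = \<pi> ` h ` S"
    unfolding topspace_Q image_image using star_pi[OF h] by (intro image_cong refl) simp
  then have surj: "star h ` topspace Q = topspace Q" using hS topspace_Q by simp
  have "inj_on (star h) (topspace Q)"
  proof (rule inj_onI)
    fix a b assume a: "a \<in> topspace Q" and b: "b \<in> topspace Q" and eq: "star h a = star h b"
    obtain x where x: "x \<in> S" "a = \<pi> x" using a unfolding topspace_Q by (elim imageE)
    obtain y where y: "y \<in> S" "b = \<pi> y" using b unfolding topspace_Q by (elim imageE)
    have "\<pi> (h x) = \<pi> (h y)" using eq star_pi[OF h] x y by simp
    then have hE: "(h x, h y) \<in> E"
      unfolding pi_eq[OF automorphism_in[OF h x(1)] automorphism_in[OF h y(1)]] .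
    note hi = automorphism_inverse[OF h]
    have hi': "epimorphism (inv_into S h) M M" using hi by (simp add: automorphism_def)
    have "(inv_into S h (h x), inv_into S h (h y)) \<in> E"
      using hE epimorphism_R[OF hi', of "h x" "h y"] epimorphism_R[OF hi', of "h y" "h x"] by blast
    moreover have "inj_on h S" using h by (simp add: automorphism_def)
    ultimately have "(x, y) \<in> E" using x(1) y(1) by (simp add: inv_into_f_f)
    then have "\<pi> x = \<pi> y" unfolding pi_eq[OF x(1) y(1)] .
    then show "a = b" using x(2) y(2) by simp
  qed
  then have "homeomorphic_map Q Q (star h)"
    by (intro continuous_imp_homeomorphic_map[OF c compact_Q Hausdorff_Q surj])
  then show ?thesis unfolding carrier_homeo_group by (simp add: star_def)
qed

lemma star_unique:
  assumes "g \<in> carrier (homeo_group Q)" "automorphism M h" "\<And>x. x \<in> S \<Longrightarrow> g (\<pi> x) = \<pi> (h x)"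
  shows "g = star h"
proof (rule extensionalityI[of _ "topspace Q"])
  show "g \<in> extensional (topspace Q)" "star h \<in> extensional (topspace Q)"
    using assms(1) star_carrier[OF assms(2)] unfolding carrier_homeo_group by auto
  show "g c = star h c" if "c \<in> topspace Q" for c
    using that assms(3) star_pi[OF assms(2)] unfolding topspace_Q by auto
qed

lemma induced_homeos_eq: "induced_homeos M = star ` Collect (automorphism M)"
proof
  show "induced_homeos M \<subseteq> star ` Collect (automorphism M)"
    unfolding induced_homeos_def using star_unique by blast
  show "star ` Collect (automorphism M) \<subseteq> induced_homeos M"
    unfolding induced_homeos_def using star_carrier star_pi by blast
qed

lemma star_comp:
  assumes g: "automorphism M g" and h: "automorphism M h" and f: "automorphism M f"
    and eq: "\<And>x. x \<in> S \<Longrightarrow> f x = g (h x)"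
  shows "star g \<otimes>\<^bsub>homeo_group Q\<^esub> star h = star f"
proof (rule star_unique[OF _ f])
  interpret group "homeo_group Q" by (rule group_homeo_group)
  show "star g \<otimes>\<^bsub>homeo_group Q\<^esub> star h \<in> carrier (homeo_group Q)"
    using star_carrier[OF g] star_carrier[OF h] by simp
  fix x assume x: "x \<in> S"
  have "(star g \<otimes>\<^bsub>homeo_group Q\<^esub> star h) (\<pi> x) = star g (star h (\<pi> x))"
    using homeo_group_mult[OF star_carrier[OF g] star_carrier[OF h]] x topspace_Q by (simp add: compose_eq)
  also have "\<dots> = \<pi> (g (h x))" using star_pi[OF h x] star_pi[OF g automorphism_in[OF h x]] by simp
  finally show "(star g \<otimes>\<^bsub>homeo_group Q\<^esub> star h) (\<pi> x) = \<pi> (f x)" using eq[OF x] by simp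
qed

lemma star_id: "star (\<lambda>x. x) = \<one>\<^bsub>homeo_group Q\<^esub>"
proof -
  interpret group "homeo_group Q" by (rule group_homeo_group)
  have "star (\<lambda>x. x) \<otimes>\<^bsub>homeo_group Q\<^esub> star (\<lambda>x. x) = star (\<lambda>x. x)"
    by (rule star_comp) (simp_all add: automorphism_id)
  then show ?thesis using star_carrier[OF automorphism_id] by (metis l_cancel_one)
qed

lemma subgroup_induced: "subgroup (induced_homeos M) (homeo_group Q)"
  unfolding induced_homeos_eq
proof (rule group.subgroupI[OF group_homeo_group])
  interpret group "homeo_group Q" by (rule group_homeo_group)
  show "star ` Collect (automorphism M) \<subseteq> carrier (homeo_group Q)" using star_carrier by blast
  show "star ` Collect (automorphism M) \<noteq> {}" using automorphism_id by blast
  fix a assume "a \<in> star ` Collect (automorphism M)"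
  then obtain g where g: "automorphism M g" "a = star g" by blast
  have inj: "inj_on g S" using g(1) by (simp add: automorphism_def)
  have "star (inv_into S g) \<otimes>\<^bsub>homeo_group Q\<^esub> star g = star (\<lambda>x. x)"
    by (rule star_comp[OF automorphism_inverse[OF g(1)] g(1) automorphism_id]) (simp add: inv_into_f_f[OF inj])
  then have "inv\<^bsub>homeo_group Q\<^esub> a = star (inv_into S g)"
    unfolding star_id g(2)
    using inv_equality star_carrier[OF g(1)] star_carrier[OF automorphism_inverse[OF g(1)]] by simp
  then show "inv\<^bsub>homeo_group Q\<^esub> a \<in> star ` Collect (automorphism M)" using automorphism_inverse[OF g(1)] by blast
  fix b assume "b \<in> star ` Collect (automorphism M)"
  then obtain h where h: "automorphism M h" "b = star h" by blast
  have "a \<otimes>\<^bsub>homeo_group Q\<^esub> b = star (g \<circ> h)"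
    unfolding g(2) h(2) by (rule star_comp[OF g(1) h(1) automorphism_comp[OF g(1) h(1)]]) simp
  then show "a \<otimes>\<^bsub>homeo_group Q\<^esub> b \<in> star ` Collect (automorphism M)"
    using automorphism_comp[OF g(1) h(1)] by blast
qed

text \<open>The preimage of \<open>W\<close> under \<open>star\<close> contains the stabilizer of an
  epimorphism onto a finite fan, so it is a neighbourhood of the identity in the usual topology of
  the automorphism group.\<close>

definition stabilized :: "('a set \<Rightarrow> 'a set) set \<Rightarrow> bool" where
  "stabilized W \<longleftrightarrow> (\<exists>k n f. 0 < k \<and> 0 < n \<and> epimorphism f M (std_fan k n) \<and>
     (\<forall>h. automorphism M h \<longrightarrow> (\<forall>x\<in>S. f (h x) = f x) \<longrightarrow> star h \<in> W))"

text \<open>All the given epimorphisms factor through a single one, and preserving that one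
  preserves each of them.\<close>

lemma stabilized_Inter:
  assumes I: "finite I" and st: "\<And>i. i \<in> I \<Longrightarrow> stabilized (W i)"
  shows "\<exists>k n f. 0 < k \<and> 0 < n \<and> epimorphism f M (std_fan k n) \<and>
     (\<forall>h. automorphism M h \<longrightarrow> (\<forall>x\<in>S. f (h x) = f x) \<longrightarrow> (\<forall>i\<in>I. star h \<in> W i))"
proof -
  have "\<exists>f :: 'a \<Rightarrow> nat. locally_const f \<and> (\<forall>h. automorphism M h \<longrightarrow> (\<forall>x\<in>S. f (h x) = f x) \<longrightarrow> star h \<in> W i)" if iI: "i \<in> I" for i
  proof -
    obtain k n f where f: "epimorphism f M (std_fan k n)"
      "\<forall>h. automorphism M h \<longrightarrow> (\<forall>x\<in>S. f (h x) = f x) \<longrightarrow> star h \<in> W i"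
      using st[OF iI] unfolding stabilized_def by blast
    show ?thesis by (intro exI[of _ f] conjI locally_const_epimorphism[OF f(1)] f(2))
  qed
  then have "\<forall>i\<in>I. \<exists>f :: 'a \<Rightarrow> nat. locally_const f \<and>
    (\<forall>h. automorphism M h \<longrightarrow> (\<forall>x\<in>S. f (h x) = f x) \<longrightarrow> star h \<in> W i)" by (rule ballI)
  from bchoice[OF this] obtain f :: "_ \<Rightarrow> 'a \<Rightarrow> nat" where
    fi: "\<forall>i\<in>I. locally_const (f i) \<and> (\<forall>h. automorphism M h \<longrightarrow> (\<forall>x\<in>S. f i (h x) = f i x) \<longrightarrow> star h \<in> W i)"
    by (elim exE)
  have f: "locally_const (f i)" if "i \<in> I" for i using bspec[OF fi that] by (rule conjunct1)
  have f2: "star h \<in> W i" if "i \<in> I" "automorphism M h" "\<forall>x\<in>S. f i (h x) = f i x" for i h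
    using bspec[OF fi that(1)] that(2,3) by simp
  from factor_family[OF I, of f, OF f] obtain k n f0 g' where
    f0: "0 < k" "0 < n" "epimorphism f0 M (std_fan k n)" "\<forall>i\<in>I. \<forall>x\<in>S. f i x = g' i (f0 x)" by blast
  have "star h \<in> W i" if h: "automorphism M h" "\<forall>x\<in>S. f0 (h x) = f0 x" and i: "i \<in> I" for h i
  proof (rule f2[OF i h(1)])
    show "\<forall>x\<in>S. f i (h x) = f i x" using f0(4) i h(2) automorphism_in[OF h(1)] by simp
  qed
  then show ?thesis using f0(1-3) by blast
qed

text \<open>A clopen \<open>P\<close> between the preimages of \<open>K\<close> and \<open>U\<close>
  is a union of fibres of an epimorphism onto a finite fan; automorphisms preserving it map
  \<open>P\<close> into itself, and so induce maps of \<open>K\<close> into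
  \<open>U\<close>.\<close>

lemma stabilized_cosub:
  assumes K: "compactin Q K" and U: "openin Q U" and KU: "K \<subseteq> U"
  shows "stabilized (cosub Q K U)"
proof -
  have KQ: "K \<subseteq> topspace Q" using K by (rule compactin_subset_topspace)
  have cK: "closedin (points M) {x \<in> S. \<pi> x \<in> K}"
    by (rule closedin_continuous_map_preimage[OF continuous_pi compactin_imp_closedin[OF Hausdorff_Q K]])
  have oU: "openin (points M) {x \<in> S. \<pi> x \<in> U}" by (rule openin_continuous_map_preimage[OF continuous_pi U])
  have "{x \<in> S. \<pi> x \<in> K} \<subseteq> {x \<in> S. \<pi> x \<in> U}" using KU by blast
  from clopen_between[OF cK oU this] obtain P where P: "openin (points M) P" "closedin (points M) P"
    "{x \<in> S. \<pi> x \<in> K} \<subseteq> P" "P \<subseteq> {x \<in> S. \<pi> x \<in> U}" by (elim exE conjE)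
  obtain k n f g' where f: "0 < k" "0 < n" "epimorphism f M (std_fan k n)" "\<forall>x\<in>S. (x \<in> P) = g' (f x)"
    using factor_locally_const[OF locally_const_clopen[OF P(1,2)]] by blast
  have "star h \<in> cosub Q K U" if h: "automorphism M h" "\<forall>x\<in>S. f (h x) = f x" for h
  proof -
    have "star h c \<in> U" if c: "c \<in> K" for c
    proof -
      have "c \<in> \<pi> ` S" using c KQ unfolding topspace_Q by (rule subsetD[rotated])
      then obtain x where x: "x \<in> S" "c = \<pi> x" by (elim imageE)
      then have "x \<in> P" using P(3) c by blast
      then have "h x \<in> P" using f(4) h(2) x(1) automorphism_in[OF h(1) x(1)] by simp
      then show ?thesis using P(4) star_pi[OF h(1) x(1)] x(2) by auto
    qed
    then show ?thesis using star_carrier[OF h(1)] by (auto simp: cosub_def)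
  qed
  then show ?thesis using f(1-3) unfolding stabilized_def by blast
qed

text \<open>Continuity of \<open>star\<close> at the identity, by induction over the generation of
  the compact-open topology.\<close>

lemma stabilized_open:
  assumes "openin (compact_open Q) W" "\<one>\<^bsub>homeo_group Q\<^esub> \<in> W"
  shows "stabilized W"
proof -
  have one: "\<one>\<^bsub>homeo_group Q\<^esub> c = c" if "c \<in> topspace Q" for c
    using that by (simp add: homeo_group_def BijGroup_def)
  have "generate_topology_on {cosub Q K U | K U. compactin Q K \<and> openin Q U} W"
    using assms(1) unfolding compact_open_cosub by (rule openin_topology_generated_by)
  then have "\<one>\<^bsub>homeo_group Q\<^esub> \<in> W \<longrightarrow> stabilized W"
  proof induction
    case Empty then show ?case by simp
  next
    case (Int a b)
    show ?case
    proof
      assume "\<one>\<^bsub>homeo_group Q\<^esub> \<in> a \<inter> b"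
      then have "stabilized ((if i then a else b))" for i :: bool using Int.IH by simp
      from stabilized_Inter[of "UNIV :: bool set" "\<lambda>i. if i then a else b", OF _ this]
      obtain k n f where "0 < k" "0 < n" "epimorphism f M (std_fan k n)"
        "\<forall>h. automorphism M h \<longrightarrow> (\<forall>x\<in>S. f (h x) = f x) \<longrightarrow> (\<forall>i\<in>UNIV. star h \<in> (if i then a else b))"
        by auto
      moreover from this have "\<forall>h. automorphism M h \<longrightarrow> (\<forall>x\<in>S. f (h x) = f x) \<longrightarrow> star h \<in> a \<inter> b"
        by (metis (full_types) IntI UNIV_I)
      ultimately show "stabilized (a \<inter> b)" unfolding stabilized_def by blast
    qed
  next
    case (UN \<K>)
    show ?case
    proof
      assume "\<one>\<^bsub>homeo_group Q\<^esub> \<in> \<Union>\<K>"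
      then obtain k where k: "k \<in> \<K>" "\<one>\<^bsub>homeo_group Q\<^esub> \<in> k" by blast
      then have "stabilized k" using UN.IH by blast
      then show "stabilized (\<Union>\<K>)" using k(1) unfolding stabilized_def by blast
    qed
  next
    case (Basis s)
    then obtain K U where KU: "compactin Q K" "openin Q U" "s = cosub Q K U" by blast
    show ?case
    proof
      assume "\<one>\<^bsub>homeo_group Q\<^esub> \<in> s"
      then have "K \<subseteq> U"
        unfolding KU(3) cosub_def using one compactin_subset_topspace[OF KU(1)] by force
      then show "stabilized s" unfolding KU(3) by (rule stabilized_cosub[OF KU(1,2)])
    qed
  qed
  then show ?thesis using assms(2) by blast
qed

lemma subgroup_H: "subgroup (carrier (H_group M)) (homeo_group Q)"
  unfolding H_group_def by (simp add: subgroup_closure_of[OF topological_group_Q subgroup_induced])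

lemma H_group_eq: "H_group M = homeo_group Q\<lparr>carrier := carrier (H_group M)\<rparr>"
  by (simp add: H_group_def)

lemma topological_group_H: "topological_group (H_group M) (H_topology M)"
  unfolding H_topology_def using topological_subgroup[OF topological_group_Q subgroup_H] H_group_eq by simp

lemma star_H: "automorphism M h \<Longrightarrow> star h \<in> carrier (H_group M)"
proof -
  assume "automorphism M h"
  then have "star h \<in> induced_homeos M" using induced_homeos_eq by blast
  moreover have "induced_homeos M \<subseteq> topspace (compact_open Q)"
    unfolding topspace_compact_open by (rule subgroup.subset[OF subgroup_induced])
  ultimately show ?thesis unfolding H_group_def using closure_of_subset[of "induced_homeos M"] by auto
qed

lemma topspace_H: "topspace (H_topology M) = carrier (H_group M)"
  using topological_group_H by (simp add: topological_group_def)

text \<open>Two nested sets per point are needed: the Ramsey property determines a translate of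
  \<open>x0\<close> only up to a small automorphism, which may move a point of \<open>W x\<close>
  but keeps it in \<open>U x\<close>, and \<open>U x\<close> is disjoint from its own image under
  \<open>g x\<close>.\<close>

lemma fixed_point_induced:
  fixes X :: "'x topology"
  assumes X: "compact_space X" "Hausdorff_space X" "topspace X \<noteq> {}"
    and act: "group_action (H_group M) (topspace X) \<phi>"
    and cont: "continuous_map (prod_topology (H_topology M) X) X (\<lambda>(g, x). \<phi> g x)"
  shows "\<exists>x\<in>topspace X. \<forall>h. automorphism M h \<longrightarrow> \<phi> (star h) x = x"
proof (rule ccontr)
  assume no: "\<not> ?thesis"
  interpret group_action "H_group M" "topspace X" \<phi> by (rule act)
  let ?H = "H_group M" and ?T = "H_topology M"
  have one: "\<one>\<^bsub>?H\<^esub> = \<one>\<^bsub>homeo_group Q\<^esub>" by (simp add: H_group_def)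
  have mult: "a \<otimes>\<^bsub>?H\<^esub> b = a \<otimes>\<^bsub>homeo_group Q\<^esub> b" for a b by (simp add: H_group_def)
  have one_in: "\<one>\<^bsub>?H\<^esub> \<in> carrier ?H" unfolding one by (rule subgroup.one_closed[OF subgroup_H])
  have one_act: "\<phi> \<one>\<^bsub>?H\<^esub> x = x" if "x \<in> topspace X" for x
    using id_eq_one that by (metis restrict_apply')
  have act_in: "\<phi> g x \<in> topspace X" if "g \<in> carrier ?H" "x \<in> topspace X" for g x
    using element_image[OF that refl] .
  have act_mult: "\<phi> (star g \<otimes>\<^bsub>homeo_group Q\<^esub> star h) x = \<phi> (star g) (\<phi> (star h) x)"
    if "automorphism M g" "automorphism M h" "x \<in> topspace X" for g h x
    using composition_rule[OF that(3) star_H[OF that(1)] star_H[OF that(2)]] mult by simp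
  define R where "R x g U W N \<longleftrightarrow> automorphism M g \<and> openin ?T N \<and> \<one>\<^bsub>?H\<^esub> \<in> N \<and> openin X W \<and> x \<in> W \<and>
     (\<forall>y\<in>U. \<phi> (star g) y \<notin> U) \<and> (\<forall>s\<in>N. \<forall>y\<in>W. \<phi> s y \<in> U)" for x g U W N
  have "\<exists>g U W N. R x g U W N" if x: "x \<in> topspace X" for x
  proof -
    obtain g where g: "automorphism M g" "\<phi> (star g) x \<noteq> x" using no x by blast
    obtain A B where AB: "openin X A" "openin X B" "x \<in> A" "\<phi> (star g) x \<in> B" "disjnt A B"
      using X(2) x act_in[OF star_H[OF g(1)] x] g(2) unfolding Hausdorff_space_def by metis
    have "continuous_map X (prod_topology ?T X) (\<lambda>y. (star g, y))"
      using star_H[OF g(1)] topspace_H by (intro continuous_map_pairedI) simp_all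
    from continuous_map_compose[OF this cont]
    have "continuous_map X X (\<lambda>y. \<phi> (star g) y)" by (simp add: o_def)
    from openin_continuous_map_preimage[OF this AB(2)]
    have "openin X {y \<in> topspace X. \<phi> (star g) y \<in> B}" .
    then have U: "openin X (A \<inter> {y \<in> topspace X. \<phi> (star g) y \<in> B})" using AB(1) by blast
    \<comment> \<open>Points of this set lie in \<open>A\<close> and are sent into \<open>B\<close>,
      which is disjoint from \<open>A\<close>.\<close>
    define U where "U = A \<inter> {y \<in> topspace X. \<phi> (star g) y \<in> B}"
    have U1: "\<phi> (star g) y \<notin> U" if "y \<in> U" for y using that AB(5) unfolding U_def disjnt_iff by blast
    define Z where "Z = {p \<in> topspace (prod_topology ?T X). (\<lambda>(g, x). \<phi> g x) p \<in> U}"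
    have oZ: "openin (prod_topology ?T X) Z"
      unfolding Z_def by (rule openin_continuous_map_preimage[OF cont]) (use U in \<open>simp add: U_def\<close>)
    have mZ: "(\<one>\<^bsub>?H\<^esub>, x) \<in> Z"
      using one_in one_act[OF x] x AB topspace_H by (simp add: Z_def U_def)
    from oZ[unfolded openin_prod_topology_alt, THEN spec, THEN spec, THEN mp, OF mZ]
    obtain N W where NW: "openin ?T N" "openin X W" "\<one>\<^bsub>?H\<^esub> \<in> N" "x \<in> W" "N \<times> W \<subseteq> Z"
      by (elim exE conjE)
    have NWU: "\<forall>s\<in>N. \<forall>y\<in>W. \<phi> s y \<in> U" using NW(5) by (auto simp: Z_def)
    have "R x g U W N" unfolding R_def by (intro conjI g(1) NW(1-4) NWU ballI U1)
    then show ?thesis by (intro exI)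
  qed
  then have "\<forall>x\<in>topspace X. \<exists>g U W N. R x g U W N" by (rule ballI)
  from bchoice[OF this] obtain g where "\<forall>x\<in>topspace X. \<exists>U W N. R x (g x) U W N" by (elim exE)
  from bchoice[OF this] obtain U where "\<forall>x\<in>topspace X. \<exists>W N. R x (g x) (U x) W N" by (elim exE)
  from bchoice[OF this] obtain W where "\<forall>x\<in>topspace X. \<exists>N. R x (g x) (U x) (W x) N" by (elim exE)
  from bchoice[OF this] obtain N where R: "\<forall>x\<in>topspace X. R x (g x) (U x) (W x) (N x)" by (elim exE)
  have g: "automorphism M (g x)" and N: "openin ?T (N x)" "\<one>\<^bsub>?H\<^esub> \<in> N x" and W: "openin X (W x)" "x \<in> W x"
    and U: "\<forall>y\<in>U x. \<phi> (star (g x)) y \<notin> U x" and NW: "\<forall>s\<in>N x. \<forall>y\<in>W x. \<phi> s y \<in> U x"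
    if "x \<in> topspace X" for x
    using bspec[OF R that] unfolding R_def by simp_all
  have cX: "compactin X (topspace X)" using X(1) by (simp add: compact_space_def)
  have "(\<forall>A\<in>W ` topspace X. openin X A) \<and> topspace X \<subseteq> \<Union>(W ` topspace X)" using W by blast
  from cX[unfolded compactin_def, THEN conjunct2, THEN spec, THEN mp, OF this]
  obtain \<F> where \<F>: "finite \<F>" "\<F> \<subseteq> W ` topspace X" "topspace X \<subseteq> \<Union>\<F>" by blast
  obtain D where D: "finite D" "D \<subseteq> topspace X" "\<F> = W ` D" using finite_subset_image[OF \<F>(1,2)] by blast
  have cover: "\<exists>x\<in>D. y \<in> W x" if "y \<in> topspace X" for y using \<F>(3) D(3) that by blast
  have "stabilized (N x)" if "x \<in> D" for x
  proof -
    have xX: "x \<in> topspace X" using that D(2) by blast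
    obtain A where A: "openin (compact_open Q) A" "N x = A \<inter> carrier ?H"
      using N(1)[OF xX] unfolding H_topology_def openin_subtopology by blast
    have "stabilized A" using stabilized_open[OF A(1)] N(2)[OF xX] A(2) one by simp
    then show ?thesis using A(2) star_H unfolding stabilized_def by blast
  qed
  from stabilized_Inter[OF D(1), of N, OF this] obtain k n f where kn: "0 < k" "0 < n"
    and f: "epimorphism f M (std_fan k n)"
    and stab: "\<forall>h. automorphism M h \<longrightarrow> (\<forall>x\<in>S. f (h x) = f x) \<longrightarrow> (\<forall>x\<in>D. star h \<in> N x)" by blast
  obtain x0 where x0: "x0 \<in> topspace X" using X(3) by blast
  \<comment> \<open>The colour names a member of the cover that contains the translate of
    \<open>x0\<close>. All functions are coloured, so the others receive one fixed value, which
    keeps the range finite.\<close>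
  define col where "col h = (if automorphism M h then SOME x. x \<in> D \<and> \<phi> (star h) x0 \<in> W x else undefined)" for h
  have col: "col h \<in> D \<and> \<phi> (star h) x0 \<in> W (col h)" if h: "automorphism M h" for h
  proof -
    have "\<exists>x. x \<in> D \<and> \<phi> (star h) x0 \<in> W x" using cover[OF act_in[OF star_H[OF h] x0]] by blast
    from someI_ex[OF this] show ?thesis using h by (simp add: col_def)
  qed
  have "range col \<subseteq> insert undefined D" using col by (auto simp: col_def)
  then have fincol: "finite (range col)" using D(1) finite_subset by blast
  \<comment> \<open>The identity is included to control \<open>h\<close> itself along with
    \<open>g c \<circ> h\<close>; as the colour \<open>c\<close> is known only afterwards, all
    \<open>g x\<close> with \<open>x \<in> D\<close> are included.\<close>
  define F where "F = insert (\<lambda>x. x) (g ` D)"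
  have F: "finite F" "\<And>h. h \<in> F \<Longrightarrow> automorphism M h"
    using D g automorphism_id unfolding F_def by auto
  from automorphism_Ramsey[OF kn f F fincol] obtain c h where h: "automorphism M h"
    and mono: "\<forall>e\<in>F. \<exists>h'. automorphism M h' \<and> col h' = c \<and> (\<forall>x\<in>S. f (e (h x)) = f (h' x))" by blast
  have key: "c \<in> D \<and> \<phi> (star (e \<circ> h)) x0 \<in> U c" if e: "e \<in> F" for e
  proof -
    obtain h' where h': "automorphism M h'" "col h' = c" "\<forall>x\<in>S. f (e (h x)) = f (h' x)" using mono e by blast
    have cD: "c \<in> D" "\<phi> (star h') x0 \<in> W c" using col[OF h'(1)] h'(2) by auto
    have eh: "automorphism M (e \<circ> h)" by (rule automorphism_comp[OF F(2)[OF e] h])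
    \<comment> \<open>The left factor by which \<open>e \<circ> h\<close> differs from
      \<open>h'\<close>. It preserves \<open>f\<close>, so \<open>star s\<close> lies in
      \<open>N c\<close> and moves the translate by \<open>h'\<close> from \<open>W c\<close> to a
      point of \<open>U c\<close>.\<close>
    define s where "s = (e \<circ> h) \<circ> inv_into S h'"
    have s: "automorphism M s" unfolding s_def by (rule automorphism_comp[OF eh automorphism_inverse[OF h'(1)]])
    have h'S: "h' ` S = S" "inj_on h' S" using h'(1) by (auto simp: automorphism_def epimorphism_def)
    have "f (s x) = f x" if x: "x \<in> S" for x
    proof -
      have "inv_into S h' x \<in> S" "h' (inv_into S h' x) = x"
        using x h'S inv_into_into[of x h' S] f_inv_into_f[of x h' S] by auto
      then show ?thesis using h'(3) unfolding s_def by (metis comp_apply)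
    qed
    then have "star s \<in> N c" using stab s cD(1) by blast
    moreover have "c \<in> topspace X" using cD(1) D(2) by blast
    ultimately have "\<phi> (star s) (\<phi> (star h') x0) \<in> U c" using NW cD(2) by blast
    moreover have "star s \<otimes>\<^bsub>homeo_group Q\<^esub> star h' = star (e \<circ> h)"
      by (rule star_comp[OF s h'(1) eh]) (simp add: s_def inv_into_f_f[OF h'S(2)])
    ultimately show ?thesis using act_mult[OF s h'(1) x0] cD(1) by simp
  qed
  have c: "c \<in> D" "\<phi> (star h) x0 \<in> U c" using key[of "\<lambda>x. x"] unfolding F_def by (auto simp: o_def)
  then have cX: "c \<in> topspace X" using D(2) by blast
  have "\<phi> (star (g c \<circ> h)) x0 \<in> U c" using key[of "g c"] c(1) unfolding F_def by blast
  moreover have "star (g c) \<otimes>\<^bsub>homeo_group Q\<^esub> star h = star (g c \<circ> h)"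
    by (rule star_comp[OF g[OF cX] h automorphism_comp[OF g[OF cX] h]]) simp
  ultimately have "\<phi> (star (g c)) (\<phi> (star h) x0) \<in> U c" using act_mult[OF g[OF cX] h x0] by simp
  then show False using U[OF cX] c(2) by blast
qed

text \<open>The induced homeomorphisms are dense in the group. The orbit map of \<open>x\<close> and
  the constant map \<open>x\<close> are continuous into a Hausdorff space and agree on this dense
  set, hence everywhere.\<close>

lemma extremely_amenable_H: "extremely_amenable TYPE('x) (H_group M) (H_topology M)"
  unfolding extremely_amenable_def
proof (intro conjI allI impI)
  show "topological_group (H_group M) (H_topology M)" by (rule topological_group_H)
  fix X :: "'x topology" and \<phi>
  assume X: "compact_space X" "Hausdorff_space X" "topspace X \<noteq> {}"
    and act: "group_action (H_group M) (topspace X) \<phi>"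
    and cont: "continuous_map (prod_topology (H_topology M) X) X (\<lambda>(g, x). \<phi> g x)"
  from fixed_point_induced[OF this] obtain x where x: "x \<in> topspace X"
    and fixed: "\<forall>h. automorphism M h \<longrightarrow> \<phi> (star h) x = x" by blast
  have "\<phi> g x = x" if g: "g \<in> carrier (H_group M)" for g
  proof -
    have "g \<in> H_topology M closure_of induced_homeos M"
    proof -
      have "induced_homeos M \<subseteq> carrier (H_group M)" unfolding induced_homeos_eq using star_H by blast
      moreover have "g \<in> compact_open Q closure_of induced_homeos M" using g by (simp add: H_group_def)
      ultimately show ?thesis using g unfolding H_topology_def by (simp add: closure_of_subtopology Int_absorb1)
    qed
    moreover have "continuous_map (H_topology M) X (\<lambda>g. \<phi> g x)"
    proof -
      have "continuous_map (H_topology M) (prod_topology (H_topology M) X) (\<lambda>g. (g, x))"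
        using x by (intro continuous_map_pairedI) simp_all
      from continuous_map_compose[OF this cont] show ?thesis by (simp add: o_def)
    qed
    moreover have "continuous_map (H_topology M) X (\<lambda>g. x)" using x by simp
    moreover have "\<phi> g x = x" if "g \<in> induced_homeos M" for g
      using that fixed unfolding induced_homeos_eq by blast
    ultimately show ?thesis
      using forall_in_closure_of_eq[OF _ X(2), of g "H_topology M" "induced_homeos M" "\<lambda>g. \<phi> g x" "\<lambda>g. x"] by blast
  qed
  then show "\<exists>x\<in>topspace X. \<forall>g\<in>carrier (H_group M). \<phi> g x = x" using x by blast
qed

end

theorem theorem2p9:
  fixes \<L> :: "'a rel_struct"
  assumes "projective_Fraisse_limit {A. ordered_fan A} \<L>"
  shows "extremely_amenable TYPE('x) (H_group \<L>) (H_topology \<L>)"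
proof -
  interpret fan_limit \<L> by (rule fan_limit.intro[OF assms])
  show ?thesis by (rule extremely_amenable_H)
qed

end
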